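(* The verification of Distinct Max-Semi-Boolean Matrix Multiplication of size $n\times m\times m$ can be reduced to the verification of 2TRG Winning Set of order $n\times m\log m$.
   Context: Max-semi-boolean matrix multiplication of size $n_1\times n_2\times n_3$: given an $n_1\times n_2$ matrix $\mathbf A$ with entries in a totally ordered set (e.g. integers or reals) and an $n_2\times n_3$ boolean matrix $\mathbf B$, compute $(\mathbf A\star_{\max}\mathbf B)[i,j]=\max\{\mathbf A[i,k]: 1\le k\le n_2,\ \mathbf B[k,j]=1\}$. In the Distinct variant, $\mathbf A[i,k]\neq\mathbf A[i,k']$ whenever $k\ne k'$. Its verification: given $\mathbf A$, $\mathbf B$ and a candidate $n_1\times n_3$ matrix $\mathbf C$, decide whether $\mathbf C=\mathbf A\star_{\max}\mathbf B$. A game-graph is $\mathcal G=(\mathcal V,\mathcal E,\mathcal V^0,\mathcal V^1)$: finite configurations $\mathcal V$, moves $\mathcal E\subseteq\mathcal V\times\mathcal V$, and a partition of $\mathcal V$ into configurations controlled by player 0 (Alice) and player 1 (Bob). A play is a non-empty finite or infinite walk in $(\mathcal V,\mathcal E)$. A strategy for player $P$ is a map $s\colon\mathcal V^P\to\mathcal V\cup\{\bot\}$ with $(\sigma,s(\sigma))\in\mathcal E$ or $s(\sigma)=\bot$; a play conforms to $s$ if at each $\sigma_i\in\mathcal V^P$ either $\sigma_{i+1}=s(\sigma_i)\ne\bot$, or $s(\sigma_i)=\bot$ and $\sigma_i$ is the last configuration. A reachability game is $(\mathcal G,\mathcal F)$ with $\mathcal F=(\mathcal F^0,\mathcal F^1)$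 a partition of $\mathcal V$. A play is winning for $P$ if finite with last configuration in $\mathcal F^P$, surviving for $P$ if winning for $P$ or infinite. $\mathcal W^P$ (resp. $\mathcal S^P$) is the set of configurations $\sigma_0$ from which $P$ has a strategy all of whose conforming plays from $\sigma_0$ are winning (resp. surviving) for $P$. For finite directed graphs $G_0=(V_0,E_0)$, $G_1=(V_1,E_1)$, $\mathcal G(G_0,G_1)$ has configurations $\mathcal V^P=\{\langle P,u,v\rangle:u\in V_P,v\in V_{1-P}\}$ and moves $(\langle P,u,v\rangle,\langle1-P,v,u'\rangle)$ for $(u,u')\in E_P$, $v\in V_{1-P}$. 2TRG Winning Set of order $|V_0|\times|V_1|$: given $G_0,G_1,\mathcal F$, compute the winning and surviving sets of $(\mathcal G(G_0,G_1),\mathcal F)$; its verification asks whether given candidate sets equal these. *)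

theory Defs
  imports Complex_Main "Jordan_Normal_Form.Matrix" "Graph_Theory.Pair_Digraph"
begin

section \<open>Max-semi-boolean matrix multiplication\<close>

text \<open>
  \<open>None\<close> is the value of the maximum of the empty set; hence candidate products have
  entries in \<^typ>\<open>'a option\<close>.
\<close>

definition max_option :: "'a::linorder set \<Rightarrow> 'a option" where
  "max_option K = (if K = {} then None else Some (Max K))"

definition max_semi_boolean_mult :: "'a::linorder mat \<Rightarrow> bool mat \<Rightarrow> 'a option mat"
    (infixl \<open>\<star>\<^sub>m\<^sub>a\<^sub>x\<close> 70) where
  "A \<star>\<^sub>m\<^sub>a\<^sub>x B = mat (dim_row A) (dim_col B)
     (\<lambda>(i, j). max_option {A $$ (i, k) |k. k < dim_col A \<and> B $$ (k, j)})"

definition distinct_in_rows :: "'a mat \<Rightarrow> bool" where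
  "distinct_in_rows A \<longleftrightarrow>
     (\<forall>i < dim_row A. \<forall>k < dim_col A. \<forall>k' < dim_col A. k \<noteq> k' \<longrightarrow> A $$ (i, k) \<noteq> A $$ (i, k'))"

definition distinct_msb_instance ::
    "nat \<Rightarrow> nat \<Rightarrow> nat \<Rightarrow> 'a mat \<Rightarrow> bool mat \<Rightarrow> 'a option mat \<Rightarrow> bool" where
  "distinct_msb_instance n1 n2 n3 A B C \<longleftrightarrow>
     A \<in> carrier_mat n1 n2 \<and> B \<in> carrier_mat n2 n3 \<and> C \<in> carrier_mat n1 n3 \<and> distinct_in_rows A"


section \<open>Reachability games\<close>

datatype player = Alice | Bob

fun opponent :: "player \<Rightarrow> player" where
  "opponent Alice = Bob"
| "opponent Bob = Alice"

record 'v game_graph =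
  configs :: "'v set"
  moves :: "('v \<times> 'v) set"
  controlled :: "player \<Rightarrow> 'v set"

definition partitions :: "'v set \<Rightarrow> (player \<Rightarrow> 'v set) \<Rightarrow> bool" where
  "partitions V X \<longleftrightarrow> X Alice \<union> X Bob = V \<and> X Alice \<inter> X Bob = {}"

definition wf_game_graph :: "'v game_graph \<Rightarrow> bool" where
  "wf_game_graph G \<longleftrightarrow>
     finite (configs G) \<and> moves G \<subseteq> configs G \<times> configs G \<and> partitions (configs G) (controlled G)"

datatype 'v play = Finite_Play "'v list" | Infinite_Play "nat \<Rightarrow> 'v"

fun is_play :: "'v game_graph \<Rightarrow> 'v play \<Rightarrow> bool" where
  "is_play G (Finite_Play xs) \<longleftrightarrow>
     xs \<noteq> [] \<and> set xs \<subseteq> configs G \<and>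
     (\<forall>i. Suc i < length xs \<longrightarrow> (xs ! i, xs ! Suc i) \<in> moves G)"
| "is_play G (Infinite_Play f) \<longleftrightarrow>
     range f \<subseteq> configs G \<and> (\<forall>i. (f i, f (Suc i)) \<in> moves G)"

fun start :: "'v play \<Rightarrow> 'v" where
  "start (Finite_Play xs) = hd xs"
| "start (Infinite_Play f) = f 0"

text \<open>The value \<open>None\<close> of a strategy is the decision to stop; stopping is allowed even if
  there are moves available.\<close>

definition is_strategy :: "'v game_graph \<Rightarrow> player \<Rightarrow> ('v \<Rightarrow> 'v option) \<Rightarrow> bool" where
  "is_strategy G P s \<longleftrightarrow> (\<forall>\<sigma> \<in> controlled G P. \<forall>\<tau>. s \<sigma> = Some \<tau> \<longrightarrow> (\<sigma>, \<tau>) \<in> moves G)"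

fun conforms :: "'v game_graph \<Rightarrow> player \<Rightarrow> ('v \<Rightarrow> 'v option) \<Rightarrow> 'v play \<Rightarrow> bool" where
  "conforms G P s (Finite_Play xs) \<longleftrightarrow>
     (\<forall>i < length xs. xs ! i \<in> controlled G P \<longrightarrow>
        (Suc i < length xs \<and> s (xs ! i) = Some (xs ! Suc i)) \<or>
        (Suc i = length xs \<and> s (xs ! i) = None))"
| "conforms G P s (Infinite_Play f) \<longleftrightarrow>
     (\<forall>i. f i \<in> controlled G P \<longrightarrow> s (f i) = Some (f (Suc i)))"

fun winning_play :: "(player \<Rightarrow> 'v set) \<Rightarrow> player \<Rightarrow> 'v play \<Rightarrow> bool" where
  "winning_play F P (Finite_Play xs) \<longleftrightarrow> last xs \<in> F P"
| "winning_play F P (Infinite_Play f) \<longleftrightarrow> False"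

fun surviving_play :: "(player \<Rightarrow> 'v set) \<Rightarrow> player \<Rightarrow> 'v play \<Rightarrow> bool" where
  "surviving_play F P (Finite_Play xs) \<longleftrightarrow> winning_play F P (Finite_Play xs)"
| "surviving_play F P (Infinite_Play f) \<longleftrightarrow> True"

definition winning_set :: "'v game_graph \<Rightarrow> (player \<Rightarrow> 'v set) \<Rightarrow> player \<Rightarrow> 'v set" where
  "winning_set G F P = {\<sigma> \<in> configs G. \<exists>s. is_strategy G P s \<and>
     (\<forall>\<pi>. is_play G \<pi> \<and> start \<pi> = \<sigma> \<and> conforms G P s \<pi> \<longrightarrow> winning_play F P \<pi>)}"

definition surviving_set :: "'v game_graph \<Rightarrow> (player \<Rightarrow> 'v set) \<Rightarrow> player \<Rightarrow> 'v set" where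
  "surviving_set G F P = {\<sigma> \<in> configs G. \<exists>s. is_strategy G P s \<and>
     (\<forall>\<pi>. is_play G \<pi> \<and> start \<pi> = \<sigma> \<and> conforms G P s \<pi> \<longrightarrow> surviving_play F P \<pi>)}"


section \<open>Two-token reachability games\<close>

type_synonym 'v config = "player \<times> 'v \<times> 'v"

definition token_configs ::
    "(player \<Rightarrow> 'v pair_pre_digraph) \<Rightarrow> player \<Rightarrow> 'v config set" where
  "token_configs H P = {(P, u, v) |u v. u \<in> pverts (H P) \<and> v \<in> pverts (H (opponent P))}"

definition token_game :: "(player \<Rightarrow> 'v pair_pre_digraph) \<Rightarrow> 'v config game_graph" where
  "token_game H = \<lparr>
     configs = token_configs H Alice \<union> token_configs H Bob,
     moves = {((P, u, v), (opponent P, v, u')) |P u v u'.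
        (u, u') \<in> parcs (H P) \<and> v \<in> pverts (H (opponent P))},
     controlled = token_configs H \<rparr>"

lemma wf_token_game:
  assumes "\<And>P. pair_fin_digraph (H P)"
  shows "wf_game_graph (token_game H)"
proof -
  have fin: "finite (pverts (H P))" for P
    using assms[of P] by (simp add: pair_fin_digraph_def pair_fin_digraph_axioms_def)
  have wf: "u \<in> pverts (H P) \<and> u' \<in> pverts (H P)" if "(u, u') \<in> parcs (H P)" for P u u'
    using assms[of P] that
    by (meson pair_fin_digraph.axioms(1) pair_wf_digraph.in_arcsD1 pair_wf_digraph.in_arcsD2)
  have eq: "token_configs H P = {P} \<times> pverts (H P) \<times> pverts (H (opponent P))" for P
    by (auto simp: token_configs_def)
  have move: "(P, u, v) \<in> configs (token_game H) \<and> (opponent P, v, u') \<in> configs (token_game H)"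
    if "(u, u') \<in> parcs (H P)" "v \<in> pverts (H (opponent P))" for P u v u'
    using wf[OF that(1)] that(2) by (cases P) (auto simp: token_game_def eq)
  have "moves (token_game H) \<subseteq> configs (token_game H) \<times> configs (token_game H)"
    using move by (force simp: token_game_def)
  then show ?thesis
    using fin by (auto simp: wf_game_graph_def partitions_def token_game_def eq)
qed

record 'v trg_verification =
  graphs :: "player \<Rightarrow> 'v pair_pre_digraph"
  targets :: "player \<Rightarrow> 'v config set"
  cand_win :: "player \<Rightarrow> 'v config set"
  cand_surv :: "player \<Rightarrow> 'v config set"

definition trg_instance :: "'v trg_verification \<Rightarrow> bool" where
  "trg_instance I \<longleftrightarrow>
     (\<forall>P. pair_fin_digraph (graphs I P)) \<and>
     partitions (configs (token_game (graphs I))) (targets I)"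

definition trg_correct :: "'v trg_verification \<Rightarrow> bool" where
  "trg_correct I \<longleftrightarrow> (\<forall>P.
     cand_win I P = winning_set (token_game (graphs I)) (targets I) P \<and>
     cand_surv I P = surviving_set (token_game (graphs I)) (targets I) P)"


section \<open>Word RAM programs over a totally ordered set\<close>

text \<open>
  A structured word RAM with finitely many registers and arrays per program. Matrix entries from
  the ordered set live in separate read-only arrays and are accessible only through unit-cost
  comparisons. A word is a natural number below a bound \<open>M\<close>; a write of a larger value, or to an
  address outside the bound, blocks execution. Since a fixed program contains only finitely many
  expressions, evaluating one of them takes a constant number of operations, on operands that are
  polynomial in \<open>M\<close> and the literals of the program; each command or test is therefore charged
  one step.
\<close>

type_synonym name = string

datatype aexp =
    Lit nat | Reg name | Cell name aexp
  | Add aexp aexp | Sub aexp aexp | Mul aexp aexp | Quot aexp aexp | Rem aexp aexp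

datatype bexp =
    Less aexp aexp
  | Entry_Less name aexp name aexp
  | Neg bexp | Conj bexp bexp

datatype com =
    Skip
  | Assign name aexp
  | Store name aexp aexp
  | Seq com com
  | Cond bexp com com
  | While bexp com

record state =
  regs :: "name \<Rightarrow> nat"
  cells :: "name \<Rightarrow> nat \<Rightarrow> nat"

fun aval :: "state \<Rightarrow> aexp \<Rightarrow> nat" where
  "aval s (Lit k) = k"
| "aval s (Reg x) = regs s x"
| "aval s (Cell x a) = cells s x (aval s a)"
| "aval s (Add a b) = aval s a + aval s b"
| "aval s (Sub a b) = aval s a - aval s b"
| "aval s (Mul a b) = aval s a * aval s b"
| "aval s (Quot a b) = aval s a div aval s b"
| "aval s (Rem a b) = aval s a mod aval s b"

fun bval :: "(name \<Rightarrow> nat \<Rightarrow> 'a::linorder) \<Rightarrow> state \<Rightarrow> bexp \<Rightarrow> bool" where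
  "bval E s (Less a b) \<longleftrightarrow> aval s a < aval s b"
| "bval E s (Entry_Less x a y b) \<longleftrightarrow> E x (aval s a) < E y (aval s b)"
| "bval E s (Neg b) \<longleftrightarrow> \<not> bval E s b"
| "bval E s (Conj b c) \<longleftrightarrow> bval E s b \<and> bval E s c"

definition set_reg :: "name \<Rightarrow> nat \<Rightarrow> state \<Rightarrow> state" where
  "set_reg x k s = s\<lparr>regs := (regs s)(x := k)\<rparr>"

definition set_cell :: "name \<Rightarrow> nat \<Rightarrow> nat \<Rightarrow> state \<Rightarrow> state" where
  "set_cell x a k s = s\<lparr>cells := (cells s)(x := (cells s x)(a := k))\<rparr>"

text \<open>\<open>exec M E p s t s'\<close>: with word bound \<open>M\<close> and entry arrays \<open>E\<close>, program \<open>p\<close> started in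
  \<open>s\<close> halts in \<open>s'\<close> after \<open>t\<close> steps.\<close>

inductive exec ::
    "nat \<Rightarrow> (name \<Rightarrow> nat \<Rightarrow> 'a::linorder) \<Rightarrow> com \<Rightarrow> state \<Rightarrow> nat \<Rightarrow> state \<Rightarrow> bool"
  for M E where
  Skip: "exec M E Skip s 1 s"
| Assign: "aval s a < M \<Longrightarrow> exec M E (Assign x a) s 1 (set_reg x (aval s a) s)"
| Store: "aval s a < M \<Longrightarrow> aval s b < M \<Longrightarrow>
    exec M E (Store x a b) s 1 (set_cell x (aval s a) (aval s b) s)"
| Seq: "exec M E p s t s' \<Longrightarrow> exec M E q s' t' s'' \<Longrightarrow> exec M E (Seq p q) s (t + t') s''"
| Cond_True: "bval E s b \<Longrightarrow> exec M E p s t s' \<Longrightarrow> exec M E (Cond b p q) s (Suc t) s'"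
| Cond_False: "\<not> bval E s b \<Longrightarrow> exec M E q s t s' \<Longrightarrow> exec M E (Cond b p q) s (Suc t) s'"
| While_False: "\<not> bval E s b \<Longrightarrow> exec M E (While b p) s 1 s"
| While_True: "bval E s b \<Longrightarrow> exec M E p s t s' \<Longrightarrow> exec M E (While b p) s' t' s'' \<Longrightarrow>
    exec M E (While b p) s (Suc (t + t')) s''"


section \<open>Encodings of instances\<close>

text \<open>
  The dimensions are in the registers \<open>n1\<close>, \<open>n2\<close>, \<open>n3\<close>; matrices are stored row by row.
  The word array \<open>C\<close> tells which entries of \<open>C\<close> are different from \<open>None\<close>; the other
  cells of the entry array \<open>C\<close> carry no information. All remaining words are zero.
\<close>

definition msb_input :: "nat \<Rightarrow> nat \<Rightarrow> nat \<Rightarrow> bool mat \<Rightarrow> 'a option mat \<Rightarrow> state" where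
  "msb_input n1 n2 n3 B C = \<lparr>
     regs = (\<lambda>_. 0)(''n1'' := n1, ''n2'' := n2, ''n3'' := n3),
     cells = (\<lambda>_ _. 0)(
       ''B'' := (\<lambda>a. of_bool (a < n2 * n3 \<and> B $$ (a div n3, a mod n3))),
       ''C'' := (\<lambda>a. of_bool (a < n1 * n3 \<and> C $$ (a div n3, a mod n3) \<noteq> None))) \<rparr>"

definition msb_entries ::
    "nat \<Rightarrow> nat \<Rightarrow> nat \<Rightarrow> 'a mat \<Rightarrow> 'a option mat \<Rightarrow> name \<Rightarrow> nat \<Rightarrow> 'a" where
  "msb_entries n1 n2 n3 A C = (\<lambda>_ _. undefined)(
     ''A'' := (\<lambda>a. if a < n1 * n2 then A $$ (a div n2, a mod n2) else undefined),
     ''C'' := (\<lambda>a. if a < n1 * n3 \<and> C $$ (a div n3, a mod n3) \<noteq> None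
                   then the (C $$ (a div n3, a mod n3)) else undefined))"

fun tag :: "player \<Rightarrow> name \<Rightarrow> name" where
  "tag Alice x = x @ ''0''"
| "tag Bob x = x @ ''1''"

text \<open>
  The graph of player \<open>P\<close> has vertices \<open>0, \<dots>, V\<^sub>P - 1\<close> and a list of \<open>E\<^sub>P\<close> arcs, given by the
  arrays \<open>src\<^sub>P\<close> and \<open>dst\<^sub>P\<close>. A set of configurations is a bit array, in which those of Alice
  precede those of Bob and each half is a matrix indexed by the vertices of Alice's and Bob's
  tokens.
\<close>

definition out_graph :: "state \<Rightarrow> player \<Rightarrow> nat pair_pre_digraph" where
  "out_graph s P = \<lparr>
     pverts = {..<regs s (tag P ''V'')},
     parcs = (\<lambda>e. (cells s (tag P ''src'') e, cells s (tag P ''dst'') e)) ` {..<regs s (tag P ''E'')} \<rparr>"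

fun config_address :: "state \<Rightarrow> nat config \<Rightarrow> nat" where
  "config_address s (Alice, u, v) = u * regs s (tag Bob ''V'') + v"
| "config_address s (Bob, v, u) =
     regs s (tag Alice ''V'') * regs s (tag Bob ''V'') + u * regs s (tag Bob ''V'') + v"

definition out_configs :: "state \<Rightarrow> name \<Rightarrow> nat config set" where
  "out_configs s x =
     {\<sigma> \<in> configs (token_game (out_graph s)). cells s x (config_address s \<sigma>) \<noteq> 0}"

definition trg_output :: "state \<Rightarrow> nat trg_verification" where
  "trg_output s = \<lparr>
     graphs = out_graph s,
     targets = (\<lambda>P. out_configs s (tag P ''F'')),
     cand_win = (\<lambda>P. out_configs s (tag P ''W'')),
     cand_surv = (\<lambda>P. out_configs s (tag P ''S'')) \<rparr>"

end

theory Submission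
  imports Defs
begin

text \<open>
  The product \<open>C\<close> is correct iff every entry of \<open>C\<close> is attained and, for each row \<open>i\<close> of \<open>A\<close>, no
  \<open>k\<close> with \<open>B[k,j] = 1\<close> has \<open>A[i,k] > C[i,j]\<close>. Attainment is checked directly: once the values
  \<open>A[i,k]\<close> and \<open>C[i,j]\<close> of a row are sorted, the only possible witness \<open>k\<close> for \<open>C[i,j]\<close> is the last
  one before it. For the upper bound, consider the digraph with the arcs \<open>j \<rightarrow> k\<close> for \<open>B[k,j] = 1\<close> and
  an arc from each of these \<open>2m\<close> elements to its predecessor in the sorted order: it has a cycle
  iff some \<open>k\<close> with \<open>B[k,j] = 1\<close> lies above \<open>j\<close>. The order depends on \<open>i\<close>, but the predecessor map is
  a permutation, which a Benes network with \<open>O(m log m)\<close> switches realises for every \<open>i\<close> with a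
  different setting of the switches. Bob's graph is this network together with the arcs of \<open>B\<close>;
  Alice's token stays on \<open>i\<close>, and the targets let her stop and win as soon as Bob violates the
  setting for \<open>i\<close>. So Bob survives somewhere iff one of the digraphs has a cycle, and otherwise
  Alice wins everywhere.
\<close>

section \<open>Routing permutations\<close>

text \<open>The targets may depend on the row \<open>i\<close>, but only through configurations,
  never through moves. A switch setting therefore has to be visible in a vertex: Bob announces the
  next digit when he enters a wire, and an announcement that contradicts the setting for
  \<open>i\<close> makes the configuration a target of Alice. From every vertex at most one legal
  continuation inside the network remains.

  The predecessor map of a linear order misses the least element. Closing it cyclically makes it a
  permutation, but the closing arc from the least to the greatest element would create a cycle for
  every \<open>i\<close>. Padding to a power of two that strictly exceeds \<open>2 * m\<close>
  supplies idle wires; they are put lowest in the order and have no arcs into the network, so that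
  the closing arc disappears.

  Ties matter as well: an attained value has \<open>A[i,k] = C[i,j]\<close> and must not count as a
  violation, so a row precedes a column of the same value. That the last row before a column is its
  only possible witness is due to the distinct entries in each row of \<open>A\<close>.\<close>

definition set_digit :: "nat \<Rightarrow> nat \<Rightarrow> nat \<Rightarrow> nat" where
  "set_digit w b x = x div (2 * w) * (2 * w) + b * w + x mod w"

definition flip_digit :: "nat \<Rightarrow> nat \<Rightarrow> nat" where
  "flip_digit w x = set_digit w (1 - x div w mod 2) x"

text \<open>The summands are the digits above weight \<open>w\<close>, the digit of weight
  \<open>w\<close> and the rest. The lemmas on digits ask at most for \<open>w > 0\<close>; powers
  of two enter only later, through \<open>weight\<close>.\<close>

lemma digit_expansion: "x = x div (2 * w) * (2 * w) + x div w mod 2 * w + x mod (w::nat)"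
proof -
  have "x div (2 * w) = x div w div 2" by (simp add: div_mult2_eq mult.commute)
  then have "x div (2 * w) * 2 + x div w mod 2 = x div w" by simp
  then have "(x div (2 * w) * 2 + x div w mod 2) * w + x mod w = x" by simp
  then show ?thesis by (simp add: algebra_simps)
qed

lemma set_digit_mod: "w > 0 \<Longrightarrow> set_digit w b x mod w = x mod w"
proof -
  have "set_digit w b x = x mod w + (x div (2 * w) * 2 + b) * w"
    by (simp add: set_digit_def algebra_simps)
  then show ?thesis by simp
qed

lemma set_digit_div: "w > 0 \<Longrightarrow> set_digit w b x div w = x div (2 * w) * 2 + b"
proof -
  assume "w > 0"
  moreover have "set_digit w b x = x mod w + (x div (2 * w) * 2 + b) * w"
    by (simp add: set_digit_def algebra_simps)
  ultimately show ?thesis by simp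
qed

lemma set_digit_bit: "w > 0 \<Longrightarrow> b < 2 \<Longrightarrow> set_digit w b x div w mod 2 = b"
  by (simp add: set_digit_div)

lemma set_digit_high: "w > 0 \<Longrightarrow> b < 2 \<Longrightarrow> set_digit w b x div (2 * w) = x div (2 * w)"
proof -
  assume "w > 0" "b < 2"
  then have "set_digit w b x div w div 2 = x div (2 * w)" by (simp add: set_digit_div)
  then show ?thesis by (simp add: div_mult2_eq mult.commute)
qed

lemma digits_eqI:
  assumes "x mod w = y mod w" "x div w mod 2 = y div w mod 2" "x div (2 * w) = y div (2 * (w::nat))"
  shows "x = y"
  using digit_expansion[of x w] digit_expansion[of y w] assms by simp

lemma set_digit_same: "set_digit w (x div w mod 2) x = x"
  using digit_expansion[of x w] by (simp add: set_digit_def)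

lemma set_digit_set_digit: "w > 0 \<Longrightarrow> b < 2 \<Longrightarrow> set_digit w c (set_digit w b x) = set_digit w c x"
  by (simp add: set_digit_def[of w c] set_digit_high set_digit_mod)

lemma set_digit_less:
  assumes "w > 0" "b < 2" "x < K" "2 * w dvd K"
  shows "set_digit w b x < K"
proof -
  obtain k where k: "K = 2 * w * k" using assms(4) by blast
  have "set_digit w b x div (2 * w) < k"
    using assms(1-3) by (simp add: set_digit_high k) (simp add: less_mult_imp_div_less mult.commute)
  then show ?thesis
    using assms(1) by (simp add: k div_less_iff_less_mult mult.commute)
qed

text \<open>Two numbers that agree below weight \<open>w\<close> agree below \<open>2 * w\<close>
  once the same digit is written into both. In this way the stretch of low digits respected by the
  routed permutation grows by one per stage.\<close>

lemma set_digit_mod_double: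
  assumes "w > 0" "b < 2"
  shows "set_digit w b x mod (2 * w) = b * w + x mod w"
proof -
  have "b * w + x mod w < 2 * w"
    using assms by (cases b) (auto simp: less_Suc_eq intro: mod_less_divisor less_le_trans)
  then show ?thesis by (simp add: set_digit_def add.assoc)
qed

lemma flip_digit_less: "w > 0 \<Longrightarrow> x < K \<Longrightarrow> 2 * w dvd K \<Longrightarrow> flip_digit w x < K"
  by (simp add: flip_digit_def set_digit_less)

lemma flip_digit_neq: "w > 0 \<Longrightarrow> flip_digit w x \<noteq> x"
proof
  assume "w > 0" "flip_digit w x = x"
  moreover have "1 - x div w mod 2 < 2" by linarith
  ultimately have "1 - x div w mod 2 = x div w mod 2"
    using set_digit_bit[of w "1 - x div w mod 2" x] by (simp add: flip_digit_def)
  moreover have "x div w mod 2 = 0 \<or> x div w mod 2 = 1" by auto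
  ultimately show False by auto
qed

lemma flip_digit_flip: "w > 0 \<Longrightarrow> flip_digit w (flip_digit w x) = x"
proof -
  assume w: "w > 0"
  have "1 - (1 - x div w mod 2) = x div w mod 2" by (simp add: mod2_eq_if)
  then show ?thesis using w
    by (simp add: flip_digit_def set_digit_bit set_digit_set_digit set_digit_same)
qed

text \<open>A switch can merge only a wire and its flip. Hence a stage is injective as soon as the
  two members of each such pair receive different digits.\<close>

lemma set_digit_eq_imp:
  assumes "w > 0" "b < 2" "set_digit w b x = set_digit w b y"
  shows "y = x \<or> y = flip_digit w x"
proof -
  have low: "x mod w = y mod w"
    using set_digit_mod[of w b x] set_digit_mod[of w b y] assms by simp
  have high: "x div (2 * w) = y div (2 * w)"
    using set_digit_high[of w b x] set_digit_high[of w b y] assms by simp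
  show ?thesis
  proof (cases "x div w mod 2 = y div w mod 2")
    case True
    with low high show ?thesis using digits_eqI by blast
  next
    case False
    then have bit: "y div w mod 2 = 1 - x div w mod 2" by (auto simp: mod2_eq_if split: if_splits)
    have "1 - x div w mod 2 < 2" by linarith
    then have "y = flip_digit w x"
      using assms(1) low high bit
      by (intro digits_eqI[of y w]) (simp_all add: flip_digit_def set_digit_bit set_digit_mod set_digit_high)
    then show ?thesis ..
  qed
qed

text \<open>Two fixed-point-free involutions \<open>f\<close> and \<open>g\<close> have a common proper 2-colouring, which is found
  by walking along the cycles of \<open>g \<circ> f\<close>. In a partial colouring, the colour 2 means
  uncoloured, and \<open>y\<close> is the point at which the walk continues.\<close>

locale two_involutions =
  fixes N :: nat and f g :: "nat \<Rightarrow> nat"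
  assumes f: "x < N \<Longrightarrow> f x < N" "x < N \<Longrightarrow> f (f x) = x" "x < N \<Longrightarrow> f x \<noteq> x"
    and g: "x < N \<Longrightarrow> g x < N" "x < N \<Longrightarrow> g (g x) = x" "x < N \<Longrightarrow> g x \<noteq> x"
begin

definition partial_colouring :: "(nat \<Rightarrow> nat) \<Rightarrow> nat \<Rightarrow> bool" where
  "partial_colouring k y \<longleftrightarrow> (\<forall>x < N. k x \<le> 2 \<and> (k x = 0 \<longrightarrow> k (f x) = 1) \<and>
     (k x = 1 \<longrightarrow> k (f x) = 0 \<and> (k (g x) = 0 \<or> g x = y \<and> k y = 2)))"

definition uncoloured :: "(nat \<Rightarrow> nat) \<Rightarrow> nat set" where
  "uncoloured k = {x. x < N \<and> k x = 2}"

lemma partial_colouring_init: "(\<And>x. x < N \<Longrightarrow> k x = 2) \<Longrightarrow> partial_colouring k y"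
  by (simp add: partial_colouring_def)

lemma partial_colouring_skip: "partial_colouring k y \<Longrightarrow> k y < 2 \<Longrightarrow> partial_colouring k y'"
  by (auto simp: partial_colouring_def)

text \<open>Colouring \<open>y\<close> and \<open>f y\<close> settles their pair under
  \<open>f\<close> at once. Only the pair of \<open>f y\<close> under \<open>g\<close> may stay
  open, so the walk continues at \<open>g (f y)\<close>. That point cannot have colour 1 already:
  its partner \<open>f y\<close> was uncoloured, which the invariant tolerates for the partner
  \<open>y\<close> only.\<close>

lemma partial_colouring_step:
  assumes pc: "partial_colouring k y" and y: "y < N" "k y = 2"
  defines "k' \<equiv> k(y := 0, f y := 1)"
  shows "partial_colouring k' (g (f y))" "uncoloured k' \<subset> uncoloured k"
    "k' (g (f y)) = 0 \<or> k' (g (f y)) = 2"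
proof -
  have P: "k x \<le> 2" "k x = 0 \<Longrightarrow> k (f x) = 1" "k x = 1 \<Longrightarrow> k (f x) = 0"
    "k x = 1 \<Longrightarrow> k (g x) = 0 \<or> g x = y \<and> k y = 2" if "x < N" for x
    using pc that by (auto simp: partial_colouring_def)
  have kfy: "k (f y) = 2"
  proof -
    have "k (f y) \<noteq> 0" "k (f y) \<noteq> 1" "k (f y) \<le> 2"
      using P(1)[of "f y"] P(2)[of "f y"] P(3)[of "f y"] f y by auto
    then show ?thesis by linarith
  qed
  have fy: "f y \<noteq> y" "f y < N" using f y by auto
  have k': "k' y = 0" "k' (f y) = 1" "x \<noteq> y \<Longrightarrow> x \<noteq> f y \<Longrightarrow> k' x = k x" for x
    using fy by (auto simp: k'_def)
  have gfy: "g (f y) \<noteq> f y" "g (f y) < N" using g fy by auto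
  show k'gfy: "k' (g (f y)) = 0 \<or> k' (g (f y)) = 2"
  proof (rule ccontr)
    assume a: "\<not> ?thesis"
    then have "g (f y) \<noteq> y" using k' by auto
    then have "k (g (f y)) = 1" using a k'(3)[of "g (f y)"] gfy P(1)[of "g (f y)"] by auto
    then have "k (f y) = 0 \<or> f y = y" using P(4)[of "g (f y)"] gfy g(2)[OF fy(2)] by auto
    then show False using kfy fy by auto
  qed
  have fne: "f x \<noteq> y" "f x \<noteq> f y" if "x < N" "x \<noteq> y" "x \<noteq> f y" for x
    using f(2) that y by metis+
  have "k' x \<le> 2 \<and> (k' x = 0 \<longrightarrow> k' (f x) = 1) \<and> (k' x = 1 \<longrightarrow> k' (f x) = 0 \<and>
      (k' (g x) = 0 \<or> g x = g (f y) \<and> k' (g (f y)) = 2))" if x: "x < N" for x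
  proof (cases "x = y \<or> x = f y")
    case True
    then show ?thesis using k' k'gfy f(2)[OF y(1)] by auto
  next
    case False
    have "k' (g x) = 0" if "k x = 1"
    proof -
      from P(4)[OF x that] show ?thesis
      proof
        assume "k (g x) = 0"
        then have "g x \<noteq> y" "g x \<noteq> f y" using y kfy by auto
        then show ?thesis using k' \<open>k (g x) = 0\<close> by simp
      next
        assume "g x = y \<and> k y = 2" then show ?thesis using k' by simp
      qed
    qed
    then show ?thesis using False fne[OF x] k' P[OF x] by auto
  qed
  then show "partial_colouring k' (g (f y))" by (simp add: partial_colouring_def)
  show "uncoloured k' \<subset> uncoloured k"
    using y kfy by (auto simp: uncoloured_def k'_def)
qed

text \<open>The invariant controls \<open>g\<close> only at points of colour 1. The converse follows
  by counting: \<open>f\<close> injects colour 0 into colour 1 and \<open>g\<close> injects colour 1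
  into colour 0, so the classes have equal size and \<open>g\<close> is onto colour 0.\<close>

lemma complete_colouring:
  assumes pc: "partial_colouring k y" and all: "\<And>x. x < N \<Longrightarrow> k x \<noteq> 2" and x: "x < N"
  shows "k x < 2" "k (f x) = 1 - k x" "k (g x) = 1 - k x"
proof -
  have P: "k x < 2" "k x = 0 \<Longrightarrow> k (f x) = 1" "k x = 1 \<Longrightarrow> k (f x) = 0"
    "k x = 1 \<Longrightarrow> k (g x) = 0" if "x < N" for x
  proof -
    have "k x \<le> 2" using pc that by (simp add: partial_colouring_def)
    then show "k x < 2" using all[OF that] by simp
    have "k x = 1 \<longrightarrow> k (g x) = 0 \<or> k y = 2 \<and> g x = y"
      using pc that unfolding partial_colouring_def by blast
    then show "k x = 1 \<Longrightarrow> k (g x) = 0" using all[OF g(1)[OF that]] by auto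
    show "k x = 0 \<Longrightarrow> k (f x) = 1" "k x = 1 \<Longrightarrow> k (f x) = 0"
      using pc that unfolding partial_colouring_def by blast+
  qed
  show k2: "k x < 2" using P x by simp
  then have cases: "k x = 0 \<or> k x = 1" by auto
  show "k (f x) = 1 - k x" using cases P x by auto
  define O0 O1 where "O0 = {x. x < N \<and> k x = 0}" and "O1 = {x. x < N \<and> k x = 1}"
  have fin: "finite O0" "finite O1" by (auto simp: O0_def O1_def)
  have "f ` O0 \<subseteq> O1" "inj_on f O0"
    using P f by (auto simp: O0_def O1_def inj_on_def) metis
  then have "card O0 \<le> card O1" using fin card_inj_on_le by blast
  have gO: "g ` O1 \<subseteq> O0" "inj_on g O1"
    using P g by (auto simp: O0_def O1_def inj_on_def) metis
  then have "card (g ` O1) = card O1" by (simp add: card_image)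
  then have "g ` O1 = O0"
    using \<open>card O0 \<le> card O1\<close> gO(1) fin by (intro card_seteq) auto
  have "k (g x) = 1" if "k x = 0"
  proof -
    have "x \<in> g ` O1" using that x \<open>g ` O1 = O0\<close> by (simp add: O0_def)
    then show ?thesis using g(2) by (auto simp: O1_def)
  qed
  then show "k (g x) = 1 - k x" using cases P(4)[OF x] by auto
qed

end

section \<open>Composition of the stages of a Benes network\<close>

primrec iterate_from :: "(nat \<Rightarrow> 'a \<Rightarrow> 'a) \<Rightarrow> nat \<Rightarrow> nat \<Rightarrow> 'a \<Rightarrow> 'a" where
  "iterate_from f s 0 x = x"
| "iterate_from f s (Suc d) x = iterate_from f (Suc s) d (f s x)"

lemma iterate_from_add:
  "iterate_from f s (d + e) x = iterate_from f (s + d) e (iterate_from f s d x)"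
  by (induction d arbitrary: s x) simp_all

text \<open>Induction outwards from the middle: stages \<open>t\<close> and
  \<open>2 * L - 1 - t\<close> are the outer switches, and the smaller network between them realises
  \<open>\<tau> (Suc t)\<close>. In the middle nothing is left to do, because
  \<open>\<tau> L\<close> is the identity.\<close>

lemma benes_routes:
  assumes range: "\<And>t x. t < L \<Longrightarrow> x < N \<Longrightarrow> f t x < N"
    and step: "\<And>t x. t < L \<Longrightarrow> x < N \<Longrightarrow> f (2 * L - 1 - t) (\<tau> (Suc t) (f t x)) = \<tau> t x"
    and id: "\<And>x. x < N \<Longrightarrow> \<tau> L x = x"
    and "t \<le> L" "x < N"
  shows "iterate_from f t (2 * (L - t)) x = \<tau> t x"
  using assms(4,5)
proof (induction "L - t" arbitrary: t x)
  case 0 then show ?case using id by simp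
next
  case (Suc d)
  have t: "t < L" "L - Suc t = d" using Suc by auto
  have "2 * (L - t) = Suc (2 * (L - Suc t) + 1)" using t by simp
  then have "iterate_from f t (2 * (L - t)) x =
      iterate_from f (Suc t + 2 * (L - Suc t)) 1 (iterate_from f (Suc t) (2 * (L - Suc t)) (f t x))"
    by (simp only: iterate_from.simps iterate_from_add)
  also have "\<dots> = f (Suc t + 2 * (L - Suc t)) (\<tau> (Suc t) (f t x))"
    using Suc.hyps(1)[of "Suc t" "f t x"] t range Suc.prems by simp
  also have "Suc t + 2 * (L - Suc t) = 2 * L - 1 - t" using t by simp
  finally show ?case using step t Suc.prems by simp
qed

section \<open>Merging\<close>

locale preordered =
  fixes le :: "nat \<Rightarrow> nat \<Rightarrow> bool"
  assumes refl: "le x x" and trans: "le x y \<Longrightarrow> le y z \<Longrightarrow> le x z" and total: "le x y \<or> le y x"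
begin

definition sorted_blocks :: "nat \<Rightarrow> (nat \<Rightarrow> nat) \<Rightarrow> nat \<Rightarrow> bool" where
  "sorted_blocks w a K \<longleftrightarrow> (\<forall>x y. x < y \<longrightarrow> y < K \<longrightarrow> x div w = y div w \<longrightarrow> le (a x) (a y))"

text \<open>The block starts at \<open>z\<close>; \<open>a\<close> and \<open>b\<close> are the next
  unread positions of its two halves, and \<open>q\<close> is the next position to be written. The
  last clause puts everything written in this block below everything unread. Images can replace
  multisets, since the arrays to be sorted hold permutations of an initial segment.\<close>

definition merging :: "nat \<Rightarrow> (nat \<Rightarrow> nat) \<Rightarrow> (nat \<Rightarrow> nat) \<Rightarrow> nat \<Rightarrow> nat \<Rightarrow> nat \<Rightarrow> nat \<Rightarrow> bool" where
  "merging w src dst z q a b \<longleftrightarrow> z mod (2 * w) = 0 \<and> z \<le> a \<and> a \<le> z + w \<and> z + w \<le> b \<and> b \<le> z + 2 * w \<and>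
     a + b = q + z + w \<and> dst ` {..<q} = src ` ({..<a} \<union> {z + w..<b}) \<and> sorted_blocks (2 * w) dst q \<and>
     (\<forall>x y. z \<le> x \<longrightarrow> x < q \<longrightarrow> a \<le> y \<and> y < z + w \<or> b \<le> y \<and> y < z + 2 * w \<longrightarrow> le (dst x) (src y))"

definition merged :: "nat \<Rightarrow> (nat \<Rightarrow> nat) \<Rightarrow> (nat \<Rightarrow> nat) \<Rightarrow> nat \<Rightarrow> bool" where
  "merged w src dst q \<longleftrightarrow> q mod (2 * w) = 0 \<and> dst ` {..<q} = src ` {..<q} \<and> sorted_blocks (2 * w) dst q"

lemma merged_0: "merged w src dst 0"
  by (simp add: merged_def sorted_blocks_def)

lemma merging_start: "merged w src dst q \<Longrightarrow> merging w src dst q q q (q + w)"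
  by (auto simp: merged_def merging_def)

lemma merging_done:
  assumes "merging w src dst z (z + 2 * w) a b"
  shows "merged w src dst (z + 2 * w)"
proof -
  have "a = z + w" "b = z + 2 * w" using assms by (auto simp: merging_def)
  moreover have "{..<z + w} \<union> {z + w..<z + 2 * w} = {..<z + 2 * w}" by auto
  ultimately show ?thesis using assms by (simp add: merging_def merged_def)
qed

lemma div_eq_same_block:
  fixes z w :: nat
  assumes "z mod w = 0" "z \<le> x" "x < z + w"
  shows "x div w = z div w"
proof -
  obtain k where k: "z = w * k" using assms(1) by (auto simp: mod_eq_0_iff_dvd)
  then have "x = w * k + (x - z)" "x - z < w" using assms by auto
  then have "x div w = k" by (metis add_diff_cancel_left' div_mult_self4 assms(3) div_less
        add.right_neutral less_nat_zero_code mult_0 not_gr_zero)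
  moreover have "z div w = k" using k \<open>x - z < w\<close> by (cases "w = 0") auto
  ultimately show ?thesis by simp
qed

lemma same_block_ge:
  fixes z w :: nat
  assumes "z mod w = 0" "x < z" "z \<le> y"
  shows "x div w \<noteq> y div w"
proof -
  obtain k where k: "z = w * k" using assms(1) by (auto simp: mod_eq_0_iff_dvd)
  have "w > 0" using k assms by (cases "w = 0") auto
  have "x div w < k" using assms(2) k by (simp add: less_mult_imp_div_less mult.commute)
  moreover have "k \<le> y div w" using assms(3) k \<open>w > 0\<close> by (simp add: less_eq_div_iff_mult_less_eq mult.commute)
  ultimately show ?thesis by simp
qed

text \<open>The entry taken next is minimal among the unread ones: it is below the other head by the
  test or by totality, and each head is below the rest of its half.\<close>

lemma merging_step:
  assumes m: "merging w src dst z q a b" and q: "q < z + 2 * w" and K: "z + 2 * w \<le> K"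
    and src: "sorted_blocks w src K"
    and left: "left \<longleftrightarrow> a < z + w \<and> (\<not> b < z + 2 * w \<or> le (src a) (src b))"
    and dst': "\<And>x. dst' x = (if x = q then if left then src a else src b else dst x)"
  shows "merging w src dst' z (Suc q) (if left then Suc a else a) (if left then b else Suc b)"
proof -
  have M: "z mod (2 * w) = 0" "z \<le> a" "a \<le> z + w" "z + w \<le> b" "b \<le> z + 2 * w" "a + b = q + z + w"
    "dst ` {..<q} = src ` ({..<a} \<union> {z + w..<b})" "sorted_blocks (2 * w) dst q"
    and le: "\<And>x y. z \<le> x \<Longrightarrow> x < q \<Longrightarrow> a \<le> y \<and> y < z + w \<or> b \<le> y \<and> y < z + 2 * w \<Longrightarrow> le (dst x) (src y)"
    using m by (auto simp: merging_def)
  define c where "c = (if left then a else b)"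
  have c: "a \<le> c \<and> c < z + w \<or> b \<le> c \<and> c < z + 2 * w"
    using M q left by (auto simp: c_def split: if_splits)
  have dst'': "dst' x = (if x = q then src c else dst x)" for x by (simp add: dst' c_def)
  have zw: "z mod w = 0" "(z + w) mod w = 0" using M(1)
    by (metis mod_mod_cancel dvd_triv_right mod_0, metis mod_mod_cancel dvd_triv_right mod_0 mod_add_self2)
  have blkL: "le (src x) (src y)" if "z \<le> x" "x \<le> y" "y < z + w" for x y
    using src that K refl div_eq_same_block[OF zw(1), of x] div_eq_same_block[OF zw(1), of y]
    by (cases "x = y") (auto simp: sorted_blocks_def)
  have blkR: "le (src x) (src y)" if "z + w \<le> x" "x \<le> y" "y < z + 2 * w" for x y
    using src that K refl div_eq_same_block[OF zw(2), of x] div_eq_same_block[OF zw(2), of y]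
    by (cases "x = y") (auto simp: sorted_blocks_def)
  have cmin: "le (src c) (src y)" if y: "a \<le> y \<and> y < z + w \<or> b \<le> y \<and> y < z + 2 * w" for y
  proof (cases left)
    case True
    then have "le (src a) (src y)" if "a \<le> y \<and> y < z + w" using blkL[of a y] M that by auto
    moreover have "le (src a) (src y)" if "b \<le> y \<and> y < z + 2 * w"
      using True left that blkR[of b y] M trans[of "src a" "src b" "src y"] by auto
    ultimately show ?thesis using y True by (auto simp: c_def)
  next
    case False
    then have "le (src b) (src y)" if "b \<le> y \<and> y < z + 2 * w" using blkR[of b y] M that by auto
    moreover have "le (src b) (src y)" if "a \<le> y \<and> y < z + w"
      using False left that blkL[of a y] M trans[of "src b" "src a" "src y"] total[of "src a" "src b"] by auto
    ultimately show ?thesis using y False by (auto simp: c_def)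
  qed
  have "z \<le> q" using M by simp
  have img: "dst' ` {..<Suc q} = insert (src c) (dst ` {..<q})"
    unfolding lessThan_Suc by (auto simp: dst'')
  also have "\<dots> = src ` ({..<if left then Suc a else a} \<union> {z + w..<if left then b else Suc b})"
    using M(3,4) by (auto simp: M(7) c_def lessThan_Suc atLeastLessThanSuc)
  finally have 1: "dst' ` {..<Suc q} = src ` ({..<if left then Suc a else a} \<union> {z + w..<if left then b else Suc b})" .
  have 2: "sorted_blocks (2 * w) dst' (Suc q)"
    unfolding sorted_blocks_def
  proof (intro allI impI)
    fix x y assume xy: "x < y" "y < Suc q" "x div (2 * w) = y div (2 * w)"
    show "le (dst' x) (dst' y)"
    proof (cases "y = q")
      case True
      then have "z \<le> x" using same_block_ge[OF M(1), of x q] xy \<open>z \<le> q\<close> by force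
      then show ?thesis using le[of x c] c xy True by (simp add: dst'')
    next
      case False
      then show ?thesis using M(8) xy by (simp add: dst'' sorted_blocks_def)
    qed
  qed
  have 3: "le (dst' x) (src y)" if "z \<le> x" "x < Suc q"
    "(if left then Suc a else a) \<le> y \<and> y < z + w \<or> (if left then b else Suc b) \<le> y \<and> y < z + 2 * w" for x y
    using that cmin[of y] le[of x y] by (auto simp: dst'' less_Suc_eq split: if_splits)
  have 4: "z \<le> (if left then Suc a else a)" "(if left then Suc a else a) \<le> z + w"
    "z + w \<le> (if left then b else Suc b)" "(if left then b else Suc b) \<le> z + 2 * w"
    "(if left then Suc a else a) + (if left then b else Suc b) = Suc q + z + w"
    using M c left by (auto simp: c_def)
  show ?thesis unfolding merging_def using M(1) 1 2 3 4 by blast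
qed

end

section \<open>The graph of the routing network\<close>

text \<open>Stage \<open>s\<close> of the network decides about the binary digit of weight \<open>weight s\<close> of a wire
  \<open>w < 2\<^sup>L\<close>. The vertex \<open>2 * (s * 2\<^sup>L + w) + b\<close> stands for being on wire \<open>w\<close> before stage \<open>s\<close> and
  choosing the digit \<open>b\<close>; only one of the two choices is legal. The wires \<open>k < m\<close> and \<open>m + j\<close>
  with \<open>j < m\<close> stand for the rows \<open>k\<close> and columns \<open>j\<close> of \<open>B\<close>; the outputs are identified with
  the inputs.\<close>

locale network =
  fixes L m :: nat and B :: "nat \<Rightarrow> nat \<Rightarrow> bool"
  assumes wires: "2 * m < 2 ^ L" and m: "m \<ge> 1"
begin

definition N :: nat where "N = 2 ^ L"

text \<open>The weights rise from \<open>2 ^ 0\<close> to \<open>2 ^ (L - 1)\<close> and fall again,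
  as in a Benes network whose middle stage is doubled. With \<open>2 * L\<close> stages every stage
  \<open>t < L\<close> has a partner \<open>2 * L - 1 - t\<close> of the same weight.\<close>

definition weight :: "nat \<Rightarrow> nat" where
  "weight s = 2 ^ (if s < L then s else 2 * L - 1 - s)"

text \<open>The arcs are numbered so that a program can list them with one counter:
  \<open>a div 2\<close> is the tail, \<open>a mod 2\<close> the digit announced on arrival. The
  digit announced at the tail, \<open>v mod 2\<close>, decides the next wire. The remainder modulo
  \<open>2 * L\<close> glues the outputs to the inputs.\<close>

definition route_arc :: "nat \<Rightarrow> nat \<times> nat" where
  "route_arc a = (let v = a div 2; s = v div (2 * N) in
     (v, 2 * (Suc s mod (2 * L) * N + set_digit (weight s) (v mod 2) (v div 2 mod N)) + a mod 2))"

text \<open>The excluded tails, from \<open>4 * m\<close> to \<open>2 * N - 1\<close>, are the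
  vertices of the idle wires before stage 0. Leaving them out cuts the cyclic closure of the order
  open.\<close>

definition route_arcs :: "(nat \<times> nat) set" where
  "route_arcs = route_arc ` {a. a < 8 * L * N \<and> \<not> (4 * m \<le> a div 2 \<and> a div 2 < 2 * N)}"

text \<open>\<open>a div 4\<close> runs through the indices \<open>k * m + j\<close> of
  \<open>B\<close>, and the two low bits are the digits announced at the tail and at the
  head.\<close>

definition matrix_arc :: "nat \<Rightarrow> nat \<times> nat" where
  "matrix_arc a = (2 * (m + a div 4 mod m) + a mod 2, 2 * (a div 4 div m) + a div 2 mod 2)"

definition matrix_arcs :: "(nat \<times> nat) set" where
  "matrix_arcs = matrix_arc ` {a. a < 4 * m * m \<and> B (a div 4 div m) (a div 4 mod m)}"

definition arcs :: "(nat \<times> nat) set" where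
  "arcs = route_arcs \<union> matrix_arcs"

text \<open>The bit \<open>v mod 2\<close> is Bob's announcement and the parity of
  \<open>D (v div 2)\<close> the setting of the switch; the sum is even exactly if they agree. Using
  the parity makes every number stored in \<open>D\<close> a meaningful setting.\<close>

definition legal :: "(nat \<Rightarrow> nat) \<Rightarrow> nat \<Rightarrow> bool" where
  "legal D v \<longleftrightarrow> (D (v div 2) + v) mod 2 = 0"

lemma L_pos: "L \<ge> 1"
  using wires m by (cases L) auto

lemma weight_pos: "weight s > 0"
  by (simp add: weight_def)

lemma weight_dvd: "s < 2 * L \<Longrightarrow> 2 * weight s dvd N"
proof -
  assume "s < 2 * L"
  then have "Suc (if s < L then s else 2 * L - 1 - s) \<le> L" by auto
  then have "(2::nat) ^ Suc (if s < L then s else 2 * L - 1 - s) dvd 2 ^ L"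
    by (rule le_imp_power_dvd)
  then show ?thesis by (simp add: weight_def N_def)
qed

lemma N_pos: "N > 0"
  by (simp add: N_def)

lemma vertex_less:
  assumes "s < 2 * L" "w < N" "b < 2"
  shows "2 * (s * N + w) + b < 4 * L * N"
proof -
  have "s * N + w < Suc s * N" using assms by simp
  also have "\<dots> \<le> 2 * L * N" using assms by (intro mult_right_mono) auto
  finally show ?thesis using assms(3) by simp
qed

lemma arcs_less: "arcs \<subseteq> {..<4 * L * N} \<times> {..<4 * L * N}"
proof -
  have "x < 4 * L * N \<and> y < 4 * L * N" if a: "a < 8 * L * N" "(x, y) = route_arc a" for a x y
  proof -
    have v: "a div 2 < 4 * L * N" using a(1) by auto
    then have s: "a div 2 div (2 * N) < 2 * L"
      by (simp add: less_mult_imp_div_less mult.commute mult.left_commute)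
    have "set_digit (weight (a div 2 div (2 * N))) (a div 2 mod 2) (a div 2 div 2 mod N) < N"
      using weight_pos weight_dvd[OF s] N_pos by (intro set_digit_less) auto
    from vertex_less[OF _ this, of "Suc (a div 2 div (2 * N)) mod (2 * L)" "a mod 2"]
    show ?thesis using a v L_pos
      by (auto simp: route_arc_def Let_def)
  qed
  moreover have "x < 4 * L * N \<and> y < 4 * L * N" if a: "a < 4 * m * m" "(x, y) = matrix_arc a" for a x y
  proof -
    have "a div 4 < m * m" using a(1) by auto
    then have "a div 4 div m < m" "a div 4 mod m < m" using m by (auto simp: less_mult_imp_div_less)
    then have "m + a div 4 mod m < 2 * m" "a div 4 div m < 2 * m" by linarith+
    then have "m + a div 4 mod m < N" "a div 4 div m < N" using wires unfolding N_def by linarith+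
    moreover have "x = 2 * (m + a div 4 mod m) + a mod 2" "y = 2 * (a div 4 div m) + a div 2 mod 2"
      using a(2) by (simp_all add: matrix_arc_def)
    moreover have "2 * u + b mod 2 < 2 * N" if "u < N" for u b
    proof -
      have "b mod 2 < 2" by simp
      with that show ?thesis by linarith
    qed
    ultimately have "x < 2 * N" "y < 2 * N" by simp_all
    moreover have "2 * N \<le> 4 * L * N" using L_pos by simp
    ultimately show ?thesis using less_le_trans by blast
  qed
  ultimately have "x < 4 * L * N \<and> y < 4 * L * N" if "(x, y) \<in> arcs" for x y
    using that unfolding arcs_def route_arcs_def matrix_arcs_def by blast
  then show ?thesis by auto
qed

end

text \<open>All that the combinatorics needs to know about one row: \<open>ord\<close> lists the
  wires in increasing order with the idle ones first, the outermost permutation is the cyclic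
  predecessor, and at each level the settings in \<open>D\<close> peel off a pair of outer stages.
  Ties are excluded only between a row and a column; \<open>ord\<close> may break the others at
  will.\<close>

locale routed_network = network +
  fixes D ord :: "nat \<Rightarrow> nat" and \<tau> :: "nat \<Rightarrow> nat \<Rightarrow> nat" and le :: "nat \<Rightarrow> nat \<Rightarrow> bool"
  assumes ord: "ord ` {..<N} = {..<N}"
    and sorted: "x < y \<Longrightarrow> y < N \<Longrightarrow> le (ord x) (ord y)"
    and idle: "le x y \<Longrightarrow> 2 * m \<le> y \<Longrightarrow> 2 * m \<le> x"
    and strict: "k < m \<Longrightarrow> j < m \<Longrightarrow> \<not> (le k (m + j) \<and> le (m + j) k)"
    and start: "q < N \<Longrightarrow> \<tau> 0 (ord (Suc q mod N)) = ord q"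
    and final: "x < N \<Longrightarrow> \<tau> L x = x"
    and stages: "t < L \<Longrightarrow> x < N \<Longrightarrow> set_digit (2 ^ t) (D ((2 * L - 1 - t) * N + \<tau> (Suc t)
      (set_digit (2 ^ t) (D (t * N + x) mod 2) x)) mod 2)
      (\<tau> (Suc t) (set_digit (2 ^ t) (D (t * N + x) mod 2) x)) = \<tau> t x"
begin

definition nxt :: "nat \<Rightarrow> nat \<Rightarrow> nat" where
  "nxt s w = set_digit (weight s) (D (s * N + w) mod 2) w"

definition node :: "nat \<Rightarrow> nat \<Rightarrow> nat" where
  "node s w = 2 * (s * N + w) + D (s * N + w) mod 2"

text \<open>Only the head has to be legal, because in the game Alice inspects the vertex that Bob
  has just entered. A play that begins with Bob's move may start at an illegal vertex.\<close>

definition legal_arcs :: "(nat \<times> nat) set" where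
  "legal_arcs = {(v, w) \<in> arcs. legal D w}"

abbreviation dest :: "nat \<Rightarrow> nat \<Rightarrow> nat" where
  "dest s w \<equiv> iterate_from nxt s (2 * L - s) w"

lemma nxt_less: "s < 2 * L \<Longrightarrow> w < N \<Longrightarrow> nxt s w < N"
  unfolding nxt_def using weight_pos weight_dvd by (intro set_digit_less) auto

lemma dest_0: "x < N \<Longrightarrow> dest 0 x = \<tau> 0 x"
proof -
  assume x: "x < N"
  have "nxt (2 * L - 1 - t) (\<tau> (Suc t) (nxt t y)) = \<tau> t y" if "t < L" "y < N" for t y
  proof -
    have "\<not> 2 * L - 1 - t < L" "2 * L - 1 - (2 * L - 1 - t) = t" using that by auto
    then show ?thesis using stages[OF that] that by (simp add: nxt_def weight_def)
  qed
  then show ?thesis using benes_routes[of L N nxt \<tau> 0 x] final x by (auto simp: nxt_less)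
qed

lemma node_div_2: "node s w div 2 = s * N + w" and node_mod_2: "node s w mod 2 = D (s * N + w) mod 2"
proof -
  have "(2 * x + b mod 2) div 2 = x" "(2 * x + b mod 2) mod 2 = b mod 2" for x b :: nat by simp_all
  then show "node s w div 2 = s * N + w" "node s w mod 2 = D (s * N + w) mod 2"
    unfolding node_def by blast+
qed

lemma node_legal: "legal D (node s w)"
proof -
  have "(D (s * N + w) + node s w) mod 2 = 0"
    unfolding mod_add_right_eq[of "D (s * N + w)" "node s w" 2, symmetric] node_mod_2
    by (simp add: mod2_eq_if)
  then show ?thesis by (simp add: legal_def node_div_2)
qed

lemma node_div: "w < N \<Longrightarrow> node s w div (2 * N) = s"
  by (simp add: div_mult2_eq node_div_2)

lemma eq_node:
  assumes "legal D v" "v div 2 = s * N + w"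
  shows "v = node s w"
proof -
  have "v mod 2 = D (v div 2) mod 2" using assms(1) unfolding legal_def by presburger
  moreover have "v = 2 * (v div 2) + v mod 2" by simp
  ultimately show ?thesis unfolding node_def assms(2)[symmetric] by simp
qed

lemma legal_eq_node: "legal D v \<Longrightarrow> v = node (v div (2 * N)) (v div 2 mod N)"
  by (rule eq_node) (simp_all add: div_mult2_eq)

text \<open>The setting at the tail fixes the next wire, and legality of the head fixes the digit
  announced there; so the path of a law-abiding token through the network is forced.\<close>

lemma route_from_node:
  assumes s: "s < 2 * L" and w: "w < N"
  shows "(node s w, v) \<in> route_arcs \<and> legal D v \<longleftrightarrow>
    \<not> (s = 0 \<and> 2 * m \<le> w) \<and> v = node (Suc s mod (2 * L)) (nxt s w)"
proof -
  let ?s = "Suc s mod (2 * L)"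
  have nl: "node s w < 4 * L * N" unfolding node_def using s w by (intro vertex_less) auto
  have ra: "route_arc a = (node s w, 2 * (?s * N + nxt s w) + a mod 2)" if "a div 2 = node s w" for a
    using w that by (simp add: route_arc_def Let_def node_div node_div_2 node_mod_2 nxt_def)
  have idle_iff: "4 * m \<le> node s w \<and> node s w < 2 * N \<longleftrightarrow> s = 0 \<and> 2 * m \<le> w"
  proof (cases "s = 0")
    case True
    have "D w mod 2 < 2" by simp
    then show ?thesis using w True unfolding node_def by auto
  next
    case False
    then have "N \<le> s * N" by simp
    moreover have "2 * (s * N) \<le> node s w" by (simp add: node_def)
    ultimately have "\<not> node s w < 2 * N" by linarith
    then show ?thesis using False by simp
  qed
  have "(node s w, v) \<in> route_arcs \<longleftrightarrow> \<not> (s = 0 \<and> 2 * m \<le> w) \<and>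
    (\<exists>b<2. v = 2 * (?s * N + nxt s w) + b)"
  proof
    assume "(node s w, v) \<in> route_arcs"
    then obtain a where eq: "(node s w, v) = route_arc a"
      and "a \<in> {a. a < 8 * L * N \<and> \<not> (4 * m \<le> a div 2 \<and> a div 2 < 2 * N)}"
      unfolding route_arcs_def by (rule imageE)
    then have na: "\<not> (4 * m \<le> a div 2 \<and> a div 2 < 2 * N)" by blast
    have half: "a div 2 = node s w" using eq by (simp add: route_arc_def Let_def)
    have "\<not> (s = 0 \<and> 2 * m \<le> w)" using na unfolding half idle_iff .
    moreover have "v = 2 * (?s * N + nxt s w) + a mod 2" using eq ra[OF half] by simp
    moreover have "a mod 2 < 2" by simp
    ultimately show "\<not> (s = 0 \<and> 2 * m \<le> w) \<and> (\<exists>b<2. v = 2 * (?s * N + nxt s w) + b)"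
      by blast
  next
    assume h: "\<not> (s = 0 \<and> 2 * m \<le> w) \<and> (\<exists>b<2. v = 2 * (?s * N + nxt s w) + b)"
    then obtain b where b: "b < 2" "v = 2 * (?s * N + nxt s w) + b" by (elim conjE exE) simp
    let ?a = "2 * node s w + b"
    have a: "?a div 2 = node s w" "?a mod 2 = b" "?a < 8 * L * N" using b nl by auto
    show "(node s w, v) \<in> route_arcs" unfolding route_arcs_def
    proof (rule image_eqI)
      show "(node s w, v) = route_arc ?a" using ra[OF a(1)] a(2) b(2) by simp
      show "?a \<in> {a. a < 8 * L * N \<and> \<not> (4 * m \<le> a div 2 \<and> a div 2 < 2 * N)}"
        using a(3) h unfolding mem_Collect_eq a(1) idle_iff by blast
    qed
  qed
  moreover have "(\<exists>b<2. v = 2 * (?s * N + nxt s w) + b) \<and> legal D v \<longleftrightarrow> v = node ?s (nxt s w)"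
  proof
    assume "(\<exists>b<2. v = 2 * (?s * N + nxt s w) + b) \<and> legal D v"
    then obtain b where b: "b < 2" "v = 2 * (?s * N + nxt s w) + b" "legal D v" by blast
    then have "v div 2 = ?s * N + nxt s w" by simp
    then show "v = node ?s (nxt s w)" using b eq_node by simp
  next
    assume "v = node ?s (nxt s w)"
    then show "(\<exists>b<2. v = 2 * (?s * N + nxt s w) + b) \<and> legal D v"
      using node_legal by (auto simp: node_def)
  qed
  ultimately show ?thesis by blast
qed

lemma matrix_from_node:
  assumes s: "s < 2 * L" and w: "w < N"
  shows "(node s w, v) \<in> matrix_arcs \<and> legal D v \<longleftrightarrow>
    s = 0 \<and> (\<exists>j k. j < m \<and> k < m \<and> w = m + j \<and> B k j \<and> v = node 0 k)"
proof
  assume "(node s w, v) \<in> matrix_arcs \<and> legal D v"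
  then obtain a where a: "a < 4 * m * m" "B (a div 4 div m) (a div 4 mod m)"
    "matrix_arc a = (node s w, v)" and l: "legal D v"
    by (auto simp: matrix_arcs_def)
  define k j where "k = a div 4 div m" and "j = a div 4 mod m"
  have "a div 4 < m * m" using a(1) by auto
  then have kj: "k < m" "j < m" using m by (auto simp: k_def j_def less_mult_imp_div_less)
  have "node s w = 2 * (m + j) + a mod 2" "v = 2 * k + a div 2 mod 2"
    using a(3) by (auto simp: matrix_arc_def k_def j_def)
  then have "s * N + w = m + j" "v div 2 = k"
    using node_div_2[of s w] by auto
  moreover have "m + j < N" using kj wires by (simp add: N_def)
  ultimately have "s = 0" "w = m + j" using N_pos by (cases s; auto)+
  moreover have "k < N" using kj wires by (simp add: N_def)
  then have "v = node 0 k" using eq_node[OF l, of 0 k] \<open>v div 2 = k\<close> by simp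
  ultimately show "s = 0 \<and> (\<exists>j k. j < m \<and> k < m \<and> w = m + j \<and> B k j \<and> v = node 0 k)"
    using kj a(2)[folded k_def j_def] by blast
next
  assume "s = 0 \<and> (\<exists>j k. j < m \<and> k < m \<and> w = m + j \<and> B k j \<and> v = node 0 k)"
  then obtain j k where h: "s = 0" "j < m" "k < m" "w = m + j" "B k j" "v = node 0 k"
    by (elim conjE exE) (rule that)
  \<comment> \<open>The witness packs the index of the entry together with the announcements at head
    and tail, in the layout that \<open>matrix_arc\<close> decodes.\<close>
  define a where "a = 4 * (k * m + j) + 2 * (D k mod 2) + D w mod 2"
  have digits: "(4 * u + 2 * X + Y) div 4 = u" "(4 * u + 2 * X + Y) mod 2 = Y"
    "(4 * u + 2 * X + Y) div 2 mod 2 = X" "4 * u + 2 * X + Y < 4 * Suc u"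
    if "X < 2" "Y < 2" for u X Y :: nat
  proof -
    have e: "4 * u + 2 * X + Y = Y + (2 * u + X) * 2" by simp
    show "(4 * u + 2 * X + Y) mod 2 = Y" unfolding e mod_mult_self1 using that by simp
    have "(4 * u + 2 * X + Y) div 2 = 2 * u + X" unfolding e using that by simp
    then show "(4 * u + 2 * X + Y) div 2 mod 2 = X" using that by simp
    show "(4 * u + 2 * X + Y) div 4 = u" "4 * u + 2 * X + Y < 4 * Suc u"
      using that by (auto intro: div_nat_eqI)
  qed
  have b: "D k mod 2 < 2" "D w mod 2 < 2" by simp_all
  have a: "a div 4 = k * m + j" "a mod 2 = D w mod 2" "a div 2 mod 2 = D k mod 2"
    unfolding a_def by (rule digits[OF b])+
  then have kj: "a div 4 div m = k" "a div 4 mod m = j" using h by auto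
  have "k * m + j < Suc k * m" using h by simp
  also have "\<dots> \<le> m * m" using h by (intro mult_right_mono) auto
  finally have "4 * Suc (k * m + j) \<le> 4 * m * m" by simp
  with digits(4)[OF b, of "k * m + j"] have "a < 4 * m * m" unfolding a_def by linarith
  then have "matrix_arc a \<in> matrix_arcs" unfolding matrix_arcs_def using h kj by blast
  moreover have "matrix_arc a = (node s w, v)"
    using h by (simp add: matrix_arc_def kj a node_def)
  ultimately show "(node s w, v) \<in> matrix_arcs \<and> legal D v"
    using h node_legal by simp
qed

section \<open>Positions in the sorted order, acyclicity and cycles\<close>

lemma inj_ord: "inj_on ord {..<N}"
  using ord by (simp add: eq_card_imp_inj_on)

definition pos :: "nat \<Rightarrow> nat" where
  "pos e = inv_into {..<N} ord e"

lemma pos: "e < N \<Longrightarrow> pos e < N" "e < N \<Longrightarrow> ord (pos e) = e"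
  using ord inv_into_into[of e ord "{..<N}"] f_inv_into_f[of e ord "{..<N}"] by (auto simp: pos_def)

lemma pos_ord: "q < N \<Longrightarrow> pos (ord q) = q"
  using inj_ord by (simp add: pos_def)

lemma ord_less: "q < N \<Longrightarrow> ord q < N"
  using ord by blast

lemma pos_active:
  assumes "e < 2 * m" "q \<le> N" "pos e < q" "q < N"
  shows "ord q < 2 * m"
proof (rule ccontr)
  assume "\<not> ord q < 2 * m"
  moreover have "le e (ord q)" using sorted[of "pos e" q] assms pos[of e] wires
    by (simp add: N_def)
  ultimately show False using idle[of e "ord q"] assms(1) by simp
qed

text \<open>Wire \<open>2 * m\<close> exists because \<open>2 * m < 2 ^ L\<close>; it is idle and
  hence precedes \<open>e\<close>. So the wrap-around of the predecessor map never starts at a row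
  or a column.\<close>

lemma pos_active_pos: "e < 2 * m \<Longrightarrow> 0 < pos e"
proof (rule ccontr)
  assume e: "e < 2 * m" and "\<not> 0 < pos e"
  moreover have N: "e < N" "2 * m < N" using e wires by (auto simp: N_def)
  then have "pos (2 * m) \<noteq> pos e" using pos(2)[of e] pos(2)[of "2 * m"] e by auto
  ultimately have "pos e < pos (2 * m)" by simp
  from pos_active[OF e _ this] show False using pos[of "2 * m"] N by simp
qed

lemma route_pos: "e < 2 * m \<Longrightarrow> \<tau> 0 e = ord (pos e - 1)"
proof -
  assume e: "e < 2 * m"
  then have N: "e < N" using wires by (auto simp: N_def)
  have "Suc (pos e - 1) = pos e" using pos_active_pos[OF e] by simp
  then show ?thesis using start[of "pos e - 1"] pos[OF N] by simp
qed

text \<open>The potential is lexicographic: the position in the order of the wire on which the token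
  will leave the network, then the number of stages still ahead. Entering the network trades one
  position for at most \<open>2 * L - 1\<close> stages, and a matrix arc lowers the position by
  dominance.\<close>

lemma acyclic_if_dominated:
  assumes dom: "\<And>k j. k < m \<Longrightarrow> j < m \<Longrightarrow> B k j \<Longrightarrow> le k (m + j)"
  shows "wf (legal_arcs\<inverse>)"
proof -
  \<comment> \<open>\<open>K\<close> exceeds every number of remaining stages, so one position
    outweighs them all.\<close>
  define K where "K = 2 * L + 1"
  \<comment> \<open>An illegal vertex can only be the first of a chain, so it gets a value above all
    legal ones. Before stage 0 the position of the wire itself counts, as the token may still leave
    by a matrix arc.\<close>
  define \<Phi> where "\<Phi> v = (let s = v div (2 * N); w = v div 2 mod N in
      if \<not> legal D v then (N + 1) * K
      else if s = 0 then pos w * K else pos (dest s w) * K + (2 * L - s))" for v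
  have \<Phi>node: "\<Phi> (node s w) = (if s = 0 then pos w * K else pos (dest s w) * K + (2 * L - s))"
    if "w < N" for s w
  proof -
    have "node s w div 2 mod N = w" using that by (simp add: node_div_2)
    then show ?thesis using that by (simp add: \<Phi>_def Let_def node_legal node_div)
  qed
  have dest_less: "dest s w < N" if "s < 2 * L" "w < N" for s w
  proof -
    have "iterate_from nxt s d w < N" if "s + d \<le> 2 * L" "w < N" for d
      using that by (induction d arbitrary: s w) (auto simp: nxt_less)
    then show ?thesis using that by simp
  qed
  have dest_step: "dest s w = (if Suc s = 2 * L then nxt s w else dest (Suc s) (nxt s w))"
    if "s < 2 * L" for s w
  proof -
    have "2 * L - s = Suc (2 * L - Suc s)" using that by simp
    then show ?thesis by auto
  qed
  have "\<Phi> v' < \<Phi> v" if vv: "(v, v') \<in> arcs" and l': "legal D v'" for v v'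
  proof -
    have v'N: "v' < 4 * L * N" and vN: "v < 4 * L * N" using vv arcs_less by auto
    have s_less: "x div (2 * N) < 2 * L" if "x < 4 * L * N" for x
      using that by (simp add: less_mult_imp_div_less mult.commute mult.left_commute)
    show ?thesis
    proof (cases "legal D v")
      case False
      define s w where "s = v' div (2 * N)" and "w = v' div 2 mod N"
      have sw: "s < 2 * L" "w < N" using s_less[OF v'N] N_pos by (auto simp: s_def w_def)
      have v': "v' = node s w" using legal_eq_node[OF l'] by (simp add: s_def w_def)
      have "pos w < N" "pos (dest s w) < N" using pos(1) dest_less sw by auto
      then have "pos w * K \<le> N * K" "pos (dest s w) * K \<le> N * K" by simp_all
      moreover have "2 * L - s < K" "N * K + K = (N + 1) * K" by (auto simp: K_def)
      ultimately have "pos w * K < (N + 1) * K" "pos (dest s w) * K + (2 * L - s) < (N + 1) * K"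
        by linarith+
      then have "\<Phi> v' < (N + 1) * K" using sw by (simp only: v' \<Phi>node split: if_split) simp
      then show ?thesis using False by (simp add: \<Phi>_def)
    next
      case True
      define s w where "s = v div (2 * N)" and "w = v div 2 mod N"
      have sw: "s < 2 * L" "w < N" using s_less[OF vN] N_pos by (auto simp: s_def w_def)
      have v: "v = node s w" using legal_eq_node[OF True] by (simp add: s_def w_def)
      from vv consider (r) "(v, v') \<in> route_arcs" | (b) "(v, v') \<in> matrix_arcs" by (auto simp: arcs_def)
      then show ?thesis
      proof cases
        case b
        then obtain j k where h: "s = 0" "j < m" "k < m" "w = m + j" "B k j" "v' = node 0 k"
          using matrix_from_node[OF sw, of v'] l' by (auto simp: v)
        have N: "k < N" "m + j < N" using h wires by (auto simp: N_def)
        have "le k (m + j)" using dom h by blast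
        then have "\<not> le (m + j) k" using strict[OF h(3,2)] by blast
        then have "\<not> pos (m + j) < pos k" using sorted[of "pos (m + j)" "pos k"] pos N by auto
        moreover have "pos (m + j) \<noteq> pos k" using pos(2)[OF N(1)] pos(2)[OF N(2)] h by auto
        ultimately have "pos k < pos (m + j)" by simp
        moreover have "0 < K" by (simp add: K_def)
        ultimately have "pos k * K < pos (m + j) * K" by simp
        then show ?thesis using h N by (simp add: v \<Phi>node)
      next
        case r
        then have h: "\<not> (s = 0 \<and> 2 * m \<le> w)" "v' = node (Suc s mod (2 * L)) (nxt s w)"
          using route_from_node[OF sw, of v'] l' by (auto simp: v)
        have nN: "nxt s w < N" using nxt_less sw by simp
        show ?thesis
        proof (cases "s = 0")
          case True
          have L: "1 < 2 * L" using L_pos by simp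
          then have "dest (Suc 0) (nxt 0 w) = \<tau> 0 w"
            using dest_0[OF sw(2)] dest_step[of 0 w] by simp
          moreover have "w < 2 * m" using h True by simp
          ultimately have "dest (Suc 0) (nxt 0 w) = ord (pos w - 1)" "0 < pos w"
            using route_pos pos_active_pos by auto
          moreover have "pos (ord (pos w - 1)) = pos w - 1" using pos[OF sw(2)] by (intro pos_ord) simp
          ultimately have "\<Phi> v' = (pos w - 1) * K + (2 * L - 1)" "\<Phi> v = pos w * K" "0 < pos w"
            using h True L nN sw by (simp_all add: v \<Phi>node)
          then show ?thesis by (cases "pos w") (auto simp: K_def)
        next
          case False
          show ?thesis
          proof (cases "Suc s = 2 * L")
            case True
            then have "\<Phi> v' = pos (dest s w) * K" using h nN dest_step[OF sw(1), of w] by (simp add: \<Phi>node)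
            then show ?thesis using False sw by (simp add: v \<Phi>node)
          next
            case F2: False
            then have "\<Phi> v' = pos (dest s w) * K + (2 * L - Suc s)"
              using h nN dest_step[OF sw(1), of w] sw by (simp add: \<Phi>node)
            then show ?thesis using False sw by (simp add: v \<Phi>node)
          qed
        qed
      qed
    qed
  qed
  then have "legal_arcs\<inverse> \<subseteq> measure \<Phi>" by (auto simp: legal_arcs_def)
  then show ?thesis using wf_subset wf_measure by blast
qed

lemma route_path:
  assumes "s + Suc d \<le> 2 * L" "w < N" "\<not> (s = 0 \<and> 2 * m \<le> w)"
  shows "(node s w, node ((s + Suc d) mod (2 * L)) (iterate_from nxt s (Suc d) w)) \<in> legal_arcs\<^sup>+"
  using assms
proof (induction d arbitrary: s w)
  case 0
  then have "(node s w, node (Suc s mod (2 * L)) (nxt s w)) \<in> legal_arcs"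
    using route_from_node[of s w] by (auto simp: legal_arcs_def arcs_def)
  then show ?case by auto
next
  case (Suc d)
  then have "(node s w, node (Suc s mod (2 * L)) (nxt s w)) \<in> legal_arcs"
    using route_from_node[of s w] by (auto simp: legal_arcs_def arcs_def)
  moreover have "Suc s mod (2 * L) = Suc s" using Suc.prems by simp
  moreover have "(node (Suc s) (nxt s w), node ((Suc s + Suc d) mod (2 * L))
      (iterate_from nxt (Suc s) (Suc d) (nxt s w))) \<in> legal_arcs\<^sup>+"
    using Suc.prems nxt_less by (intro Suc.IH) auto
  ultimately show ?case by (auto intro: trancl_into_trancl2)
qed

text \<open>One pass through the network leads from an element to its predecessor, and
  \<open>pos_active\<close> keeps the token off the idle wires all the way down to
  \<open>e\<close>.\<close>

lemma descend:
  assumes "e < 2 * m"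
  shows "pos e + d < N \<Longrightarrow> (node 0 (ord (pos e + d)), node 0 e) \<in> legal_arcs\<^sup>*"
proof (induction d)
  case 0
  have "e < N" using assms wires by (simp add: N_def)
  then show ?case by (simp add: pos)
next
  case (Suc d)
  let ?f = "ord (pos e + Suc d)"
  have f: "?f < 2 * m" "?f < N" using pos_active[OF assms, of "pos e + Suc d"] Suc.prems ord_less by auto
  have "(node 0 ?f, node 0 (dest 0 ?f)) \<in> legal_arcs\<^sup>+"
    using route_path[of 0 "2 * L - 1" ?f] f L_pos by simp
  moreover have "dest 0 ?f = ord (pos e + d)"
    using dest_0[OF f(2)] route_pos[OF f(1)] pos_ord[OF Suc.prems] by simp
  ultimately show ?case using Suc by simp
qed

text \<open>If \<open>k\<close> is not below column \<open>j\<close>, sortedness places the column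
  earlier. The matrix arc jumps from the column up to \<open>k\<close>, and passes through the
  network come down to the column again.\<close>

lemma cycle_if_not_dominated:
  assumes "k < m" "j < m" "B k j" "\<not> le k (m + j)"
  shows "(node 0 (m + j), node 0 (m + j)) \<in> legal_arcs\<^sup>+"
proof -
  have N: "k < N" "m + j < N" using assms wires by (auto simp: N_def)
  have "\<not> pos k < pos (m + j)" using sorted[of "pos k" "pos (m + j)"] pos N assms(4) by auto
  then obtain d where d: "pos k = pos (m + j) + d"
    by (auto simp: not_less le_iff_add)
  have "(node 0 (m + j), node 0 k) \<in> legal_arcs"
    using matrix_from_node[of 0 "m + j" "node 0 k"] assms N L_pos node_legal
    by (auto simp: legal_arcs_def arcs_def)
  moreover have "(node 0 k, node 0 (m + j)) \<in> legal_arcs\<^sup>*"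
    using descend[of "m + j" d] assms pos[OF N(1)] d by auto
  ultimately show ?thesis by (rule rtrancl_into_trancl2)
qed

end

section \<open>Reasoning about word RAM programs\<close>

fun written_regs :: "com \<Rightarrow> name set" where
  "written_regs (Assign x a) = {x}"
| "written_regs (Seq p q) = written_regs p \<union> written_regs q"
| "written_regs (Cond b p q) = written_regs p \<union> written_regs q"
| "written_regs (While b p) = written_regs p"
| "written_regs _ = {}"

fun written_arrays :: "com \<Rightarrow> name set" where
  "written_arrays (Store x a b) = {x}"
| "written_arrays (Seq p q) = written_arrays p \<union> written_arrays q"
| "written_arrays (Cond b p q) = written_arrays p \<union> written_arrays q"
| "written_arrays (While b p) = written_arrays p"
| "written_arrays _ = {}"

text \<open>A frame condition. The sets are read off the program text, so whatever a phase does not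
  write is preserved without being part of any invariant.\<close>

definition agree_off :: "name set \<Rightarrow> name set \<Rightarrow> state \<Rightarrow> state \<Rightarrow> bool" where
  "agree_off X Y s s' \<longleftrightarrow>
     (\<forall>x. x \<notin> X \<longrightarrow> regs s' x = regs s x) \<and> (\<forall>y. y \<notin> Y \<longrightarrow> cells s' y = cells s y)"

lemma agree_off_refl: "agree_off X Y s s"
  by (simp add: agree_off_def)

lemma agree_off_trans: "agree_off X Y s s' \<Longrightarrow> agree_off X Y s' s'' \<Longrightarrow> agree_off X Y s s''"
  by (simp add: agree_off_def)

lemma agree_off_mono: "agree_off X Y s s' \<Longrightarrow> X \<subseteq> X' \<Longrightarrow> Y \<subseteq> Y' \<Longrightarrow> agree_off X' Y' s s'"
  by (auto simp: agree_off_def)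

lemma agree_off_reg: "agree_off X Y s s' \<Longrightarrow> x \<notin> X \<Longrightarrow> regs s' x = regs s x"
  and agree_off_cells: "agree_off X Y s s' \<Longrightarrow> y \<notin> Y \<Longrightarrow> cells s' y = cells s y"
  by (simp_all add: agree_off_def)

lemma agree_off_set_reg: "x \<in> X \<Longrightarrow> agree_off X Y s s' \<Longrightarrow> agree_off X Y s (set_reg x k s')"
  by (auto simp: agree_off_def set_reg_def)

lemma exec_agree_off: "exec M E p s t s' \<Longrightarrow> agree_off (written_regs p) (written_arrays p) s s'"
proof (induction rule: exec.induct)
  case (Seq p s t s' q t' s'')
  then show ?case by (auto simp: agree_off_def)
next
  case (While_True s b p t s' t' s'')
  then show ?case by (auto intro: agree_off_trans)
qed (auto simp: agree_off_def set_reg_def set_cell_def)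

text \<open>Total correctness with a step bound. A derivation of \<open>exec\<close> exists only if
  no write leaves the word bound, so boundedness of all written words is part of the claim.\<close>

definition runs :: "nat \<Rightarrow> (name \<Rightarrow> nat \<Rightarrow> 'a::linorder) \<Rightarrow> com \<Rightarrow> state \<Rightarrow> nat \<Rightarrow> (state \<Rightarrow> bool) \<Rightarrow> bool"
  where "runs M E p s T Q \<longleftrightarrow> (\<exists>t s'. exec M E p s t s' \<and> t \<le> T \<and> Q s')"

lemma runs_weaken:
  "runs M E p s T Q \<Longrightarrow> T \<le> T' \<Longrightarrow>
    (\<And>s'. agree_off (written_regs p) (written_arrays p) s s' \<Longrightarrow> Q s' \<Longrightarrow> Q' s') \<Longrightarrow> runs M E p s T' Q'"
  unfolding runs_def by (metis exec_agree_off le_trans)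

lemma runs_Seq:
  assumes "runs M E p s T R"
    and "\<And>s'. agree_off (written_regs p) (written_arrays p) s s' \<Longrightarrow> R s' \<Longrightarrow> runs M E q s' T' Q"
  shows "runs M E (Seq p q) s (T + T') Q"
proof -
  obtain t s' where 1: "exec M E p s t s'" "t \<le> T" "R s'" using assms(1) by (auto simp: runs_def)
  obtain t' s'' where 2: "exec M E q s' t' s''" "t' \<le> T'" "Q s''"
    using assms(2)[OF exec_agree_off[OF 1(1)] 1(3)] by (auto simp: runs_def)
  from exec.Seq[OF 1(1) 2(1)] add_mono[OF 1(2) 2(2)] 2(3) show ?thesis
    unfolding runs_def by blast
qed

lemma runs_Seq_le:
  assumes "runs M E p s T R"
    and "\<And>s'. agree_off (written_regs p) (written_arrays p) s s' \<Longrightarrow> R s' \<Longrightarrow> runs M E q s' T' Q"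
    and "T + T' \<le> T''"
  shows "runs M E (Seq p q) s T'' Q"
  using runs_weaken[OF runs_Seq[OF assms(1,2)] assms(3)] by blast

text \<open>The variant bounds the number of rounds, each of which pays for the body and one test;
  the last step is the failing test. The body may also use the frame condition relative to the state
  before the loop, so \<open>Inv\<close> has to speak only of what the loop changes.\<close>

lemma runs_While:
  assumes "Inv s0"
    and step: "\<And>s. agree_off (written_regs p) (written_arrays p) s0 s \<Longrightarrow> Inv s \<Longrightarrow> bval E s b \<Longrightarrow>
      runs M E p s T (\<lambda>s'. Inv s' \<and> \<Phi> s' < \<Phi> s)"
  shows "runs M E (While b p) s0 (\<Phi> s0 * (T + 1) + 1) (\<lambda>s. Inv s \<and> \<not> bval E s b)"
proof -
  have "runs M E (While b p) s (\<Phi> s * (T + 1) + 1) (\<lambda>s. Inv s \<and> \<not> bval E s b)"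
    if "agree_off (written_regs p) (written_arrays p) s0 s" "Inv s" for s
    using that
  proof (induction "\<Phi> s" arbitrary: s rule: less_induct)
    case less
    show ?case
    proof (cases "bval E s b")
      case False
      from exec.While_False[OF this] less.prems False show ?thesis by (fastforce simp: runs_def)
    next
      case True
      obtain t s' where 1: "exec M E p s t s'" "t \<le> T" "Inv s'" "\<Phi> s' < \<Phi> s"
        using step[OF less.prems True] by (auto simp: runs_def)
      from less.hyps[OF 1(4) agree_off_trans[OF less.prems(1) exec_agree_off[OF 1(1)]] 1(3)]
      obtain t' s'' where 2: "exec M E (While b p) s' t' s''" "t' \<le> \<Phi> s' * (T + 1) + 1"
        "Inv s''" "\<not> bval E s'' b" by (auto simp: runs_def)
      have "Suc (t + t') \<le> Suc (\<Phi> s') * (T + 1) + 1" using 1(2) 2(2) by simp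
      also have "\<dots> \<le> \<Phi> s * (T + 1) + 1" using 1(4) by (intro add_right_mono mult_right_mono) simp_all
      finally show ?thesis using exec.While_True[OF True 1(1) 2(1)] 2 by (auto simp: runs_def)
    qed
  qed
  from this[OF agree_off_refl assms(1)] show ?thesis .
qed

definition For :: "name \<Rightarrow> aexp \<Rightarrow> com \<Rightarrow> com" where
  "For x a p = Seq (Assign x (Lit 0))
     (While (Less (Reg x) a) (Seq p (Assign x (Add (Reg x) (Lit 1)))))"

lemma written_For [simp]:
  "written_regs (For x a p) = insert x (written_regs p)"
  "written_arrays (For x a p) = written_arrays p"
  by (auto simp: For_def)

lemma regs_set_reg [simp]: "regs (set_reg x k s) y = (if y = x then k else regs s y)"
  and cells_set_reg [simp]: "cells (set_reg x k s) = cells s"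
  and regs_set_cell [simp]: "regs (set_cell z a k s) = regs s"
  and cells_set_cell [simp]: "cells (set_cell z a k s) y b = (if y = z \<and> b = a then k else cells s y b)"
  by (simp_all add: set_reg_def set_cell_def)

text \<open>Each round pays for the body, the increment and the test; the two extra steps are the
  initialisation and the last test. The counter itself reaches \<open>K\<close>, hence
  \<open>K < M\<close>. The invariant is demanded with the counter already advanced, the state in
  which the loop goes on.\<close>

lemma runs_For:
  assumes bound: "\<And>s. agree_off (insert x (written_regs p)) (written_arrays p) s0 s \<Longrightarrow> aval s a = K"
    and M: "K < M" and x: "x \<notin> written_regs p"
    and init: "Inv 0 (set_reg x 0 s0)"
    and step: "\<And>s k. agree_off (insert x (written_regs p)) (written_arrays p) s0 s \<Longrightarrow> regs s x = k \<Longrightarrow>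
      k < K \<Longrightarrow> Inv k s \<Longrightarrow> runs M E p s T (\<lambda>s'. Inv (Suc k) (set_reg x (Suc k) s'))"
  shows "runs M E (For x a p) s0 (K * (T + 2) + 2) (Inv K)"
proof -
  let ?b = "Seq p (Assign x (Add (Reg x) (Lit 1)))"
  let ?I = "\<lambda>s. Inv (regs s x) s \<and> regs s x \<le> K \<and>
    agree_off (insert x (written_regs p)) (written_arrays p) s0 s"
  have "runs M E (While (Less (Reg x) a) ?b) (set_reg x 0 s0)
      ((K - regs (set_reg x 0 s0) x) * ((T + 1) + 1) + 1) (\<lambda>s. ?I s \<and> \<not> bval E s (Less (Reg x) a))"
  proof (rule runs_While[where \<Phi> = "\<lambda>s. K - regs s x"])
    show "?I (set_reg x 0 s0)" using init by (auto intro: agree_off_set_reg agree_off_refl)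
  next
    fix s assume I: "?I s" and b: "bval E s (Less (Reg x) a)"
    then have lt: "regs s x < K" using bound by simp
    have "runs M E p s T (\<lambda>s'. Inv (Suc (regs s x)) (set_reg x (Suc (regs s x)) s'))"
      using step[of s "regs s x"] I lt by simp
    then show "runs M E ?b s (T + 1) (\<lambda>s'. ?I s' \<and> K - regs s' x < K - regs s x)"
    proof (rule runs_Seq)
      fix s' assume a': "agree_off (written_regs p) (written_arrays p) s s'"
        and J: "Inv (Suc (regs s x)) (set_reg x (Suc (regs s x)) s')"
      have eq: "regs s' x = regs s x" using a' x by (simp add: agree_off_reg)
      have "exec M E (Assign x (Add (Reg x) (Lit 1))) s' 1 (set_reg x (Suc (regs s x)) s')"
        using exec.Assign[of s' "Add (Reg x) (Lit 1)" M E x] lt M by (simp add: eq)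
      moreover have "agree_off (insert x (written_regs p)) (written_arrays p) s0 s'"
        using I agree_off_mono[OF a', of "insert x (written_regs p)" "written_arrays p"]
        by (blast intro: agree_off_trans)
      ultimately show "runs M E (Assign x (Add (Reg x) (Lit 1))) s' 1
          (\<lambda>s'. ?I s' \<and> K - regs s' x < K - regs s x)"
        unfolding runs_def using J lt
        by (intro exI[of _ 1] exI[of _ "set_reg x (Suc (regs s x)) s'"])
          (auto intro: agree_off_set_reg)
    qed
  qed
  note loop = this
  have "runs M E (Assign x (Lit 0)) s0 1 (\<lambda>s. s = set_reg x 0 s0)"
    using exec.Assign[of s0 "Lit 0" M E x] M by (auto simp: runs_def)
  then have "runs M E (For x a p) s0 (1 + (K * ((T + 1) + 1) + 1))
      (\<lambda>s. ?I s \<and> \<not> bval E s (Less (Reg x) a))"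
    unfolding For_def
  proof (rule runs_Seq)
    fix s' assume "s' = set_reg x 0 s0"
    with loop show "runs M E (While (Less (Reg x) a) ?b) s' (K * ((T + 1) + 1) + 1)
      (\<lambda>s. ?I s \<and> \<not> bval E s (Less (Reg x) a))" by simp
  qed
  then show ?thesis
  proof (rule runs_weaken)
    fix s assume h: "?I s \<and> \<not> bval E s (Less (Reg x) a)"
    then have "regs s x = K" using bound[of s] by simp
    with h show "Inv K s" by simp
  qed simp
qed

lemma runs_For_reg:
  assumes "regs s0 y = K" "K < M" and fresh: "y \<notin> insert x (written_regs p) \<and> x \<notin> written_regs p"
    and "Inv 0 (set_reg x 0 s0)"
    and "\<And>s k. agree_off (insert x (written_regs p)) (written_arrays p) s0 s \<Longrightarrow> regs s x = k \<Longrightarrow>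
      k < K \<Longrightarrow> Inv k s \<Longrightarrow> runs M E p s T (\<lambda>s'. Inv (Suc k) (set_reg x (Suc k) s'))"
  shows "runs M E (For x (Reg y) p) s0 (K * (T + 2) + 2) (Inv K)"
proof (rule runs_For)
  show "aval s (Reg y) = K" if "agree_off (insert x (written_regs p)) (written_arrays p) s0 s" for s
    using agree_off_reg[OF that] fresh assms(1) by simp
qed (use assms in auto)

section \<open>Symbolic execution of straight-line code\<close>

fun loop_free :: "com \<Rightarrow> bool" where
  "loop_free (While b p) = False"
| "loop_free (Seq p q) \<longleftrightarrow> loop_free p \<and> loop_free q"
| "loop_free (Cond b p q) \<longleftrightarrow> loop_free p \<and> loop_free q"
| "loop_free _ = True"

fun max_steps :: "com \<Rightarrow> nat" where
  "max_steps (Seq p q) = max_steps p + max_steps q"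
| "max_steps (Cond b p q) = Suc (max (max_steps p) (max_steps q))"
| "max_steps _ = 1"

text \<open>The catch-all clause is right for \<open>Skip\<close> and a dummy for
  \<open>While\<close>. Together with \<open>in_bounds\<close>, this turns a claim about
  straight-line code into a goal for the simplifier.\<close>

fun result :: "(name \<Rightarrow> nat \<Rightarrow> 'a::linorder) \<Rightarrow> com \<Rightarrow> state \<Rightarrow> state" where
  "result E (Assign x a) s = set_reg x (aval s a) s"
| "result E (Store x a b) s = set_cell x (aval s a) (aval s b) s"
| "result E (Seq p q) s = result E q (result E p s)"
| "result E (Cond b p q) s = (if bval E s b then result E p s else result E q s)"
| "result E _ s = s"

fun in_bounds :: "nat \<Rightarrow> (name \<Rightarrow> nat \<Rightarrow> 'a::linorder) \<Rightarrow> com \<Rightarrow> state \<Rightarrow> bool" where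
  "in_bounds M E (Assign x a) s \<longleftrightarrow> aval s a < M"
| "in_bounds M E (Store x a b) s \<longleftrightarrow> aval s a < M \<and> aval s b < M"
| "in_bounds M E (Seq p q) s \<longleftrightarrow> in_bounds M E p s \<and> in_bounds M E q (result E p s)"
| "in_bounds M E (Cond b p q) s \<longleftrightarrow> (if bval E s b then in_bounds M E p s else in_bounds M E q s)"
| "in_bounds M E _ s = True"

lemma exec_loop_free:
  "loop_free p \<Longrightarrow> in_bounds M E p s \<Longrightarrow> \<exists>t \<le> max_steps p. exec M E p s t (result E p s)"
proof (induction p arbitrary: s)
  case (Seq p q)
  obtain t where "t \<le> max_steps p" "exec M E p s t (result E p s)" using Seq by auto
  moreover obtain t' where "t' \<le> max_steps q" "exec M E q (result E p s) t' (result E q (result E p s))"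
    using Seq by fastforce
  ultimately show ?case by (auto intro!: exI[of _ "t + t'"] exec.Seq)
next
  case (Cond b p q)
  show ?case
  proof (cases "bval E s b")
    case True
    then obtain t where "t \<le> max_steps p" "exec M E p s t (result E p s)" using Cond by auto
    then show ?thesis using True by (auto intro!: exI[of _ "Suc t"] exec.Cond_True)
  next
    case False
    then obtain t where "t \<le> max_steps q" "exec M E q s t (result E q s)" using Cond by auto
    then show ?thesis using False by (auto intro!: exI[of _ "Suc t"] exec.Cond_False)
  qed
qed (auto intro!: exI[of _ "1::nat"] exec.intros simp flip: One_nat_def)

lemma runs_loop_free:
  "loop_free p \<Longrightarrow> in_bounds M E p s \<Longrightarrow> max_steps p \<le> T \<Longrightarrow> Q (result E p s) \<Longrightarrow> runs M E p s T Q"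
proof -
  assume "loop_free p" "in_bounds M E p s" "max_steps p \<le> T" and Q: "Q (result E p s)"
  then obtain t where "t \<le> T" "exec M E p s t (result E p s)"
    using exec_loop_free[of p M E s] le_trans by blast
  with Q show ?thesis unfolding runs_def by blast
qed

section \<open>Reachability games\<close>

text \<open>Playing the two strategies against each other yields one play that conforms to both. It
  would have to be finite and end in a target of either player.\<close>

lemma winning_surviving_disjoint:
  assumes wf: "wf_game_graph G" and part: "partitions (configs G) F"
  shows "winning_set G F P \<inter> surviving_set G F (opponent P) = {}"
proof (rule ccontr)
  let ?Q = "opponent P"
  assume "winning_set G F P \<inter> surviving_set G F ?Q \<noteq> {}"
  then obtain \<sigma> where "\<sigma> \<in> winning_set G F P" and "\<sigma> \<in> surviving_set G F ?Q"
    by blast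
  then obtain s s' where \<sigma>: "\<sigma> \<in> configs G"
    and s: "is_strategy G P s"
      "\<And>\<pi>. is_play G \<pi> \<Longrightarrow> start \<pi> = \<sigma> \<Longrightarrow> conforms G P s \<pi> \<Longrightarrow> winning_play F P \<pi>"
    and s': "is_strategy G ?Q s'"
      "\<And>\<pi>. is_play G \<pi> \<Longrightarrow> start \<pi> = \<sigma> \<Longrightarrow> conforms G ?Q s' \<pi> \<Longrightarrow> surviving_play F ?Q \<pi>"
    by (auto simp: winning_set_def surviving_set_def)
  have moves: "moves G \<subseteq> configs G \<times> configs G"
    and ctrl: "controlled G P \<union> controlled G ?Q = configs G" "controlled G P \<inter> controlled G ?Q = {}"
    using wf by (cases P; auto simp: wf_game_graph_def partitions_def)+
  have disj: "F P \<inter> F ?Q = {}"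
    using part by (cases P) (auto simp: partitions_def)
  define st where "st \<tau> = (if \<tau> \<in> controlled G P then s \<tau> else s' \<tau>)" for \<tau>
  \<comment> \<open>After the first stop this sequence is constant; if there is a stop, the play is
    the prefix that ends with it.\<close>
  define f where "f k = ((\<lambda>\<tau>. case st \<tau> of None \<Rightarrow> \<tau> | Some \<tau>' \<Rightarrow> \<tau>') ^^ k) \<sigma>" for k
  have f0: "f 0 = \<sigma>" by (simp add: f_def)
  have fSuc: "f (Suc k) = (case st (f k) of None \<Rightarrow> f k | Some \<tau> \<Rightarrow> \<tau>)" for k
    by (simp add: f_def split: option.split)
  have st: "(\<tau>, \<tau>') \<in> moves G" if "\<tau> \<in> configs G" "st \<tau> = Some \<tau>'" for \<tau> \<tau>'
    using that s(1) s'(1) ctrl by (auto simp: st_def is_strategy_def split: if_splits)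
  have conf: "f k \<in> configs G" for k
  proof (induction k)
    case 0 then show ?case by (simp add: f0 \<sigma>)
  next
    case (Suc k) then show ?case using st moves
      by (auto simp: fSuc split: option.split)
  qed
  have stP: "f k \<in> controlled G P \<Longrightarrow> st (f k) = s (f k)"
    and stQ: "f k \<in> controlled G ?Q \<Longrightarrow> st (f k) = s' (f k)" for k
    using ctrl(2) by (auto simp: st_def)
  show False
  proof (cases "\<exists>k. st (f k) = None")
    case False
    then have step: "st (f k) = Some (f (Suc k))" for k
    proof -
      have "st (f k) \<noteq> None" using False by simp
      then show ?thesis by (auto simp: fSuc)
    qed
    have "is_play G (Infinite_Play f)" "conforms G P s (Infinite_Play f)"
      using conf st step stP by auto
    with s(2)[of "Infinite_Play f"] f0 show False by auto
  next
    case True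
    define l where "l = (LEAST k. st (f k) = None)"
    have l: "st (f l) = None" unfolding l_def using True by (rule LeastI_ex)
    have step: "st (f k) = Some (f (Suc k))" if "k < l" for k
      using not_less_Least[OF that[unfolded l_def]] by (cases "st (f k)") (auto simp: fSuc)
    define xs where "xs = map f [0..<Suc l]"
    have len: "length xs = Suc l" and nth: "k < Suc l \<Longrightarrow> xs ! k = f k" for k
      by (simp_all add: xs_def del: upt_Suc)
    have play: "is_play G (Finite_Play xs)"
      using conf st step by (auto simp: len nth) (auto simp: xs_def)
    have start: "start (Finite_Play xs) = \<sigma>"
      by (simp add: xs_def f0 hd_append del: upt_Suc) (simp add: upt_rec f0)
    have cases: "k < l \<or> k = l" if "k < Suc l" for k using that by auto
    have "conforms G P s (Finite_Play xs)" "conforms G ?Q s' (Finite_Play xs)"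
      using step l by (auto simp: len nth dest!: cases stP stQ)
    with s(2)[OF play start] s'(2)[OF play start] disj show False
      by auto
  qed
qed

lemma winning_subset_surviving: "winning_set G F P \<subseteq> surviving_set G F P"
proof -
  have "winning_play F P \<pi> \<Longrightarrow> surviving_play F P \<pi>" for \<pi> :: "'a play"
    by (cases \<pi>) auto
  then show ?thesis by (fastforce simp: winning_set_def surviving_set_def)
qed

lemma surviving_subset_configs: "surviving_set G F P \<subseteq> configs G"
  by (auto simp: surviving_set_def)

text \<open>This supplies a configuration that Alice wins whatever the matrices are, so that empty
  candidate sets for her are certainly wrong.\<close>

lemma wins_if_stops_in_target:
  assumes "\<sigma> \<in> controlled G P" "\<sigma> \<in> configs G" "\<sigma> \<in> F P"
  shows "\<sigma> \<in> winning_set G F P"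
proof -
  have "winning_play F P \<pi>"
    if "is_play G \<pi>" "start \<pi> = \<sigma>" "conforms G P (\<lambda>_. None) \<pi>" for \<pi>
  proof (cases \<pi>)
    case (Finite_Play xs)
    then have "xs \<noteq> []" "xs ! 0 = \<sigma>" using that by (auto simp: hd_conv_nth)
    with that Finite_Play assms(1) have "length xs = 1" by auto
    then have "last xs = \<sigma>" using \<open>xs ! 0 = \<sigma>\<close> by (cases xs) auto
    then show ?thesis using Finite_Play assms(3) by simp
  next
    case (Infinite_Play f) then show ?thesis using that assms(1) by auto
  qed
  moreover have "is_strategy G P (\<lambda>_. None)" by (simp add: is_strategy_def)
  ultimately show ?thesis using assms(2) by (auto simp: winning_set_def)
qed

text \<open>The only arc at \<open>i\<close> is a loop, so Alice merely decides whether to stop. All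
  configurations of Bob are targets of Alice, so Bob loses by stopping, while stopping pays for
  Alice exactly at illegal vertices. Bob survives by following legal arcs for as long as she lets
  the play go on.\<close>

locale self_loop_game =
  fixes n V :: nat and arcs :: "(nat \<times> nat) set" and legal :: "nat \<Rightarrow> nat \<Rightarrow> bool"
    and H :: "player \<Rightarrow> nat pair_pre_digraph" and F :: "player \<Rightarrow> nat config set"
  assumes Alice_graph: "H Alice = \<lparr>pverts = {..<n}, parcs = Id_on {..<n}\<rparr>"
    and Bob_graph: "H Bob = \<lparr>pverts = {..<V}, parcs = arcs\<rparr>"
    and arcs: "arcs \<subseteq> {..<V} \<times> {..<V}"
    and F_Alice: "F Alice = {(Alice, i, v) |i v. i < n \<and> v < V \<and> \<not> legal i v} \<union> {(Bob, v, i) |i v. i < n \<and> v < V}"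
    and F_Bob: "F Bob = {(Alice, i, v) |i v. i < n \<and> v < V \<and> legal i v}"
begin

definition legal_arcs :: "nat \<Rightarrow> (nat \<times> nat) set" where
  "legal_arcs i = {(v, w) \<in> arcs. legal i w}"

abbreviation "G \<equiv> token_game H"

lemma controlled_Alice: "controlled G Alice = {(Alice, i, v) |i v. i < n \<and> v < V}"
  and controlled_Bob: "controlled G Bob = {(Bob, v, i) |i v. i < n \<and> v < V}"
  by (auto simp: token_game_def token_configs_def Alice_graph Bob_graph)

lemma configs_eq: "configs G = controlled G Alice \<union> controlled G Bob"
  by (simp add: token_game_def)

lemma moves_eq: "moves G = {((Alice, i, v), (Bob, v, i)) |i v. i < n \<and> v < V} \<union>
    {((Bob, v, i), (Alice, i, w)) |i v w. i < n \<and> (v, w) \<in> arcs}"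
proof -
  have ex: "(\<exists>P. Q P) \<longleftrightarrow> Q Alice \<or> Q Bob" for Q
    by (metis player.exhaust)
  have "moves G = {((Alice, u, v), (Bob, v, u')) |u v u'. (u, u') \<in> Id_on {..<n} \<and> v < V} \<union>
    {((Bob, u, v), (Alice, v, u')) |u v u'. (u, u') \<in> arcs \<and> v < n}"
    unfolding token_game_def by (auto simp: ex Alice_graph Bob_graph)
  then show ?thesis by auto
qed

lemma digraphs: "pair_fin_digraph (H P)"
proof -
  have "finite arcs" using arcs finite_subset by blast
  moreover have "finite (Id_on {..<n})" by (simp add: Id_on_def)
  ultimately show ?thesis
    using arcs by (cases P; unfold_locales) (auto simp: Alice_graph Bob_graph)
qed

lemma targets_partition: "partitions (configs G) F"
  by (auto simp: partitions_def configs_eq controlled_Alice controlled_Bob F_Alice F_Bob)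

text \<open>Alice stops at illegal vertices and otherwise returns the move. An infinite play would
  then contain an infinite chain of legal arcs, one for every two moves. The claims about Bob follow
  because his surviving set is disjoint from her winning set.\<close>

lemma Alice_wins_everywhere:
  assumes "\<And>i. i < n \<Longrightarrow> wf ((legal_arcs i)\<inverse>)"
  shows "winning_set G F Alice = configs G" "surviving_set G F Alice = configs G"
    "winning_set G F Bob = {}" "surviving_set G F Bob = {}"
proof -
  define s where "s \<sigma> = (if \<sigma> \<in> F Alice then None else
      case \<sigma> of (P, i, v) \<Rightarrow> Some (Bob, v, i))" for \<sigma> :: "nat config"
  have str: "is_strategy G Alice s"
    by (auto simp: is_strategy_def s_def controlled_Alice moves_eq F_Alice)
  have win: "winning_play F Alice \<pi>"
    if "is_play G \<pi>" and "conforms G Alice s \<pi>" for \<pi>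
  proof (cases \<pi>)
    case (Finite_Play xs)
    then have xs: "xs \<noteq> []" "set xs \<subseteq> configs G" using that by auto
    then have last: "last xs = xs ! (length xs - 1)" "last xs \<in> configs G"
      by (auto simp: last_conv_nth)
    have "last xs \<in> F Alice"
    proof (cases "last xs \<in> controlled G Alice")
      case True
      then have "s (last xs) = None" using that(2) xs last(1)
        unfolding Finite_Play conforms.simps
        by (auto dest!: spec[of _ "length xs - 1"])
      then show ?thesis by (simp add: s_def split: if_splits prod.splits)
    next
      case False
      then show ?thesis using last(2) by (auto simp: configs_eq controlled_Bob F_Alice)
    qed
    then show ?thesis by (simp add: Finite_Play)
  next
    case (Infinite_Play f)
    have mv: "(f k, f (Suc k)) \<in> moves G" and cf: "f k \<in> configs G" for k
      using that(1) Infinite_Play by auto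
    have al: "f k \<notin> F Alice" if "f k \<in> controlled G Alice" for k
    proof
      assume "f k \<in> F Alice"
      then have "s (f k) = None" by (simp add: s_def)
      then show False using \<open>conforms G Alice s \<pi>\<close> that by (simp add: Infinite_Play)
    qed
    have two: "\<exists>w. f (Suc (Suc k)) = (Bob, w, i) \<and> (v, w) \<in> legal_arcs i" if f: "f k = (Bob, v, i)" for k v i
    proof -
      obtain w where w: "f (Suc k) = (Alice, i, w)" "(v, w) \<in> arcs"
        using mv[of k] by (auto simp: f moves_eq)
      have c: "f (Suc k) \<in> controlled G Alice"
        using cf[of "Suc k"] w by (auto simp: configs_eq controlled_Alice controlled_Bob)
      from al[OF this] c have "legal i w" by (auto simp: w controlled_Alice F_Alice)
      moreover have "f (Suc (Suc k)) = (Bob, w, i)"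
        using mv[of "Suc k"] by (auto simp: w moves_eq)
      ultimately show ?thesis using w by (auto simp: legal_arcs_def)
    qed
    \<comment> \<open>The offset \<open>d\<close> skips a possible first configuration of Alice;
      from there on every second configuration is Bob's.\<close>
    obtain d v i where d: "f d = (Bob, v, i)"
    proof (cases "fst (f 0)")
      case Alice then show ?thesis using that[of 1] mv[of 0] by (auto simp: moves_eq)
    next
      case Bob then show ?thesis using that[of 0] by (metis prod.collapse)
    qed
    have i: "i < n" using cf[of d] by (auto simp: d configs_eq controlled_Alice controlled_Bob)
    define g where "g k = fst (snd (f (d + 2 * k)))" for k
    have fg: "f (d + 2 * k) = (Bob, g k, i)" for k
    proof (induction k)
      case 0 then show ?case by (simp add: d g_def)
    next
      case (Suc k)
      from two[OF this] have "\<exists>w. f (d + 2 * Suc k) = (Bob, w, i)" by auto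
      then show ?case unfolding g_def by fastforce
    qed
    have "(g k, g (Suc k)) \<in> legal_arcs i" for k
      using two[OF fg[of k]] fg[of "Suc k"] by auto
    then have "\<exists>g. \<forall>k. (g (Suc k), g k) \<in> (legal_arcs i)\<inverse>" by blast
    with assms[OF i] show ?thesis unfolding wf_iff_no_infinite_down_chain by blast
  qed
  show W: "winning_set G F Alice = configs G"
    using str win unfolding winning_set_def by blast
  show "surviving_set G F Alice = configs G"
    using winning_subset_surviving[of G F Alice] surviving_subset_configs[of G F Alice] W by simp
  show S: "surviving_set G F Bob = {}"
    using winning_surviving_disjoint[OF wf_token_game[OF digraphs] targets_partition, of Alice] W
      surviving_subset_configs[of G F Bob] by auto
  show "winning_set G F Bob = {}"
    using winning_subset_surviving[of G F Bob] S by simp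
qed

text \<open>Every vertex with a legal path to \<open>v\<close> has a legal arc to another such
  vertex, because a path that arrives at \<open>v\<close> can go round again. Bob's strategy always
  picks such an arc and never stops, so only Alice can end the play, and only at a legal
  vertex.\<close>

lemma Bob_survives_on_cycle:
  assumes "i < n" and cyc: "(v, v) \<in> (legal_arcs i)\<^sup>+"
  shows "(Bob, v, i) \<in> surviving_set G F Bob"
proof -
  define X where "X = {w. (w, v) \<in> (legal_arcs i)\<^sup>+}"
  have next_ex: "\<exists>w'. w' \<in> X \<and> (w, w') \<in> legal_arcs i" if "w \<in> X" for w
  proof -
    from that have "(w, v) \<in> (legal_arcs i)\<^sup>+" by (simp add: X_def)
    from tranclD[OF this] obtain w' where w': "(w, w') \<in> legal_arcs i" "(w', v) \<in> (legal_arcs i)\<^sup>*"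
      by blast
    have "(w', v) \<in> (legal_arcs i)\<^sup>+" using rtrancl_trancl_trancl[OF w'(2) cyc] .
    then show ?thesis using w'(1) by (auto simp: X_def)
  qed
  define nx where "nx w = (SOME w'. w' \<in> X \<and> (w, w') \<in> legal_arcs i)" for w
  have nx: "nx w \<in> X" "(w, nx w) \<in> legal_arcs i" if "w \<in> X" for w
    using someI_ex[OF next_ex[OF that]] unfolding nx_def by blast+
  define s where "s \<sigma> = (case \<sigma> of (P, w, j) \<Rightarrow>
      if j = i \<and> w \<in> X then Some (Alice, i, nx w) else None)" for \<sigma> :: "nat config"
  have X_lt: "w < V" if "w \<in> X" for w
    using nx[OF that] arcs by (auto simp: legal_arcs_def)
  have str: "is_strategy G Bob s"
    using nx by (auto simp: is_strategy_def s_def controlled_Bob moves_eq legal_arcs_def)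
  define ok where "ok \<sigma> \<longleftrightarrow> (\<exists>w\<in>X. \<sigma> = (Bob, w, i) \<or> (\<sigma> = (Alice, i, w) \<and> legal i w))"
    for \<sigma> :: "nat config"
  have step: "ok \<tau>" if "ok \<sigma>" "(\<sigma>, \<tau>) \<in> moves G" "\<sigma> \<in> controlled G Bob \<Longrightarrow> s \<sigma> = Some \<tau>" for \<sigma> \<tau>
    using that nx X_lt assms(1)
    by (auto simp: ok_def moves_eq s_def controlled_Bob legal_arcs_def)
  have okv: "ok (Bob, v, i)" using cyc by (auto simp: ok_def X_def)
  have "surviving_play F Bob \<pi>"
    if play: "is_play G \<pi>" and st: "start \<pi> = (Bob, v, i)" and conf: "conforms G Bob s \<pi>" for \<pi>
  proof (cases \<pi>)
    case (Finite_Play xs)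
    have xs: "xs \<noteq> []" using play Finite_Play by auto
    have "ok (xs ! k)" if "k < length xs" for k
      using that
    proof (induction k)
      case 0 then show ?case using st okv Finite_Play xs by (simp add: hd_conv_nth)
    next
      case (Suc k)
      then have "(xs ! k, xs ! Suc k) \<in> moves G" using play Finite_Play by simp
      moreover have "s (xs ! k) = Some (xs ! Suc k)" if "xs ! k \<in> controlled G Bob"
        using conf that Suc.prems unfolding Finite_Play conforms.simps
        by (metis Suc_lessD less_irrefl)
      ultimately show ?case using Suc step by simp
    qed
    then have okl: "ok (last xs)" using xs by (simp add: last_conv_nth)
    have "last xs \<notin> controlled G Bob"
    proof
      assume "last xs \<in> controlled G Bob"
      then have "s (last xs) = None" using conf xs unfolding Finite_Play conforms.simps
        by (auto simp: last_conv_nth dest!: spec[of _ "length xs - 1"])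
      then show False using okl \<open>last xs \<in> controlled G Bob\<close>
        by (auto simp: ok_def s_def controlled_Bob)
    qed
    then show ?thesis using okl X_lt assms(1)
      by (auto simp: Finite_Play ok_def F_Bob controlled_Bob)
  next
    case (Infinite_Play f) then show ?thesis by simp
  qed
  then show ?thesis
    using str X_lt[of v] cyc assms(1)
    by (auto simp: surviving_set_def configs_eq controlled_Bob X_def)
qed

end

section \<open>The reduction as a program\<close>

notation Seq (infixr \<open>;;\<close> 60)
notation Assign (infix \<open>::=\<close> 61)

abbreviation "Or b c \<equiv> Neg (Conj (Neg b) (Neg c))"
abbreviation "Ite b c d \<equiv> Or (Conj b c) (Conj (Neg b) d)"
abbreviation "Twice a \<equiv> Mul (Lit 2) a"
abbreviation "Succ a \<equiv> Add a (Lit 1)"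

abbreviation Addr :: "aexp \<Rightarrow> aexp \<Rightarrow> aexp" where
  "Addr s w \<equiv> Add (Mul s (Reg ''N'')) w"

abbreviation Set_Digit :: "aexp \<Rightarrow> aexp \<Rightarrow> aexp \<Rightarrow> aexp" where
  "Set_Digit w b x \<equiv> Add (Add (Mul (Quot x (Twice w)) (Twice w)) (Mul b w)) (Rem x w)"

abbreviation Flip :: "aexp \<Rightarrow> aexp \<Rightarrow> aexp" where
  "Flip w x \<equiv> Set_Digit w (Sub (Lit 1) (Rem (Quot x w) (Lit 2))) x"

abbreviation "Weight \<equiv> Cell ''p'' (Reg ''t'')"

text \<open>The machine has no logarithm: \<open>N\<close> is found by doubling, and the powers met
  on the way fill the table \<open>p\<close> of stage weights, whose second half is the mirror image
  of the first. The flag \<open>g\<close> stays 1 as long as all entries of \<open>C\<close>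
  examined are attained.\<close>

definition setup_prog :: com where
  "setup_prog =
     ''N'' ::= Lit 1 ;; ''L'' ::= Lit 0 ;;
     While (Less (Reg ''N'') (Succ (Twice (Reg ''n2''))))
       (Store ''p'' (Reg ''L'') (Reg ''N'') ;; ''N'' ::= Twice (Reg ''N'') ;; ''L'' ::= Succ (Reg ''L'')) ;;
     For ''t'' (Reg ''L'')
       (Store ''p'' (Sub (Sub (Twice (Reg ''L'')) (Lit 1)) (Reg ''t'')) Weight) ;;
     ''V0'' ::= Reg ''n1'' ;; ''V1'' ::= Mul (Mul (Lit 4) (Reg ''L'')) (Reg ''N'') ;; ''g'' ::= Lit 1"

abbreviation Add_Arc :: "aexp \<Rightarrow> aexp \<Rightarrow> com" where
  "Add_Arc x y \<equiv> Store ''src1'' (Reg ''E1'') x ;; Store ''dst1'' (Reg ''E1'') y ;; ''E1'' ::= Succ (Reg ''E1'')"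

definition add_arcs :: "aexp \<Rightarrow> bexp \<Rightarrow> aexp \<Rightarrow> aexp \<Rightarrow> com" where
  "add_arcs bound b x y = For ''q'' bound (Cond b
     (Add_Arc x y) Skip)"

definition graphs_prog :: com where
  "graphs_prog =
     For ''q'' (Reg ''n1'') (Store ''src0'' (Reg ''q'') (Reg ''q'') ;; Store ''dst0'' (Reg ''q'') (Reg ''q'')) ;;
     ''E0'' ::= Reg ''n1'' ;;
     (let v = Quot (Reg ''q'') (Lit 2); s = Quot v (Twice (Reg ''N'')) in
      add_arcs (Twice (Reg ''V1''))
        (Neg (Conj (Neg (Less v (Mul (Lit 4) (Reg ''n2'')))) (Less v (Twice (Reg ''N'')))))
        v (Add (Twice (Addr (Rem (Succ s) (Twice (Reg ''L'')))
             (Set_Digit (Cell ''p'' s) (Rem v (Lit 2)) (Rem (Quot v (Lit 2)) (Reg ''N'')))))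
           (Rem (Reg ''q'') (Lit 2)))) ;;
     (let u = Quot (Reg ''q'') (Lit 4) in
      add_arcs (Mul (Mul (Lit 4) (Reg ''n2'')) (Reg ''n2''))
        (Less (Lit 0) (Cell ''B'' u))
        (Add (Twice (Add (Reg ''n2'') (Rem u (Reg ''n2'')))) (Rem (Reg ''q'') (Lit 2)))
        (Add (Twice (Quot u (Reg ''n2''))) (Rem (Quot (Reg ''q'') (Lit 2)) (Lit 2))))"

abbreviation Row_A :: "aexp \<Rightarrow> aexp" where
  "Row_A x \<equiv> Add (Mul (Reg ''i'') (Reg ''n2'')) x"

abbreviation Row_C :: "aexp \<Rightarrow> aexp" where
  "Row_C x \<equiv> Add (Mul (Reg ''i'') (Reg ''n2'')) (Sub x (Reg ''n2''))"

text \<open>Only strict comparisons of entries are available, so a non-strict one is the negation of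
  the reverse. Reading an entry that carries no information is harmless, since the guards then make
  its value irrelevant.\<close>

definition Preceq :: "aexp \<Rightarrow> aexp \<Rightarrow> bexp" where
  "Preceq x y = (let
     isA = (\<lambda>x. Less x (Reg ''n2''));
     idle = (\<lambda>x. Neg (Less x (Twice (Reg ''n2''))));
     none = (\<lambda>x. Conj (Neg (isA x)) (Less (Cell ''C'' (Row_C x)) (Lit 1)))
   in Or (idle x) (Conj (Neg (idle y)) (Or (none x) (Conj (Neg (none y))
     (Ite (isA x)
       (Ite (isA y) (Neg (Entry_Less ''A'' (Row_A y) ''A'' (Row_A x))) (Neg (Entry_Less ''C'' (Row_C y) ''A'' (Row_A x))))
       (Ite (isA y) (Entry_Less ''C'' (Row_C x) ''A'' (Row_A y)) (Neg (Entry_Less ''C'' (Row_C y) ''C'' (Row_C x)))))))))"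

text \<open>A single loop over the output positions merges all pairs of blocks, resetting the read
  positions whenever a new pair begins; a level thus costs \<open>N\<close> rounds of constant cost.
  Every level has its own stretch of \<open>o\<close>.\<close>

definition merge_prog :: com where
  "merge_prog = (let
     block = Sub (Reg ''q'') (Rem (Reg ''q'') (Twice Weight));
     left = Cell ''o'' (Addr (Reg ''t'') (Reg ''a''));
     right = Cell ''o'' (Addr (Reg ''t'') (Reg ''b''));
     out = Addr (Succ (Reg ''t'')) (Reg ''q'')
   in For ''q'' (Reg ''N'')
     (Cond (Less (Rem (Reg ''q'') (Twice Weight)) (Lit 1))
        (''a'' ::= Reg ''q'' ;; ''b'' ::= Add (Reg ''q'') Weight) Skip ;;
      Cond (Conj (Less (Reg ''a'') (Add block Weight))
             (Or (Neg (Less (Reg ''b'') (Add block (Twice Weight)))) (Preceq left right)))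
        (Store ''o'' out left ;; ''a'' ::= Succ (Reg ''a''))
        (Store ''o'' out right ;; ''b'' ::= Succ (Reg ''b''))))"

definition sort_prog :: com where
  "sort_prog =
     For ''q'' (Reg ''N'') (Store ''o'' (Reg ''q'') (Reg ''q'')) ;;
     For ''t'' (Reg ''L'') merge_prog"

abbreviation "Sorted x \<equiv> Cell ''o'' (Addr (Reg ''L'') x)"

text \<open>Register \<open>c\<close> holds the last row of \<open>B\<close> met in the sorted order, that is, the only
  possible witness for the attainment of an entry of \<open>C\<close> that comes next.\<close>

abbreviation "Not_Attained \<equiv>
  Conj (Conj (Less (Reg ''e'') (Twice (Reg ''n2''))) (Less (Lit 0) (Cell ''C'' (Row_C (Reg ''e'')))))
     (Neg (Conj (Less (Reg ''c'') (Reg ''n2'')) (Conj (Neg (Entry_Less ''A'' (Row_A (Reg ''c'')) ''C'' (Row_C (Reg ''e''))))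
     (Less (Lit 0) (Cell ''B'' (Add (Mul (Reg ''c'') (Reg ''n2'')) (Sub (Reg ''e'') (Reg ''n2''))))))))"

text \<open>The initial value \<open>N\<close> of \<open>c\<close> exceeds every row number and
  means that no row has been met yet.\<close>

definition attained_prog :: com where
  "attained_prog =
     ''c'' ::= Reg ''N'' ;;
     For ''q'' (Reg ''N'')
       (''e'' ::= Sorted (Reg ''q'') ;;
        Cond (Less (Reg ''e'') (Reg ''n2''))
          (''c'' ::= Reg ''e'')
          (Cond Not_Attained
             (''g'' ::= Lit 0) Skip))"

definition permutation_prog :: com where
  "permutation_prog =
     For ''q'' (Reg ''N'')
       (''e'' ::= Sorted (Reg ''q'') ;;
        ''f'' ::= Sorted (Rem (Succ (Reg ''q'')) (Reg ''N'')) ;;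
        Store ''T'' (Reg ''f'') (Reg ''e'') ;; Store ''I'' (Reg ''e'') (Reg ''f''))"

text \<open>Two pointers: \<open>y\<close> walks along the current cycle, and when that is closed,
  \<open>x\<close> scans for a point at which the next one can start.\<close>

abbreviation "Colour_Step \<equiv>
  Cond (Less (Cell ''k'' (Reg ''y'')) (Lit 2)) (''x'' ::= Succ (Reg ''x'') ;; ''y'' ::= Reg ''x'')
     (''z'' ::= Flip Weight (Reg ''y'') ;; Store ''k'' (Reg ''y'') (Lit 0) ;; Store ''k'' (Reg ''z'') (Lit 1) ;;
     ''y'' ::= Cell ''I'' (Addr (Reg ''t'') (Flip Weight (Cell ''T'' (Addr (Reg ''t'') (Reg ''z''))))))"

definition colour_prog :: com where
  "colour_prog =
     For ''q'' (Reg ''N'') (Store ''k'' (Reg ''q'') (Lit 2)) ;;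
     ''x'' ::= Lit 0 ;; ''y'' ::= Lit 0 ;;
     While (Less (Reg ''x'') (Reg ''N''))
       Colour_Step"

abbreviation "Switch_Stores \<equiv>
  Store ''D'' (Addr (Reg ''t'') (Reg ''q'')) (Cell ''k'' (Reg ''q'')) ;;
     Store ''D'' (Addr (Sub (Sub (Twice (Reg ''L'')) (Lit 1)) (Reg ''t'')) (Reg ''r'')) (Rem (Quot (Reg ''f'') Weight) (Lit 2)) ;;
     Store ''T'' (Addr (Succ (Reg ''t'')) (Reg ''h'')) (Reg ''r'') ;; Store ''I'' (Addr (Succ (Reg ''t'')) (Reg ''r'')) (Reg ''h'')"

text \<open>Wire \<open>q\<close> has to reach \<open>f\<close>. Its colour is the digit chosen at
  stage \<open>t\<close>, which leads to \<open>h\<close>; the same digit written into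
  \<open>f\<close> gives \<open>r\<close>, the wire from which stage \<open>2 * L - 1 - t\<close>
  restores the digit of \<open>f\<close>. What remains for the inner network is to take
  \<open>h\<close> to \<open>r\<close>.\<close>

definition switch_prog :: com where
  "switch_prog =
     For ''q'' (Reg ''N'')
       (''h'' ::= Set_Digit Weight (Cell ''k'' (Reg ''q'')) (Reg ''q'') ;;
        ''f'' ::= Cell ''T'' (Addr (Reg ''t'') (Reg ''q'')) ;;
        ''r'' ::= Set_Digit Weight (Cell ''k'' (Reg ''q'')) (Reg ''f'') ;;
        Switch_Stores)"

text \<open>The parity of \<open>sum\<close> is 1 exactly at the illegal vertices. The second half
  of each bit array holds the configurations of Bob, all of which go to Alice.\<close>

definition targets_prog :: com where
  "targets_prog = (let
     out = Add (Mul (Reg ''i'') (Reg ''V1'')) (Reg ''q'');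
     out' = Add (Mul (Reg ''V0'') (Reg ''V1'')) out;
     sum = Add (Cell ''D'' (Quot (Reg ''q'') (Lit 2))) (Reg ''q'')
   in For ''q'' (Reg ''V1'')
     (Store ''F0'' out (Rem sum (Lit 2)) ;; Store ''F1'' out (Rem (Succ sum) (Lit 2)) ;;
      Store ''F0'' out' (Lit 1) ;; Store ''F1'' out' (Lit 0)))"

definition row_prog :: com where
  "row_prog = sort_prog ;; attained_prog ;; permutation_prog ;;
     For ''t'' (Reg ''L'') (colour_prog ;; switch_prog) ;; targets_prog"

text \<open>Alice's candidates are everything or nothing, as told by \<open>g\<close>; Bob's arrays
  are never written and so denote the empty set.\<close>

definition candidates_prog :: com where
  "candidates_prog = For ''q'' (Twice (Mul (Reg ''V0'') (Reg ''V1'')))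
     (Store ''W0'' (Reg ''q'') (Reg ''g'') ;; Store ''S0'' (Reg ''q'') (Reg ''g''))"

definition reduction_prog :: com where
  "reduction_prog = setup_prog ;; graphs_prog ;; For ''i'' (Reg ''n1'') row_prog ;; candidates_prog"

subsection \<open>Correctness of the phases\<close>

text \<open>\<open>L\<close> is determined by running the setup and is therefore a parameter.
  \<open>upper\<close> holds since doubling stops at the first power above \<open>2 * m\<close>. The
  bound on \<open>M\<close> covers every address, in particular the \<open>8 * n * L * N\<close>
  cells of an array of configurations and the list of Bob's arcs.\<close>

locale msb_run =
  fixes n m L M :: nat and A :: "'a::linorder mat" and B :: "bool mat" and C :: "'a option mat"
  assumes n: "n \<ge> 1" and m': "m \<ge> 1" and wires': "2 * m < 2 ^ L" and upper: "2 ^ L \<le> 4 * m"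
    and inst: "distinct_msb_instance n m m A B C"
    and M: "16 * n * L * 2 ^ L + 8 * m * m < M"
begin

sublocale network L m "\<lambda>k j. B $$ (k, j)"
  using m' wires' by unfold_locales

abbreviation "E \<equiv> msb_entries n m m A C"

definition base :: "state \<Rightarrow> bool" where
  "base s \<longleftrightarrow> regs s ''n1'' = n \<and> regs s ''n2'' = m \<and> regs s ''N'' = N \<and> regs s ''L'' = L \<and>
     regs s ''V0'' = n \<and> regs s ''V1'' = 4 * L * N \<and> (\<forall>t < 2 * L. cells s ''p'' t = weight t) \<and>
     (\<forall>a. cells s ''B'' a = of_bool (a < m * m \<and> B $$ (a div m, a mod m))) \<and>
     (\<forall>a. cells s ''C'' a = of_bool (a < n * m \<and> C $$ (a div m, a mod m) \<noteq> None))"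

lemma baseD:
  assumes "base s"
  shows "regs s ''n1'' = n" "regs s ''n2'' = m" "regs s ''N'' = N" "regs s ''L'' = L"
    "regs s ''V0'' = n" "regs s ''V1'' = 4 * L * N" "t < 2 * L \<Longrightarrow> cells s ''p'' t = weight t"
    "cells s ''B'' a = of_bool (a < m * m \<and> B $$ (a div m, a mod m))"
    "cells s ''C'' a = of_bool (a < n * m \<and> C $$ (a div m, a mod m) \<noteq> None)"
  using assms by (auto simp: base_def)

lemma base_agree_off:
  assumes "agree_off X Y s s'" "base s"
    "X \<inter> {''n1'', ''n2'', ''N'', ''L'', ''V0'', ''V1''} = {}" "Y \<inter> {''p'', ''B'', ''C''} = {}"
  shows "base s'"
proof -
  have "regs s' x = regs s x" if "x \<in> {''n1'', ''n2'', ''N'', ''L'', ''V0'', ''V1''}" for x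
    using assms that by (intro agree_off_reg[OF assms(1)]) blast
  moreover have "cells s' x = cells s x" if "x \<in> {''p'', ''B'', ''C''}" for x
    using assms that by (intro agree_off_cells[OF assms(1)]) blast
  ultimately show ?thesis using assms(2) by (simp add: base_def)
qed

lemma weight_less_L: "t < L \<Longrightarrow> weight t = 2 ^ t"
  by (simp add: weight_def)

lemma M_bounds:
  shows "N < M" "L < M" "2 * L < M" "4 * L * N < M" "8 * L * N + 4 * m * m < M" "8 * n * L * N < M" "n < M" "m * m < M" "8 < M"
proof -
  have "L * N \<le> n * (L * N)" using n by simp
  moreover have "N \<le> L * N" "L \<le> L * N" using L_pos N_pos by simp_all
  moreover have "n \<le> n * (L * N)" "1 \<le> n * (L * N)" using n L_pos N_pos by simp_all
  moreover have "16 * (n * (L * N)) + 8 * (m * m) < M" using M by (simp add: N_def mult.assoc)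
  ultimately show "N < M" "L < M" "2 * L < M" "4 * L * N < M" "8 * L * N + 4 * m * m < M" "8 * n * L * N < M" "n < M" "m * m < M" "8 < M"
    unfolding mult.assoc by linarith+
qed

lemma addr_less: "s < K \<Longrightarrow> w < N \<Longrightarrow> s * N + w < K * N"
proof -
  assume "s < K" "w < N"
  then have "s * N + w < Suc s * N" by simp
  also have "\<dots> \<le> K * N" using \<open>s < K\<close> by (intro mult_right_mono) auto
  finally show ?thesis .
qed

lemma addr_eq_iff: "w < N \<Longrightarrow> w' < N \<Longrightarrow> s * N + w = s' * N + w' \<longleftrightarrow> s = s' \<and> w = w'"
proof -
  assume "w < N" "w' < N"
  then have "(s * N + w) div N = s" "(s * N + w) mod N = w" "(s' * N + w') div N = s'" "(s' * N + w') mod N = w'"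
    by simp_all
  then show ?thesis by metis
qed

lemma addr_M: "s \<le> 2 * L \<Longrightarrow> w < N \<Longrightarrow> s * N + w < M"
proof -
  assume "s \<le> 2 * L" "w < N"
  then have "s * N + w < Suc (2 * L) * N" by (intro addr_less) auto
  also have "\<dots> \<le> (4 * L) * N" using L_pos by (intro mult_right_mono) auto
  finally show ?thesis using M_bounds(4) by simp
qed

end

lemma aval_Set_Digit [simp]: "aval s (Set_Digit w b x) = set_digit (aval s w) (aval s b) (aval s x)"
  by (simp add: set_digit_def)

lemma aval_Flip: "aval s (Flip w x) = flip_digit (aval s w) (aval s x)"
  by (simp add: flip_digit_def set_digit_def)

lemma written_merge_prog [simp]:
  "written_regs merge_prog = {''q'', ''a'', ''b''}" "written_arrays merge_prog = {''o''}"
  by (auto simp: merge_prog_def Let_def)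

lemma written_sort_prog [simp]:
  "written_regs sort_prog = {''t'', ''q'', ''a'', ''b''}" "written_arrays sort_prog = {''o''}"
  by (auto simp: sort_prog_def)

context msb_run
begin

section \<open>The order of rows and columns for a fixed row of the first matrix\<close>

definition none :: "nat \<Rightarrow> nat \<Rightarrow> bool" where
  "none i x \<longleftrightarrow> m \<le> x \<and> C $$ (i, x - m) = None"

definition val :: "nat \<Rightarrow> nat \<Rightarrow> 'a" where
  "val i x = (if x < m then A $$ (i, x) else the (C $$ (i, x - m)))"

text \<open>Idle wires are least. Next come the columns with \<open>None\<close>, which acts as
  minus infinity: any row of \<open>B\<close> that hits such a column lies above it and is a
  violation, as it should be. Comparison is strict only from a column to a row, which puts a row
  before a column of the same value.\<close>

definition le :: "nat \<Rightarrow> nat \<Rightarrow> nat \<Rightarrow> bool" where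
  "le i x y \<longleftrightarrow> 2 * m \<le> x \<or> (y < 2 * m \<and> (none i x \<or> (\<not> none i y \<and>
     (if \<not> x < m \<and> y < m then val i x < val i y else val i x \<le> val i y))))"

lemma preordered_le: "preordered (le i)"
proof
  show "le i x x" for x by (auto simp: le_def)
  show "le i x z" if "le i x y" "le i y z" for x y z
    using that unfolding le_def by (auto split: if_splits)
  show "le i x y \<or> le i y x" for x y
    unfolding le_def by (auto split: if_splits)
qed

lemma row_addr: "i < n \<Longrightarrow> k < m \<Longrightarrow> i * m + k < n * m \<and> (i * m + k) div m = i \<and> (i * m + k) mod m = k"
proof -
  assume "i < n" "k < m"
  then have "i * m + k < Suc i * m" by simp
  also have "\<dots> \<le> n * m" using \<open>i < n\<close> by (intro mult_right_mono) auto
  finally show ?thesis using \<open>k < m\<close> by simp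
qed

lemma entries_A: "i < n \<Longrightarrow> k < m \<Longrightarrow> E ''A'' (i * m + k) = A $$ (i, k)"
  using row_addr[of i k] by (simp add: msb_entries_def)

lemma entries_C: "i < n \<Longrightarrow> j < m \<Longrightarrow> C $$ (i, j) \<noteq> None \<Longrightarrow> E ''C'' (i * m + j) = the (C $$ (i, j))"
  using row_addr[of i j] by (simp add: msb_entries_def)

lemma cells_C: "base s \<Longrightarrow> i < n \<Longrightarrow> j < m \<Longrightarrow> cells s ''C'' (i * m + j) = of_bool (C $$ (i, j) \<noteq> None)"
  using row_addr[of i j] baseD(9)[of s] by simp

lemma cells_B: "base s \<Longrightarrow> k < m \<Longrightarrow> j < m \<Longrightarrow> cells s ''B'' (k * m + j) = of_bool (B $$ (k, j))"
proof -
  assume b: "base s" and kj: "k < m" "j < m"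
  then have "k * m + j < Suc k * m" by simp
  also have "\<dots> \<le> m * m" using kj by (intro mult_right_mono) auto
  finally show ?thesis using b kj by (simp add: baseD)
qed

lemma bval_Preceq:
  assumes s: "base s" "regs s ''i'' = i" "i < n"
  shows "bval E s (Preceq x y) \<longleftrightarrow> le i (aval s x) (aval s y)"
proof -
  have C1: "cells s ''C'' (i * m + X - m) = of_bool (C $$ (i, X - m) \<noteq> None)" if "m \<le> X" "X < 2 * m" for X
    using that cells_C[OF s(1,3), of "X - m"] by auto
  have C2: "E ''C'' (i * m + X - m) = the (C $$ (i, X - m))"
    if "m \<le> X" "X < 2 * m" "C $$ (i, X - m) \<noteq> None" for X
    using that entries_C[OF s(3), of "X - m"] by auto
  show ?thesis
    unfolding Preceq_def Let_def le_def
    using s(2,3) baseD(2)[OF s(1)]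
    by (cases "aval s x < m"; cases "aval s x < 2 * m"; cases "aval s y < m"; cases "aval s y < 2 * m";
      cases "none i (aval s x)"; cases "none i (aval s y)")
      (auto simp: C1 C2 entries_A none_def val_def not_less not_le)
qed

definition order_at :: "state \<Rightarrow> nat \<Rightarrow> nat \<Rightarrow> nat" where
  "order_at s t x = cells s ''o'' (t * N + x)"

lemma order_at_set_reg [simp]: "order_at (set_reg x k s) = order_at s"
  by (simp add: order_at_def fun_eq_iff)

definition sorted_level :: "nat \<Rightarrow> nat \<Rightarrow> state \<Rightarrow> bool" where
  "sorted_level i t s \<longleftrightarrow> order_at s t ` {..<N} = {..<N} \<and>
     preordered.sorted_blocks (le i) (2 ^ t) (order_at s t) N"

lemma block_fits:
  fixes q :: nat
  assumes "d dvd N" "q < N"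
  shows "q - q mod d + d \<le> N"
proof -
  obtain k where k: "N = d * k" using assms(1) by blast
  then have d: "d > 0" using N_pos by (cases d) auto
  have "q div d < k" using assms(2) k by (simp add: less_mult_imp_div_less mult.commute)
  then have "Suc (q div d) * d \<le> k * d" by (intro mult_right_mono) auto
  moreover have "q - q mod d = q div d * d" by (simp add: minus_mod_eq_div_mult)
  ultimately show ?thesis by (simp add: k mult.commute)
qed

lemma runs_merge:
  assumes s: "base s" "regs s ''i'' = i" "i < n" "regs s ''t'' = t" "t < L" and srt: "sorted_level i t s"
  shows "runs M E merge_prog s (N * (6 + 2) + 2) (sorted_level i (Suc t))"
proof -
  interpret pre: preordered "le i" by (rule preordered_le)
  define w :: nat where "w = 2 ^ t"
  have w0: "w > 0" by (simp add: w_def)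
  have wN: "2 * w dvd N" using weight_dvd[of t] weight_less_L[of t] s(5) by (simp add: w_def)
  let ?src = "order_at s t"
  have src_lt: "?src x < N" if "x < N" for x using srt that by (auto simp: sorted_level_def)
  have src_sorted: "pre.sorted_blocks w ?src N" using srt by (simp add: sorted_level_def w_def)
  \<comment> \<open>For \<open>q > 0\<close> the invariant describes the block that contains
    position \<open>q - 1\<close>; at a block boundary it still speaks of the block just
    finished.\<close>
  let ?Inv = "\<lambda>q s'. (\<forall>x < N. order_at s' t x = ?src x) \<and> (q = 0 \<or>
    (\<exists>z. pre.merging w ?src (order_at s' (Suc t)) z q (regs s' ''a'') (regs s' ''b'') \<and> z < q \<and> q \<le> z + 2 * w))"
  have "runs M E merge_prog s (N * (6 + 2) + 2) (?Inv N)"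
    unfolding merge_prog_def Let_def
  proof (rule runs_For_reg[where Inv = ?Inv], goal_cases)
    case 1 show ?case using s(1) by (simp add: baseD)
  next
    case 2 show ?case using M_bounds by simp
  next
    case 3 show ?case by simp
  next
    case 4 show ?case by (simp add: order_at_def)
  next
    case (5 s1 q)
    have b1: "base s1" using base_agree_off[OF 5(1) s(1)] by simp
    have r1: "regs s1 ''i'' = i" "regs s1 ''t'' = t" "regs s1 ''q'' = q" "cells s1 ''p'' t = w"
      using 5(1) s 5(2) baseD(7)[OF b1, of t] by (simp_all add: agree_off_def w_def weight_less_L)
    define z where "z = q - q mod (2 * w)"
    have zN: "z + 2 * w \<le> N" using block_fits[OF wN 5(3)] by (simp add: z_def)
    have qz: "q < z + 2 * w"
    proof -
      have "q mod (2 * w) < 2 * w" using w0 by simp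
      moreover have "q mod (2 * w) \<le> q" by simp
      ultimately show ?thesis unfolding z_def by linarith
    qed
    have merged: "pre.merged w ?src (order_at s1 (Suc t)) q" if "q mod (2 * w) = 0"
    proof (cases "q = 0")
      case True then show ?thesis using pre.merged_0 by simp
    next
      case False
      then obtain z' where z': "pre.merging w ?src (order_at s1 (Suc t)) z' q (regs s1 ''a'') (regs s1 ''b'')"
        "z' < q" "q \<le> z' + 2 * w" using 5(4) by auto
      have "z' mod (2 * w) = 0" using z'(1) by (simp add: pre.merging_def)
      then have "2 * w dvd q - z'" using that z'(2) by (auto intro: dvd_diff_nat)
      then have "q = z' + 2 * w" using z'(2,3) by (auto dest: dvd_imp_le)
      then show ?thesis using pre.merging_done z'(1) by simp
    qed
    have unmerged: "pre.merging w ?src (order_at s1 (Suc t)) z q (regs s1 ''a'') (regs s1 ''b'')"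
      if "q mod (2 * w) \<noteq> 0"
    proof -
      have "q \<noteq> 0" using that by (intro notI) simp
      then obtain z' where z': "pre.merging w ?src (order_at s1 (Suc t)) z' q (regs s1 ''a'') (regs s1 ''b'')"
        "z' < q" "q \<le> z' + 2 * w" using 5(4) by auto
      have z'0: "z' mod (2 * w) = 0" using z'(1) by (simp add: pre.merging_def)
      then have "q \<noteq> z' + 2 * w" using that by auto
      then have "q div (2 * w) = z' div (2 * w)"
        using z' by (intro pre.div_eq_same_block z'0) auto
      then have "z = z'" using z'0 by (simp add: z_def minus_mod_eq_div_mult) (metis z'0 mult_div_mod_eq add.right_neutral mult.commute)
      then show ?thesis using z'(1) by simp
    qed
    let ?M2 = "\<lambda>s2. cells s2 = cells s1 \<and>
      pre.merging w ?src (order_at s1 (Suc t)) z q (regs s2 ''a'') (regs s2 ''b'')"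
    show ?case
    proof (rule runs_Seq_le[where R = ?M2 and T = 3 and T' = 3], goal_cases)
      case 1
      show ?case
      proof (rule runs_loop_free, goal_cases)
        case 2 then show ?case using r1 w0 zN qz M_bounds(1) 5(3) by (auto simp: z_def)
      next
        case 4
        show ?case using r1 unmerged pre.merging_start[OF merged] by (auto simp: z_def)
      qed simp_all
    next
      case (2 s2)
      have b2: "base s2" using base_agree_off[OF 2(1) b1] by simp
      have r2: "regs s2 ''i'' = i" "regs s2 ''t'' = t" "regs s2 ''q'' = q" "cells s2 ''p'' t = w" "cells s2 = cells s1"
        using 2(1) r1 2(2) by (simp_all add: agree_off_def)
      define a b where "a = regs s2 ''a''" and "b = regs s2 ''b''"
      have mg: "pre.merging w ?src (order_at s1 (Suc t)) z q a b" using 2(2) by (simp add: a_def b_def)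
      then have ab: "a \<le> z + w" "b \<le> z + 2 * w" "a + b = q + z + w" "z \<le> a" "z + w \<le> b" "z mod (2 * w) = 0"
        by (auto simp: pre.merging_def)
      have src: "cells s1 ''o'' (t * N + x) = ?src x" if "x < N" for x
        using 5(4) that by (simp add: order_at_def)
      define left where "left \<longleftrightarrow> a < z + w \<and> (\<not> b < z + 2 * w \<or> le i (?src a) (?src b))"
      have aN: "a < N" using ab zN w0 by linarith
      have leftb: "left \<longleftrightarrow> bval E s2 (Conj (Less (Reg ''a'') (Add (Sub (Reg ''q'') (Rem (Reg ''q'') (Twice Weight))) Weight))
             (Or (Neg (Less (Reg ''b'') (Add (Sub (Reg ''q'') (Rem (Reg ''q'') (Twice Weight))) (Twice Weight))))
               (Preceq (Cell ''o'' (Addr (Reg ''t'') (Reg ''a''))) (Cell ''o'' (Addr (Reg ''t'') (Reg ''b''))))))"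
      proof -
        have "cells s1 ''o'' (t * N + b) = ?src b" if "b < z + 2 * w" using src that zN by simp
        then show ?thesis
          using r2 src[OF aN] by (auto simp: left_def bval_Preceq[OF b2 r2(1) s(3)] baseD(3)[OF b2] a_def[symmetric] b_def[symmetric] z_def[symmetric])
      qed
      have bN: "b < N" if "\<not> left"
        using that ab zN qz unfolding left_def by auto
      have out: "Suc t * N + q < M" using addr_M[of "Suc t" q] 5(3) s(5) by simp
      have dst: "order_at (set_cell ''o'' (Suc t * N + q) v s2) (Suc t) = (order_at s1 (Suc t))(q := v)" for v
        by (auto simp: order_at_def fun_eq_iff r2(5))
      have dst': "order_at (set_cell ''o'' (Suc t * N + q) v s2) t x = ?src x" if "x < N" for v x
      proof -
        have "t * N + x < Suc t * N" using that by simp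
        then have "t * N + x \<noteq> Suc t * N + q" by linarith
        then show ?thesis using src that by (simp add: order_at_def r2(5))
      qed
      note step = pre.merging_step[OF mg qz zN src_sorted left_def, of "(order_at s1 (Suc t))(q := if left then ?src a else ?src b)"]
      show ?case
      proof (rule runs_loop_free, goal_cases)
        case 2
        show ?case
          using aN bN src_lt M_bounds(1) out
          by (simp add: leftb[symmetric] r2 src a_def[symmetric] b_def[symmetric] baseD(3)[OF b2] less_trans[OF src_lt] del: aval.simps bval.simps(3,4) mult_Suc)
             (auto simp: src r2 baseD(3)[OF b2] a_def[symmetric] b_def[symmetric] intro: less_trans[OF src_lt])
      next
        case 4
        have "z < Suc q" by (simp add: z_def)
        show ?case
        proof (cases left)
          case True
          then show ?thesis using step \<open>z < Suc q\<close> qz aN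
            by (simp only: result.simps leftb[symmetric] if_True)
              (auto simp: dst dst' src r2 baseD(3)[OF b2] a_def[symmetric] b_def[symmetric] simp del: mult_Suc intro!: exI[of _ z])
        next
          case False
          then show ?thesis using step \<open>z < Suc q\<close> qz bN
            by (simp only: result.simps leftb[symmetric] if_False)
              (auto simp: dst dst' src r2 baseD(3)[OF b2] a_def[symmetric] b_def[symmetric] simp del: mult_Suc intro!: exI[of _ z])
        qed
      qed simp_all
    qed simp_all
  qed
  then show ?thesis
  proof (rule runs_weaken)
    fix s' assume I: "?Inv N s'"
    then obtain z where z: "pre.merging w ?src (order_at s' (Suc t)) z N (regs s' ''a'') (regs s' ''b'')"
      "z < N" "N \<le> z + 2 * w" using N_pos by auto
    have "2 * w dvd N - z" using z wN by (auto simp: pre.merging_def intro: dvd_diff_nat)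
    then have "N = z + 2 * w" using z(2,3) by (auto dest: dvd_imp_le)
    then have "pre.merged w ?src (order_at s' (Suc t)) N" using pre.merging_done z(1) by metis
    then show "sorted_level i (Suc t) s'"
      using srt by (simp add: sorted_level_def pre.merged_def w_def)
  qed simp
qed

lemma runs_sort:
  assumes s: "base s" "regs s ''i'' = i" "i < n"
  shows "runs M E sort_prog s (N * 3 + 2 + (L * (N * 8 + 4) + 2)) (sorted_level i L)"
  unfolding sort_prog_def
proof (rule runs_Seq[where R = "sorted_level i 0"], goal_cases)
  case 1
  have "runs M E (For ''q'' (Reg ''N'') (Store ''o'' (Reg ''q'') (Reg ''q''))) s (N * (1 + 2) + 2)
     (\<lambda>s'. \<forall>x<N. cells s' ''o'' x = x)"
  proof (rule runs_For_reg[where Inv = "\<lambda>q s'. \<forall>x<q. cells s' ''o'' x = x"], goal_cases)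
    case 1 show ?case using s(1) by (simp add: baseD)
  next
    case 2 show ?case using M_bounds by simp
  next
    case (5 s1 q)
    show ?case using 5 M_bounds(1) by (intro runs_loop_free) (auto simp: less_Suc_eq)
  qed simp_all
  then show ?case
  proof (rule runs_weaken)
    fix s' :: state assume "\<forall>x<N. cells s' ''o'' x = x"
    then show "sorted_level i 0 s'"
      by (auto simp: sorted_level_def order_at_def preordered.sorted_blocks_def[OF preordered_le] image_def)
  qed simp
next
  case (2 s1)
  have b1: "base s1" using base_agree_off[OF 2(1) s(1)] by simp
  have i1: "regs s1 ''i'' = i" using 2(1) s(2) by (simp add: agree_off_def)
  have "runs M E (For ''t'' (Reg ''L'') merge_prog) s1 (L * ((N * (6 + 2) + 2) + 2) + 2) (sorted_level i L)"
  proof (rule runs_For_reg[where Inv = "sorted_level i"], goal_cases)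
    case 1 show ?case using b1 by (simp add: baseD)
  next
    case 2 show ?case using M_bounds by simp
  next
    case 4 show ?case using 2(2) by (simp add: sorted_level_def order_at_def)
  next
    case (5 s2 t)
    have "base s2" using base_agree_off[OF 5(1) b1] by simp
    moreover have "regs s2 ''i'' = i" using 5(1) i1 by (simp add: agree_off_def)
    ultimately have "runs M E merge_prog s2 (N * (6 + 2) + 2) (sorted_level i (Suc t))"
      using 5 s(3) by (intro runs_merge) auto
    then show ?case by (rule runs_weaken) (simp_all add: sorted_level_def order_at_def[abs_def])
  qed simp_all
  then show ?case by (rule runs_weaken) (simp_all add: algebra_simps)
qed

lemma base_preserved:
  assumes "agree_off X Y s s'" "base s" "regs s ''i'' = i"
    "X \<inter> {''n1'', ''n2'', ''N'', ''L'', ''V0'', ''V1'', ''i''} = {}" "Y \<inter> {''p'', ''B'', ''C''} = {}"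
  shows "base s'" "regs s' ''i'' = i"
proof -
  have "''i'' \<notin> X" using assms(4) by blast
  then show "regs s' ''i'' = i" using agree_off_reg[OF assms(1)] assms(3) by metis
  show "base s'" using assms(4,5) by (intro base_agree_off[OF assms(1,2)]) auto
qed

section \<open>Attainment of the entries of the candidate\<close>

lemma sorted_levelD:
  assumes "sorted_level i L s"
  shows "order_at s L ` {..<N} = {..<N}" "inj_on (order_at s L) {..<N}"
    "x < N \<Longrightarrow> order_at s L x < N"
    "x < y \<Longrightarrow> y < N \<Longrightarrow> le i (order_at s L x) (order_at s L y)"
proof -
  show img: "order_at s L ` {..<N} = {..<N}" using assms by (simp add: sorted_level_def)
  then show "inj_on (order_at s L) {..<N}" by (simp add: eq_card_imp_inj_on)
  show "x < N \<Longrightarrow> order_at s L x < N" using img by blast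
  show "x < y \<Longrightarrow> y < N \<Longrightarrow> le i (order_at s L x) (order_at s L y)"
    using assms by (simp add: sorted_level_def preordered.sorted_blocks_def[OF preordered_le] N_def)
qed

definition attained :: "nat \<Rightarrow> nat \<Rightarrow> bool" where
  "attained i j \<longleftrightarrow> (C $$ (i, j) \<noteq> None \<longrightarrow> (\<exists>k<m. B $$ (k, j) \<and> A $$ (i, k) = the (C $$ (i, j))))"

lemma distinct_A: "i < n \<Longrightarrow> k < m \<Longrightarrow> k' < m \<Longrightarrow> A $$ (i, k) = A $$ (i, k') \<Longrightarrow> k = k'"
  using inst unfolding distinct_msb_instance_def distinct_in_rows_def by (metis carrier_matD)

text \<open>Here distinctness enters. A witness \<open>k\<close> cannot come after column
  \<open>j\<close>, as ties put rows first. The last row \<open>c\<close> before the column then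
  satisfies \<open>A[i,k] \<le> A[i,c] \<le> C[i,j] = A[i,k]\<close>, so \<open>k\<close> and
  \<open>c\<close> have equal entries and coincide.\<close>

lemma attained_iff_last:
  assumes srt: "sorted_level i L s" and i: "i < n" and q: "q < N"
    and e: "order_at s L q = m + j" "j < m" "C $$ (i, j) \<noteq> None"
    and c: "c < m \<Longrightarrow> \<exists>p<q. order_at s L p = c"
      "\<And>p. p < q \<Longrightarrow> order_at s L p < m \<Longrightarrow> c < m \<and> le i (order_at s L p) c"
  shows "attained i j \<longleftrightarrow> c < m \<and> \<not> A $$ (i, c) < the (C $$ (i, j)) \<and> B $$ (c, j)"
proof -
  have le_c: "A $$ (i, c) \<le> the (C $$ (i, j))" if cm: "c < m"
  proof -
    obtain p where "p < q" "order_at s L p = c" using c(1)[OF cm] by blast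
    then have "le i c (m + j)" using sorted_levelD(4)[OF srt, of p q] q e by simp
    then show ?thesis using cm e by (simp add: le_def none_def val_def)
  qed
  show ?thesis
  proof
    assume "attained i j"
    then obtain k where k: "k < m" "B $$ (k, j)" "A $$ (i, k) = the (C $$ (i, j))"
      using e by (auto simp: attained_def)
    have "k \<in> order_at s L ` {..<N}" using k(1) wires sorted_levelD(1)[OF srt] by (simp add: N_def)
    then obtain p where p: "p < N" "order_at s L p = k" by auto
    have "\<not> q < p"
    proof
      assume "q < p"
      then have "le i (m + j) k" using sorted_levelD(4)[OF srt, of q p] p e by simp
      then show False using k e by (simp add: le_def none_def val_def)
    qed
    moreover have "p \<noteq> q" using p e k by auto
    ultimately have "p < q" by simp
    then have "c < m" "le i k c" using c(2)[of p] p k by auto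
    then have "A $$ (i, k) \<le> A $$ (i, c)" using k by (simp add: le_def none_def val_def)
    then have "A $$ (i, k) = A $$ (i, c)" using le_c[OF \<open>c < m\<close>] k by simp
    then have "k = c" using distinct_A i k \<open>c < m\<close> by blast
    then show "c < m \<and> \<not> A $$ (i, c) < the (C $$ (i, j)) \<and> B $$ (c, j)" using k by simp
  next
    assume "c < m \<and> \<not> A $$ (i, c) < the (C $$ (i, j)) \<and> B $$ (c, j)"
    then show "attained i j" using le_c unfolding attained_def by (metis antisym_conv2)
  qed
qed

lemma runs_attained:
  assumes s: "base s" "regs s ''i'' = i" "i < n" and srt: "sorted_level i L s"
  shows "runs M E attained_prog s (N * 6 + 3)
    (\<lambda>s'. regs s' ''g'' = (if \<forall>j<m. attained i j then regs s ''g'' else 0))"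
  unfolding attained_prog_def
proof (rule runs_Seq_le[where R = "\<lambda>s'. s' = set_reg ''c'' N s" and T = 1 and T' = "N * (4 + 2) + 2"], goal_cases)
  case 1
  show ?case using s M_bounds(1) by (intro runs_loop_free) (simp_all add: baseD)
next
  case (2 s1)
  let ?ord = "order_at s L"
  have b1: "base s1" "regs s1 ''i'' = i" using base_preserved[OF 2(1) s(1,2)] by simp_all
  let ?ok = "\<lambda>p. m \<le> ?ord p \<longrightarrow> ?ord p < 2 * m \<longrightarrow> attained i (?ord p - m)"
  \<comment> \<open>The last two clauses say that \<open>c\<close> is the greatest row met so far,
    or that none has been met.\<close>
  let ?Inv = "\<lambda>q s'. regs s' ''g'' = (if \<forall>p<q. ?ok p then regs s ''g'' else 0) \<and> regs s' ''c'' \<le> N \<and>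
     (regs s' ''c'' < m \<longrightarrow> (\<exists>p<q. ?ord p = regs s' ''c'')) \<and>
     (\<forall>p<q. ?ord p < m \<longrightarrow> regs s' ''c'' < m \<and> le i (?ord p) (regs s' ''c''))"
  have mN: "m < N" using wires m by (simp add: N_def)
  let ?body = "(''e'' ::= Sorted (Reg ''q'') ;;
        Cond (Less (Reg ''e'') (Reg ''n2''))
          (''c'' ::= Reg ''e'')
          (Cond Not_Attained
             (''g'' ::= Lit 0) Skip))"
  have "runs M E (For ''q'' (Reg ''N'') ?body) s1 (N * (4 + 2) + 2) (?Inv N)"
  proof (rule runs_For_reg[where Inv = ?Inv], goal_cases)
    case 1 show ?case using b1 by (simp add: baseD)
  next
    case 2 show ?case using M_bounds by simp
  next
    case 4 show ?case using 2(2) mN by simp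
  next
    case (5 s2 q)
    have b2: "base s2" "regs s2 ''i'' = i" using base_preserved[OF 5(1) b1] by simp_all
    have "cells s2 ''o'' = cells s ''o''" using 5(1) 2(2) by (simp add: agree_off_def)
    then have o: "cells s2 ''o'' (L * N + q) = ?ord q" by (simp add: order_at_def)
    define e c where "e = ?ord q" and "c = regs s2 ''c''"
    have eN: "e < N" using sorted_levelD(3)[OF srt 5(3)] by (simp add: e_def)
    have c_ex: "\<exists>p<q. ?ord p = c" if "c < m" using 5(4) that by (auto simp: c_def)
    have c_last: "c < m \<and> le i (?ord p) c" if "p < q" "?ord p < m" for p using 5(4) that by (auto simp: c_def)
    have cN: "c \<le> N" using 5(4) by (simp add: c_def)
    have g: "regs s2 ''g'' = (if \<forall>p<q. ?ok p then regs s ''g'' else 0)" using 5(4) by simp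
    define s3 where "s3 = set_reg ''e'' e s2"
    note regs2 = 5(2) b2(2) baseD(1-6)[OF b2(1)]
    have all_Suc: "(\<forall>p<Suc q. P p) \<longleftrightarrow> (\<forall>p<q. P p) \<and> P q" for P by (auto simp: less_Suc_eq)
    show ?case
    proof (rule runs_Seq_le[where R = "\<lambda>s'. s' = s3" and T = 1 and T' = 3], goal_cases)
      case 1
      show ?case using eN M_bounds(1) by (intro runs_loop_free) (simp_all add: regs2 o e_def s3_def)
    next
      case (2 s')
      have b3: "base s3" "regs s3 ''i'' = i" "regs s3 ''e'' = e" "regs s3 ''c'' = c" "regs s3 ''g'' = regs s2 ''g''"
        using b2 by (simp_all add: s3_def base_def c_def)
      have post: "?Inv (Suc q) s'"
        if "regs s' ''c'' = c" "regs s' ''g'' = (if ?ok q then regs s2 ''g'' else 0)" "\<not> e < m" for s' :: state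
      proof (intro conjI)
        show "regs s' ''g'' = (if \<forall>p<Suc q. ?ok p then regs s ''g'' else 0)"
          unfolding all_Suc that(2) g by auto
        show "regs s' ''c'' \<le> N" using that(1) cN by simp
        show "regs s' ''c'' < m \<longrightarrow> (\<exists>p<Suc q. ?ord p = regs s' ''c'')"
          using c_ex less_SucI unfolding that(1) by metis
        show "\<forall>p<Suc q. ?ord p < m \<longrightarrow> regs s' ''c'' < m \<and> le i (?ord p) (regs s' ''c'')"
          unfolding all_Suc that(1) using c_last that(3) by (simp add: e_def)
      qed
            have isK: "bval E s3 (Less (Reg ''e'') (Reg ''n2'')) \<longleftrightarrow> e < m"
        by (simp add: b3 baseD(2)[OF b3(1)])
      \<comment> \<open>The wire is a row, or it makes no claim that needs checking, or it is a
        column with a proper entry.\<close>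
      consider (K) "e < m" | (N) "m \<le> e" "\<not> (e < 2 * m \<and> C $$ (i, e - m) \<noteq> None)"
        | (J) j where "e = m + j" "j < m" "C $$ (i, j) \<noteq> None"
      proof (cases "e < m")
        case False
        then show ?thesis using that(2) that(3)[of "e - m"] by fastforce
      qed (rule that(1))
      then show ?case
      proof cases
        case K
        have "le i (?ord p) e" if "p < q" for p
          using sorted_levelD(4)[OF srt that 5(3)] by (simp add: e_def)
        moreover have "le i e e" by (rule preordered.refl[OF preordered_le])
        ultimately have "le i (?ord p) e" if "p < Suc q" for p
          using that by (cases "p = q") (simp_all add: e_def)
        moreover have "?ok q" using K by (simp add: e_def)
        ultimately have "?Inv (Suc q) (set_reg ''q'' (Suc q) (set_reg ''c'' e s3))"
          using g eN K by (auto simp: all_Suc b3 e_def)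
        then show ?thesis unfolding 2(2)
          using eN M_bounds(1) by (intro runs_loop_free) (simp_all only: in_bounds.simps result.simps isK K if_True, simp_all add: b3)
      next
        case N
        then have okq: "?ok q" by (auto simp: e_def attained_def)
        have notK: "\<not> e < m" using N by simp
        have "\<not> (e < 2 * m \<and> 0 < cells s3 ''C'' (i * m + (e - m)))"
          using N cells_C[OF b3(1) s(3), of "e - m"] by auto
        then have test: "\<not> bval E s3 Not_Attained" by (simp add: b3 baseD(2)[OF b3(1)])
        have "?Inv (Suc q) (set_reg ''q'' (Suc q) s3)"
          by (rule post) (use okq notK in \<open>simp_all add: b3\<close>)
        then show ?thesis unfolding 2(2)
          using M_bounds(1)
          by (intro runs_loop_free) (simp_all only: in_bounds.simps result.simps isK notK if_False if_not_P[OF test], simp_all)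
      next
        case J
        have notK: "\<not> e < m" using J by simp
        have ac: "attained i j \<longleftrightarrow> c < m \<and> \<not> A $$ (i, c) < the (C $$ (i, j)) \<and> B $$ (c, j)"
          using attained_iff_last[OF srt s(3) 5(3) _ J(2,3), of c] c_ex c_last J by (simp add: e_def)
        have test: "bval E s3 Not_Attained \<longleftrightarrow> \<not> attained i j"
          unfolding ac using J
          by (auto simp: b3 baseD(2)[OF b3(1)] cells_C[OF b3(1) s(3)] cells_B[OF b3(1)] entries_A entries_C s(3))
        have okq: "?ok q \<longleftrightarrow> attained i j" using J by (simp add: e_def[symmetric])
        show ?thesis unfolding 2(2)
        proof (rule runs_loop_free, goal_cases)
          case 2 show ?case
            using M_bounds(1) by (simp only: in_bounds.simps result.simps isK notK if_False test) simp
        next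
          case 4 show ?case
            by (rule post; simp only: result.simps isK notK if_False test regs_set_reg okq; simp add: b3 notK)
        qed simp_all
      qed
    qed simp
  qed simp_all
  then show ?case
  proof (rule runs_weaken)
    fix s' :: state assume I: "?Inv N s'"
    have "(\<forall>p<N. ?ok p) \<longleftrightarrow> (\<forall>j<m. attained i j)"
    proof (intro iffI allI impI)
      fix j assume h: "\<forall>p<N. ?ok p" and j: "j < m"
      then have "m + j \<in> ?ord ` {..<N}" using wires sorted_levelD(1)[OF srt] by (simp add: N_def)
      then obtain p where p: "p < N" "?ord p = m + j" by (metis imageE lessThan_iff)
      then show "attained i j" using h j by (metis add_diff_cancel_left' add_less_cancel_left le_add1 mult_2)
    qed auto
    then show "regs s' ''g'' = (if \<forall>j<m. attained i j then regs s ''g'' else 0)" using I by simp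
  qed simp
qed simp

section \<open>Levels of the routed permutation and switch settings\<close>

definition T_at :: "state \<Rightarrow> nat \<Rightarrow> nat \<Rightarrow> nat" where
  "T_at s t x = cells s ''T'' (t * N + x)"

definition I_at :: "state \<Rightarrow> nat \<Rightarrow> nat \<Rightarrow> nat" where
  "I_at s t x = cells s ''I'' (t * N + x)"

definition D_at :: "state \<Rightarrow> nat \<Rightarrow> nat \<Rightarrow> nat" where
  "D_at s t x = cells s ''D'' (t * N + x)"

text \<open>Level \<open>t\<close> stores what the stages from \<open>t\<close> to
  \<open>2 * L - 1 - t\<close> have to do, together with the inverse. The \<open>t\<close> low
  digits are respected, since the stages outside have dealt with them; at level \<open>L\<close>
  this leaves only the identity.\<close>

definition perm_level :: "nat \<Rightarrow> state \<Rightarrow> bool" where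
  "perm_level t s \<longleftrightarrow> (\<forall>x<N. T_at s t x < N \<and> I_at s t x < N \<and> I_at s t (T_at s t x) = x \<and>
     T_at s t (I_at s t x) = x \<and> T_at s t x mod 2 ^ t = x mod 2 ^ t)"

lemma runs_permutation:
  assumes s: "base s" "regs s ''i'' = i" "i < n" and srt: "sorted_level i L s"
  shows "runs M E permutation_prog s (N * 6 + 2)
    (\<lambda>s'. perm_level 0 s' \<and> (\<forall>q<N. T_at s' 0 (order_at s L (Suc q mod N)) = order_at s L q))"
proof -
  let ?ord = "order_at s L"
  define nx where "nx q = ?ord (Suc q mod N)" for q
  let ?Inv = "\<lambda>q s'. \<forall>p<q. cells s' ''T'' (nx p) = ?ord p \<and> cells s' ''I'' (?ord p) = nx p"
  have SucN: "Suc p mod N = Suc q mod N \<longleftrightarrow> p = q" if "p < N" "q < N" for p q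
    using that by (auto simp: mod_Suc split: if_splits)
  have nx_lt: "nx q < N" for q unfolding nx_def using N_pos by (intro sorted_levelD(3)[OF srt]) simp
  have ord_eq: "?ord p = ?ord q \<longleftrightarrow> p = q" if "p < N" "q < N" for p q
    using inj_on_eq_iff[OF sorted_levelD(2)[OF srt]] that by simp
  have nx_eq: "nx p = nx q \<longleftrightarrow> p = q" if "p < N" "q < N" for p q
    using that N_pos by (simp add: nx_def ord_eq SucN)
  have "runs M E permutation_prog s (N * (4 + 2) + 2) (?Inv N)"
    unfolding permutation_prog_def
  proof (rule runs_For_reg[where Inv = ?Inv], goal_cases)
    case 1 show ?case using s by (simp add: baseD)
  next
    case 2 show ?case using M_bounds by simp
  next
    case (5 s2 q)
    have b2: "base s2" "regs s2 ''i'' = i" using base_preserved[OF 5(1) s(1,2)] by simp_all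
    have o: "cells s2 ''o'' (L * N + x) = ?ord x" for x
      using 5(1) by (simp add: agree_off_def order_at_def)
    have lt: "nx q < M" "?ord q < M" using nx_lt[of q] sorted_levelD(3)[OF srt 5(3)] M_bounds(1) by simp_all
    show ?case
      using lt nx_eq ord_eq 5
      by (intro runs_loop_free) (auto simp: baseD[OF b2(1)] o nx_def[symmetric] less_Suc_eq)
  qed simp_all
  then show ?thesis
  proof (rule runs_weaken)
    fix s' :: state assume I: "?Inv N s'"
    have T: "T_at s' 0 (nx p) = ?ord p" "I_at s' 0 (?ord p) = nx p" if "p < N" for p
      using I that by (simp_all add: T_at_def I_at_def)
    have ex1: "\<exists>p<N. ?ord p = x" if "x < N" for x
    proof -
      have "x \<in> ?ord ` {..<N}" using that sorted_levelD(1)[OF srt] by simp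
      then show ?thesis by auto
    qed
    have ex2: "\<exists>p<N. nx p = x" if x: "x < N" for x
    proof -
      obtain p where p: "p < N" "?ord p = x" using ex1[OF x] by blast
      define p' where "p' = (if p = 0 then N - 1 else p - 1)"
      have "p' < N" "Suc p' mod N = p" using p N_pos by (auto simp: p'_def)
      then show ?thesis using p by (auto simp: nx_def)
    qed
    have "T_at s' 0 x < N \<and> I_at s' 0 x < N \<and> I_at s' 0 (T_at s' 0 x) = x \<and> T_at s' 0 (I_at s' 0 x) = x" if x: "x < N" for x
    proof -
      obtain p p' where p: "p < N" "?ord p = x" "p' < N" "nx p' = x" using ex1[OF x] ex2[OF x] by blast
      then show ?thesis using T[of p] T[of p'] nx_lt[of p] sorted_levelD(3)[OF srt, of p'] by simp
    qed
    then show "perm_level 0 s' \<and> (\<forall>q<N. T_at s' 0 (?ord (Suc q mod N)) = ?ord q)"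
      using T by (simp add: perm_level_def nx_def)
  qed simp
qed

end

lemma written_row_phases [simp]:
  "written_regs attained_prog = {''c'', ''q'', ''e'', ''g''}" "written_arrays attained_prog = {}"
  "written_regs permutation_prog = {''q'', ''e'', ''f''}" "written_arrays permutation_prog = {''T'', ''I''}"
  "written_regs colour_prog = {''q'', ''x'', ''y'', ''z''}" "written_arrays colour_prog = {''k''}"
  "written_regs switch_prog = {''q'', ''h'', ''f'', ''r''}" "written_arrays switch_prog = {''D'', ''T'', ''I''}"
  "written_regs targets_prog = {''q''}" "written_arrays targets_prog = {''F0'', ''F1''}"
  by (auto simp: attained_prog_def permutation_prog_def colour_prog_def switch_prog_def targets_prog_def Let_def)

lemma aval_Cell_Addr: "aval s (Cell x (Addr a e)) = cells s x (aval s a * regs s ''N'' + aval s e)"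
  by simp

context msb_run
begin

lemma level_set_reg [simp]: "T_at (set_reg x k s) = T_at s" "I_at (set_reg x k s) = I_at s" "D_at (set_reg x k s) = D_at s"
  by (simp_all add: T_at_def I_at_def D_at_def fun_eq_iff)

lemma level_set_cell:
  assumes "x < N" "y < N"
  shows "T_at (set_cell z (u * N + y) v s) t x = (if z = ''T'' \<and> t = u \<and> x = y then v else T_at s t x)"
    "I_at (set_cell z (u * N + y) v s) t x = (if z = ''I'' \<and> t = u \<and> x = y then v else I_at s t x)"
    "D_at (set_cell z (u * N + y) v s) t x = (if z = ''D'' \<and> t = u \<and> x = y then v else D_at s t x)"
  using assms by (auto simp: T_at_def I_at_def D_at_def addr_eq_iff)

lemma two_pow_dvd: "t < L \<Longrightarrow> 2 * 2 ^ t dvd N"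
  using weight_dvd[of t] weight_less_L[of t] by simp

text \<open>The first map pairs wires that share a switch of stage \<open>t\<close>, the second one
  wires whose destinations share a switch of the mirrored stage. A common 2-colouring gives the
  members of each pair different digits, so that neither stage merges two routes.\<close>

lemma perm_involutions:
  assumes p: "perm_level t s" and t: "t < L"
  shows "two_involutions N (flip_digit (2 ^ t)) (\<lambda>x. I_at s t (flip_digit (2 ^ t) (T_at s t x)))"
proof -
  have P: "T_at s t x < N" "I_at s t x < N" "I_at s t (T_at s t x) = x" "T_at s t (I_at s t x) = x" if "x < N" for x
    using p that by (simp_all add: perm_level_def)
  have fl: "flip_digit (2 ^ t) x < N" if "x < N" for x
    using that two_pow_dvd[OF t] by (intro flip_digit_less) simp_all
  show ?thesis
  proof
    fix x assume x: "x < N"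
    let ?y = "flip_digit (2 ^ t) (T_at s t x)"
    show "flip_digit (2 ^ t) x < N" using fl x .
    show "flip_digit (2 ^ t) (flip_digit (2 ^ t) x) = x" "flip_digit (2 ^ t) x \<noteq> x"
      by (simp_all add: flip_digit_flip flip_digit_neq)
    have y: "?y < N" using fl P(1) x by simp
    show "I_at s t ?y < N" using P(2) y .
    show "I_at s t (flip_digit (2 ^ t) (T_at s t (I_at s t ?y))) = x"
      using P(4)[OF y] P(3)[OF x] by (simp add: flip_digit_flip)
    show "I_at s t ?y \<noteq> x"
    proof
      assume "I_at s t ?y = x"
      then have "?y = T_at s t x" using P(4)[OF y] by simp
      then show False using flip_digit_neq[of "2 ^ t" "T_at s t x"] by simp
    qed
  qed
qed

definition coloured :: "nat \<Rightarrow> state \<Rightarrow> (nat \<Rightarrow> nat) \<Rightarrow> bool" where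
  "coloured t s k \<longleftrightarrow> (\<forall>x<N. k x < 2 \<and> k (flip_digit (2 ^ t) x) = 1 - k x \<and>
     k (I_at s t (flip_digit (2 ^ t) (T_at s t x))) = 1 - k x)"

text \<open>Each round advances \<open>x\<close> or colours two points, so the number of uncoloured
  points plus the distance from \<open>x\<close> to \<open>N\<close> decreases; it is at most
  \<open>2 * N\<close>.\<close>

lemma runs_colour:
  assumes s: "base s" "regs s ''i'' = i" "regs s ''t'' = t" and t: "t < L" and p: "perm_level t s"
  shows "runs M E colour_prog s (N * 15 + 5) (\<lambda>s'. coloured t s (cells s' ''k''))"
proof -
  define w :: nat where "w = 2 ^ t"
  define g where "g x = I_at s t (flip_digit w (T_at s t x))" for x
  interpret two_involutions N "flip_digit w" g
    unfolding g_def w_def using perm_involutions[OF p t] .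
  \<comment> \<open>The disjunction lets \<open>x\<close> advance safely: when \<open>y\<close>
    turns out to be coloured, either \<open>y\<close> is \<open>x\<close> or \<open>x\<close> was
    coloured before.\<close>
  let ?Inv = "\<lambda>s'. partial_colouring (cells s' ''k'') (regs s' ''y'') \<and> regs s' ''x'' \<le> N \<and>
    (regs s' ''x'' < N \<longrightarrow> regs s' ''y'' < N \<and> (regs s' ''y'' = regs s' ''x'' \<or> cells s' ''k'' (regs s' ''x'') \<noteq> 2)) \<and>
    (\<forall>x<regs s' ''x''. cells s' ''k'' x \<noteq> 2)"
  let ?\<Phi> = "\<lambda>s'. card (uncoloured (cells s' ''k'')) + (N - regs s' ''x'')"
  have init: "runs M E (For ''q'' (Reg ''N'') (Store ''k'' (Reg ''q'') (Lit 2))) s (N * (1 + 2) + 2)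
     (\<lambda>s'. \<forall>x<N. cells s' ''k'' x = 2)"
  proof (rule runs_For_reg[where Inv = "\<lambda>q s'. \<forall>x<q. cells s' ''k'' x = 2"], goal_cases)
    case 1 show ?case using s(1) by (simp add: baseD)
  next
    case 2 show ?case using M_bounds by simp
  next
    case (5 s1 q)
    show ?case using 5 M_bounds(1,9) by (intro runs_loop_free) (auto simp: less_Suc_eq)
  qed simp_all
  show ?thesis unfolding colour_prog_def
  proof (rule runs_Seq_le[OF init, where T' = "12 * N + 3"], goal_cases)
    case (1 s1)
    have b1: "base s1" "regs s1 ''i'' = i" using base_preserved[OF 1(1) s(1,2)] by simp_all
    define s2 where "s2 = set_reg ''y'' 0 (set_reg ''x'' 0 s1)"
    have b2: "base s2" "regs s2 ''i'' = i" "regs s2 ''t'' = t"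
      using 1(1) b1 s(3) by (simp_all add: agree_off_def s2_def base_def)
    have TI: "cells s2 ''T'' = cells s ''T''" "cells s2 ''I'' = cells s ''I''"
      using 1(1) by (simp_all add: agree_off_def s2_def)
    have U: "card (uncoloured k) \<le> N" for k
      using card_mono[of "{..<N}" "uncoloured k"] by (auto simp: uncoloured_def)
    have I2: "?Inv s2" using 1(2) N_pos by (auto simp: s2_def intro!: partial_colouring_init)
    have loop: "runs M E (While (Less (Reg ''x'') (Reg ''N'')) Colour_Step) s2 (?\<Phi> s2 * (5 + 1) + 1)
       (\<lambda>s'. ?Inv s' \<and> \<not> bval E s' (Less (Reg ''x'') (Reg ''N'')))"
    proof (rule runs_While[where \<Phi> = ?\<Phi> and Inv = ?Inv, OF I2], goal_cases)
      case (1 s3)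
      have b3: "base s3" "regs s3 ''i'' = i" using base_preserved[OF 1(1) b2(1,2)] by simp_all
      have t3: "regs s3 ''t'' = t" using 1(1) b2(3) by (simp add: agree_off_def)
      have w3: "cells s3 ''p'' t = w" using baseD(7)[OF b3(1), of t] t by (simp add: weight_less_L w_def)
      have TI3: "cells s3 ''T'' = cells s ''T''" "cells s3 ''I'' = cells s ''I''"
        using 1(1) TI by (simp_all add: agree_off_def)
      define x y k where "x = regs s3 ''x''" and "y = regs s3 ''y''" and "k = cells s3 ''k''"
      have x: "x < N" using 1(3) by (simp add: x_def baseD(3)[OF b3(1)])
      then have I: "partial_colouring k y" "y < N" "y = x \<or> k x \<noteq> 2" "\<forall>x'<x. k x' \<noteq> 2"
        using 1(2) by (simp_all add: x_def y_def k_def)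
      show ?case
      proof (cases "k y < 2")
        case True
        have test: "bval E s3 (Less (Cell ''k'' (Reg ''y'')) (Lit 2))" using True by (simp add: k_def y_def)
        have "partial_colouring k (Suc x)" using partial_colouring_skip[OF I(1) True] .
        moreover have "\<forall>x'<Suc x. k x' \<noteq> 2" using I(3,4) True by (auto simp: less_Suc_eq)
        ultimately show ?thesis
          using x M_bounds(1)
          by (intro runs_loop_free)
            (simp_all only: in_bounds.simps result.simps if_P[OF test],
              auto simp: x_def[symmetric] k_def[symmetric])
      next
        case False
        have test: "\<not> bval E s3 (Less (Cell ''k'' (Reg ''y'')) (Lit 2))" using False by (simp add: k_def y_def)
        have "k y \<le> 2" using I(1,2) by (simp add: partial_colouring_def)
        with False have ky: "k y = 2" by simp
        define z where "z = flip_digit w y"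
        have z: "z < N" using I(2) f(1) by (simp add: z_def)
        define k' where "k' = k(y := 0, z := 1)"
        note st = partial_colouring_step[OF I(1,2) ky, folded z_def, folded k'_def]
        have gz: "g z < N" using g(1)[OF z] .
        define s4 where "s4 = set_reg ''y'' (g z) (set_cell ''k'' z 1 (set_cell ''k'' y 0 (set_reg ''z'' z s3)))"
        have gz_eq: "cells s ''I'' (t * N + flip_digit w (cells s ''T'' (t * N + z))) = g z"
          by (simp add: g_def I_at_def T_at_def)
        have res: "result E Colour_Step s3 = s4"
          by (simp only: result.simps if_not_P[OF test] aval_Flip aval_Cell_Addr)
            (simp add: s4_def t3 w3 TI3 z_def[symmetric] y_def[symmetric] baseD(3)[OF b3(1)] gz_eq)
        have k4: "cells s4 ''k'' = k'" by (simp add: s4_def fun_eq_iff k'_def k_def)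
        have bd: "in_bounds M E Colour_Step s3"
          using z I(2) gz M_bounds(1,9)
          by (simp only: in_bounds.simps result.simps if_not_P[OF test] aval_Flip aval_Cell_Addr)
            (simp add: t3 w3 TI3 z_def[symmetric] y_def[symmetric] baseD(3)[OF b3(1)] gz_eq)
        have k'2: "k' u \<noteq> 2" if "k u \<noteq> 2" for u using that by (simp add: k'_def)
        have r4: "regs s4 ''y'' = g z" "regs s4 ''x'' = x" by (simp_all add: s4_def x_def)
        have "g z = x \<or> k' x \<noteq> 2" using I(3) k'2 by (cases "y = x") (simp_all add: k'_def)
        then have "?Inv s4" using st(1) x gz I(4) k'2 by (simp add: k4 r4)
        moreover have "finite (uncoloured k)" by (simp add: uncoloured_def)
        then have "?\<Phi> s4 < ?\<Phi> s3" using psubset_card_mono[OF _ st(2)] by (simp add: k4 r4 x_def k_def)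
        ultimately show ?thesis
          using bd by (intro runs_loop_free) (simp_all only: res, simp_all)
      qed
    qed
    have "?\<Phi> s2 \<le> 2 * N" using U[of "cells s2 ''k''"] by simp
    then have tm: "?\<Phi> s2 * (5 + 1) + 1 \<le> 12 * N + 1" by simp
    have fin: "runs M E (While (Less (Reg ''x'') (Reg ''N'')) Colour_Step) s2 (12 * N + 1)
        (\<lambda>s'. coloured t s (cells s' ''k''))"
    proof (rule runs_weaken[OF loop tm])
      fix s' :: state
      assume ag: "agree_off (written_regs (While (Less (Reg ''x'') (Reg ''N'')) Colour_Step))
          (written_arrays (While (Less (Reg ''x'') (Reg ''N'')) Colour_Step)) s2 s'"
        and I: "?Inv s' \<and> \<not> bval E s' (Less (Reg ''x'') (Reg ''N''))"
      have "regs s' ''N'' = N" using ag baseD(3)[OF b2(1)] by (simp add: agree_off_def)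
      then have all: "cells s' ''k'' x \<noteq> 2" if "x < N" for x using I that by auto
      show "coloured t s (cells s' ''k'')"
        using complete_colouring[of "cells s' ''k''" "regs s' ''y''"] I all
        unfolding coloured_def g_def w_def by blast
    qed
    show ?case
    proof (rule runs_Seq_le[where R = "\<lambda>s'. s' = set_reg ''x'' 0 s1" and T = 1 and T' = "12 * N + 2"], goal_cases)
      case 1 show ?case using M_bounds(9) by (intro runs_loop_free) simp_all
    next
      case (2 s')
      show ?case unfolding 2(2)
      proof (rule runs_Seq_le[where R = "\<lambda>s'. s' = s2" and T = 1 and T' = "12 * N + 1"], goal_cases)
        case 1 show ?case using M_bounds(9) by (intro runs_loop_free) (simp_all add: s2_def)
      next
        case (2 s') show ?case unfolding 2(2) using fin .
      qed simp
    qed simp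
  qed simp
qed

definition stage_correct :: "state \<Rightarrow> nat \<Rightarrow> bool" where
  "stage_correct s t \<longleftrightarrow> (\<forall>x<N. let y = T_at s (Suc t) (set_digit (2 ^ t) (D_at s t x mod 2) x) in
     y < N \<and> set_digit (2 ^ t) (D_at s (2 * L - 1 - t) y mod 2) y = T_at s t x)"

text \<open>What stage \<open>t\<close> leaves alone: all settings except those of its two stages,
  and the permutations up to its own level. This is what the stages further out need in order to
  stay correct.\<close>

definition same_levels :: "nat \<Rightarrow> state \<Rightarrow> state \<Rightarrow> bool" where
  "same_levels t s s' \<longleftrightarrow> (\<forall>x<N. (\<forall>v. v \<noteq> t \<longrightarrow> v \<noteq> 2 * L - 1 - t \<longrightarrow> D_at s' v x = D_at s v x) \<and>
     (\<forall>v\<le>t. T_at s' v x = T_at s v x))"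

text \<open>\<open>H x\<close> is the wire after the first switch and \<open>Q x\<close> the wire
  before the last one. Both maps are injective, because wires that a switch could merge have
  different colours. As \<open>H x\<close> and \<open>Q x\<close> carry the same digit
  \<open>k x\<close>, the permutation from \<open>H x\<close> to \<open>Q x\<close> respects one
  digit more.\<close>

lemma runs_switch:
  assumes s: "base s" "regs s ''i'' = i" "regs s ''t'' = t" and t: "t < L" and p: "perm_level t s"
    and col: "coloured t s (cells s ''k'')"
  shows "runs M E switch_prog s (N * 9 + 2)
    (\<lambda>s'. perm_level (Suc t) s' \<and> stage_correct s' t \<and> same_levels t s s')"
proof -
  define w :: nat where "w = 2 ^ t"
  define u where "u = 2 * L - 1 - t"
  define k where "k = cells s ''k''"
  define H Q where "H x = set_digit w (k x) x" and "Q x = set_digit w (k x) (T_at s t x)" for x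
  have w: "w > 0" "2 * w dvd N" using two_pow_dvd[OF t] by (simp_all add: w_def)
  have ut: "u \<noteq> t" "u < 2 * L" using t by (auto simp: u_def)
  have K: "k x < 2" "k (flip_digit w x) = 1 - k x" "k (I_at s t (flip_digit w (T_at s t x))) = 1 - k x" if "x < N" for x
    using col that by (simp_all add: coloured_def k_def w_def)
  have P: "T_at s t x < N" "I_at s t x < N" "I_at s t (T_at s t x) = x" "T_at s t (I_at s t x) = x"
    "T_at s t x mod w = x mod w" if "x < N" for x
    using p that by (simp_all add: perm_level_def w_def)
  have HQ_lt: "H x < N" "Q x < N" if "x < N" for x
    unfolding H_def Q_def using w K(1) P(1) that by (auto intro!: set_digit_less)
  have kne: "k x \<noteq> 1 - k x" for x by (cases "k x") auto
  have H_eq: "H x = H y \<longleftrightarrow> x = y" if xy: "x < N" "y < N" for x y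
  proof
    assume h: "H x = H y"
    have kk: "k x = k y" using h set_digit_bit[OF w(1) K(1)[OF xy(1)], of x] set_digit_bit[OF w(1) K(1)[OF xy(2)], of y]
      by (simp add: H_def)
    have "set_digit w (k x) x = set_digit w (k x) y" using h kk by (simp add: H_def)
    from set_digit_eq_imp[OF w(1) K(1)[OF xy(1)] this] show "x = y"
      using kk kne[of x] K(2)[OF xy(1)] by auto
  qed simp
  have Q_eq: "Q x = Q y \<longleftrightarrow> x = y" if xy: "x < N" "y < N" for x y
  proof
    assume h: "Q x = Q y"
    have kk: "k x = k y" using h set_digit_bit[OF w(1) K(1)[OF xy(1)], of "T_at s t x"]
        set_digit_bit[OF w(1) K(1)[OF xy(2)], of "T_at s t y"]
      by (simp add: Q_def)
    have "set_digit w (k x) (T_at s t x) = set_digit w (k x) (T_at s t y)" using h kk by (simp add: Q_def)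
    from set_digit_eq_imp[OF w(1) K(1)[OF xy(1)] this] show "x = y"
    proof
      assume "T_at s t y = T_at s t x" then show ?thesis using P(3) xy by metis
    next
      assume "T_at s t y = flip_digit w (T_at s t x)"
      then have "y = I_at s t (flip_digit w (T_at s t x))" using P(3)[OF xy(2)] by simp
      then show ?thesis using K(3)[OF xy(1)] kk kne[of x] by auto
    qed
  qed simp
  let ?Inv = "\<lambda>q s'. (\<forall>x<q. D_at s' t x = k x \<and> D_at s' u (Q x) = T_at s t x div w mod 2 \<and>
      T_at s' (Suc t) (H x) = Q x \<and> I_at s' (Suc t) (Q x) = H x) \<and> same_levels t s s'"
  have "runs M E switch_prog s (N * (7 + 2) + 2) (?Inv N)"
    unfolding switch_prog_def
  proof (rule runs_For_reg[where Inv = ?Inv], goal_cases)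
    case 1 show ?case using s(1) by (simp add: baseD)
  next
    case 2 show ?case using M_bounds by simp
  next
    case 4 show ?case by (simp add: same_levels_def)
  next
    case (5 s1 q)
    have b1: "base s1" "regs s1 ''i'' = i" using base_preserved[OF 5(1) s(1,2)] by simp_all
    have r1: "regs s1 ''t'' = t" "regs s1 ''q'' = q" "cells s1 ''p'' t = w" "regs s1 ''L'' = L" "regs s1 ''N'' = N"
      "cells s1 ''k'' = k"
      using 5(1) s(3) 5(2) baseD(7)[OF b1(1), of t] baseD(3,4)[OF b1(1)] t by (simp_all add: agree_off_def weight_less_L w_def k_def)
    have q: "q < N" by fact
    have sl: "same_levels t s s1" using 5(4) by simp
    have Tq: "cells s1 ''T'' (t * N + q) = T_at s t q"
      using sl q by (simp add: same_levels_def T_at_def)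
    define s2 where "s2 = set_reg ''r'' (Q q) (set_reg ''f'' (T_at s t q) (set_reg ''h'' (H q) s1))"
    define s3 where "s3 = set_cell ''I'' (Suc t * N + Q q) (H q) (set_cell ''T'' (Suc t * N + H q) (Q q)
      (set_cell ''D'' (u * N + Q q) (T_at s t q div w mod 2) (set_cell ''D'' (t * N + q) (k q) s2)))"
    have M': "x < M" if "x < N" for x using that M_bounds(1) by simp
    have lts: "H q < M" "Q q < M" "T_at s t q < M" "k q < M" "t * N + q < M" "u * N + Q q < M"
        "Suc t * N + H q < M" "Suc t * N + Q q < M" "T_at s t q div w mod 2 < M"
    proof -
      show "H q < M" "Q q < M" "T_at s t q < M" using HQ_lt[OF q] P(1)[OF q] M' by blast+
      show "k q < M" using K(1)[OF q] M_bounds(9) by linarith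
      show "t * N + q < M" "u * N + Q q < M" "Suc t * N + H q < M" "Suc t * N + Q q < M"
        using t ut q HQ_lt[OF q] by (simp_all add: addr_M del: mult_Suc)
      have "T_at s t q div w mod 2 < 2" by simp
      then show "T_at s t q div w mod 2 < M" using M_bounds(9) by linarith
    qed
    have r2: "regs s2 ''t'' = t" "regs s2 ''q'' = q" "cells s2 ''p'' t = w" "regs s2 ''L'' = L" "regs s2 ''N'' = N"
      "cells s2 ''k'' = k" "regs s2 ''h'' = H q" "regs s2 ''f'' = T_at s t q" "regs s2 ''r'' = Q q"
      using r1 by (simp_all add: s2_def)
    define s1' where "s1' = set_reg ''f'' (T_at s t q) (set_reg ''h'' (H q) s1)"
    have r1': "regs s1' ''t'' = t" "regs s1' ''q'' = q" "cells s1' ''p'' t = w" "cells s1' ''k'' = k"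
      "regs s1' ''f'' = T_at s t q"
      using r1 by (simp_all add: s1'_def)
    have e1: "aval s1 (Set_Digit Weight (Cell ''k'' (Reg ''q'')) (Reg ''q'')) = H q"
      unfolding aval_Set_Digit by (simp add: r1 H_def)
    have e2: "aval s1' (Set_Digit Weight (Cell ''k'' (Reg ''q'')) (Reg ''f'')) = Q q"
      unfolding aval_Set_Digit by (simp add: r1' Q_def)
    note upd = level_set_cell[OF _ q] level_set_cell[OF _ HQ_lt(1)[OF q]] level_set_cell[OF _ HQ_lt(2)[OF q]]
    have "?Inv (Suc q) (set_reg ''q'' (Suc q) s3)"
    proof (intro conjI allI impI)
      fix x assume "x < Suc q"
      then have x: "x < N" "x = q \<or> x < q" using q by auto
      have old: "D_at s1 t x = k x \<and> D_at s1 u (Q x) = T_at s t x div w mod 2 \<and>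
         T_at s1 (Suc t) (H x) = Q x \<and> I_at s1 (Suc t) (Q x) = H x" if "x < q"
        using 5(4) that by simp
      note lt = HQ_lt[OF x(1)] x(1)
      show "D_at (set_reg ''q'' (Suc q) s3) t x = k x" using x old lt ut
        by (auto simp: s3_def s2_def upd simp del: mult_Suc)
      show "D_at (set_reg ''q'' (Suc q) s3) u (Q x) = T_at s t x div w mod 2" using x old lt ut Q_eq[OF x(1) q]
        by (auto simp: s3_def s2_def upd simp del: mult_Suc)
      show "T_at (set_reg ''q'' (Suc q) s3) (Suc t) (H x) = Q x" using x old lt H_eq[OF x(1) q]
        by (auto simp: s3_def s2_def upd simp del: mult_Suc)
      show "I_at (set_reg ''q'' (Suc q) s3) (Suc t) (Q x) = H x" using x old lt Q_eq[OF x(1) q]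
        by (auto simp: s3_def s2_def upd simp del: mult_Suc)
    next
      show "same_levels t s (set_reg ''q'' (Suc q) s3)"
        using sl by (auto simp: same_levels_def s3_def s2_def upd u_def simp del: mult_Suc)
    qed
    note inv = this
    have stores: "runs M E (Switch_Stores) s2 4
        (\<lambda>s'. ?Inv (Suc q) (set_reg ''q'' (Suc q) s'))"
    proof (rule runs_loop_free)
      show "loop_free Switch_Stores" "max_steps Switch_Stores \<le> 4" by simp_all
      have res: "result E Switch_Stores s2 = s3" by (simp add: s3_def r2 u_def)
      show "?Inv (Suc q) (set_reg ''q'' (Suc q) (result E Switch_Stores s2))" unfolding res by (rule inv)
      show "in_bounds M E Switch_Stores s2" using lts by (simp add: r2 u_def)
    qed
    show ?case
    proof (rule runs_Seq_le[where R = "\<lambda>s'. s' = set_reg ''h'' (H q) s1" and T = 1 and T' = 6], goal_cases)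
      case 1 show ?case using e1 lts by (intro runs_loop_free) (simp_all only: in_bounds.simps result.simps loop_free.simps max_steps.simps)
    next
      case (2 s')
      show ?case unfolding 2(2)
      proof (rule runs_Seq_le[where R = "\<lambda>s'. s' = s1'" and T = 1 and T' = 5], goal_cases)
        case 1 show ?case using lts by (intro runs_loop_free) (simp_all add: s1'_def r1 Tq)
      next
        case (2 s')
        show ?case unfolding 2(2)
        proof (rule runs_Seq_le[where R = "\<lambda>s'. s' = s2" and T = 1 and T' = 4], goal_cases)
          case 1 show ?case using e2 lts
            by (intro runs_loop_free) (simp_all only: in_bounds.simps result.simps loop_free.simps max_steps.simps s1'_def s2_def)
        next
          case (2 s') show ?case unfolding 2(2) using stores .
        qed simp
      qed simp
    qed simp
  qed simp_all
  then show ?thesis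
  proof (rule runs_weaken)
    fix s' :: state assume I: "?Inv N s'"
    have J: "D_at s' t x = k x" "D_at s' u (Q x) = T_at s t x div w mod 2"
      "T_at s' (Suc t) (H x) = Q x" "I_at s' (Suc t) (Q x) = H x" if "x < N" for x
      using I that by simp_all
    have sl: "same_levels t s s'" using I by simp
    have inj: "inj_on H {..<N}" "inj_on Q {..<N}" using H_eq Q_eq by (auto simp: inj_on_def)
    have surj: "H ` {..<N} = {..<N}" "Q ` {..<N} = {..<N}"
      by (rule endo_inj_surj; use inj HQ_lt in auto)+
    have perm: "perm_level (Suc t) s'"
      unfolding perm_level_def
    proof (intro allI impI)
      fix y assume y: "y < N"
      obtain x where x: "x < N" "y = H x" using surj(1) y by (metis imageE lessThan_iff)
      obtain x' where x': "x' < N" "y = Q x'" using surj(2) y by (metis imageE lessThan_iff)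
      have "Q x mod (2 * w) = H x mod (2 * w)"
        using set_digit_mod_double[OF w(1) K(1)[OF x(1)]] P(5)[OF x(1)] by (simp add: Q_def H_def)
      then show "T_at s' (Suc t) y < N \<and> I_at s' (Suc t) y < N \<and> I_at s' (Suc t) (T_at s' (Suc t) y) = y \<and>
        T_at s' (Suc t) (I_at s' (Suc t) y) = y \<and> T_at s' (Suc t) y mod 2 ^ Suc t = y mod 2 ^ Suc t"
        using J(3,4)[OF x(1)] J(3,4)[OF x'(1)] HQ_lt[OF x(1)] HQ_lt[OF x'(1)] x x' by (simp add: w_def)
    qed
    have "stage_correct s' t" unfolding stage_correct_def Let_def
    proof (intro allI impI)
      fix x assume x: "x < N"
      have h: "set_digit (2 ^ t) (D_at s' t x mod 2) x = H x"
        using J(1)[OF x] K(1)[OF x] by (simp add: H_def w_def)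
      \<comment> \<open>The last switch undoes the overwriting of the digit, whatever the colour
        was.\<close>
      have "set_digit w (T_at s t x div w mod 2) (Q x) = T_at s t x"
        unfolding Q_def set_digit_set_digit[OF w(1) K(1)[OF x]] by (rule set_digit_same)
      moreover have "T_at s' t x = T_at s t x" using sl x by (simp add: same_levels_def)
      ultimately show "T_at s' (Suc t) (set_digit (2 ^ t) (D_at s' t x mod 2) x) < N \<and>
        set_digit (2 ^ t) (D_at s' (2 * L - 1 - t) (T_at s' (Suc t) (set_digit (2 ^ t) (D_at s' t x mod 2) x)) mod 2)
          (T_at s' (Suc t) (set_digit (2 ^ t) (D_at s' t x mod 2) x)) = T_at s' t x"
        unfolding h J(3)[OF x] using J(2)[OF x] HQ_lt[OF x] by (simp add: u_def w_def)
    qed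
    then show "perm_level (Suc t) s' \<and> stage_correct s' t \<and> same_levels t s s'" using perm sl by simp
  qed simp
qed

end

lemma written_row_prog [simp]:
  "written_regs row_prog = {''t'', ''q'', ''a'', ''b'', ''c'', ''e'', ''g'', ''f'', ''x'', ''y'', ''z'', ''h'', ''r''}"
  "written_arrays row_prog = {''o'', ''T'', ''I'', ''k'', ''D'', ''F0'', ''F1''}"
  by (auto simp: row_prog_def)

context msb_run
begin

text \<open>Correctness of stage \<open>t'\<close> involves the settings of stages \<open>t'\<close>
  and \<open>2 * L - 1 - t'\<close> and the permutations up to level \<open>t' + 1\<close>, hence at
  most up to \<open>t\<close>; a later stage \<open>t\<close> writes none of them.\<close>

lemma stage_correct_mono:
  assumes "same_levels t s s'" "t' < t" "t < L" "stage_correct s t'"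
  shows "stage_correct s' t'"
proof -
  define u where "u = 2 * L - 1 - t'"
  have S: "D_at s' t' x = D_at s t' x" "D_at s' u x = D_at s u x"
    "T_at s' t' x = T_at s t' x" "T_at s' (Suc t') x = T_at s (Suc t') x" if "x < N" for x
    using assms(1-3) that by (auto simp: same_levels_def u_def)
  show ?thesis unfolding stage_correct_def Let_def
  proof (intro allI impI)
    fix x assume x: "x < N"
    let ?h = "set_digit (2 ^ t') (D_at s t' x mod 2) x"
    have h: "?h < N" using x two_pow_dvd[of t'] assms(2,3) by (intro set_digit_less) auto
    have "T_at s (Suc t') ?h < N \<and> set_digit (2 ^ t') (D_at s u (T_at s (Suc t') ?h) mod 2) (T_at s (Suc t') ?h) = T_at s t' x"
      using assms(4) x by (simp add: stage_correct_def Let_def u_def)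
    then show "T_at s' (Suc t') (set_digit (2 ^ t') (D_at s' t' x mod 2) x) < N \<and>
        set_digit (2 ^ t') (D_at s' (2 * L - 1 - t') (T_at s' (Suc t') (set_digit (2 ^ t') (D_at s' t' x mod 2) x)) mod 2)
          (T_at s' (Suc t') (set_digit (2 ^ t') (D_at s' t' x mod 2) x)) = T_at s' t' x"
      unfolding u_def[symmetric] using S[OF x] S[OF h] S(2) by simp
  qed
qed

definition network_done :: "(nat \<Rightarrow> nat) \<Rightarrow> nat \<Rightarrow> state \<Rightarrow> bool" where
  "network_done ord t s \<longleftrightarrow> perm_level t s \<and> (\<forall>q<N. T_at s 0 (ord (Suc q mod N)) = ord q) \<and> (\<forall>t'<t. stage_correct s t')"

lemma runs_network:
  assumes s: "base s" "regs s ''i'' = i" and p: "perm_level 0 s"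
    and start: "\<forall>q<N. T_at s 0 (ord (Suc q mod N)) = ord q" and ord: "\<And>q. q < N \<Longrightarrow> ord q < N"
  shows "runs M E (For ''t'' (Reg ''L'') (colour_prog ;; switch_prog)) s (L * (N * 24 + 9) + 2) (network_done ord L)"
proof -
  have "runs M E (For ''t'' (Reg ''L'') (colour_prog ;; switch_prog)) s (L * ((N * 24 + 7) + 2) + 2) (network_done ord L)"
  proof (rule runs_For_reg[where Inv = "network_done ord"], goal_cases)
    case 1 show ?case using s(1) by (simp add: baseD)
  next
    case 2 show ?case using M_bounds by simp
  next
    case 4 show ?case using p start by (simp add: network_done_def perm_level_def)
  next
    case (5 s1 t)
    have b1: "base s1" "regs s1 ''i'' = i" using base_preserved[OF 5(1) s(1,2)] by simp_all
    have P1: "perm_level t s1" "\<And>q. q < N \<Longrightarrow> T_at s1 0 (ord (Suc q mod N)) = ord q" "\<And>t'. t' < t \<Longrightarrow> stage_correct s1 t'"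
      using 5(4) by (simp_all add: network_done_def)
    show ?case
    proof (rule runs_Seq_le[OF runs_colour[OF b1 5(2,3) P1(1)], where T' = "N * 9 + 2"], goal_cases)
      case (1 s2)
      have b2: "base s2" "regs s2 ''i'' = i" using base_preserved[OF 1(1) b1] by simp_all
      have t2: "regs s2 ''t'' = t" using 1(1) 5(2) by (simp add: agree_off_def)
      have eq: "T_at s2 = T_at s1" "I_at s2 = I_at s1" "D_at s2 = D_at s1"
        using 1(1) by (simp_all add: agree_off_def T_at_def I_at_def D_at_def fun_eq_iff)
      have "perm_level t s2" "coloured t s2 (cells s2 ''k'')" using P1(1) 1(2) by (simp_all add: perm_level_def coloured_def eq)
      from runs_switch[OF b2 t2 5(3) this] show ?case
      proof (rule runs_weaken)
        fix s3 :: state assume h: "perm_level (Suc t) s3 \<and> stage_correct s3 t \<and> same_levels t s2 s3"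
        have "stage_correct s3 t'" if t': "t' < Suc t" for t'
        proof (cases "t' = t")
          case False
          then have "stage_correct s2 t'" using t' P1(3)[of t'] by (simp add: stage_correct_def eq)
          then show ?thesis using stage_correct_mono[of t s2 s3 t'] h False t' 5(3) by simp
        qed (use h in simp)
        moreover have "T_at s3 0 (ord (Suc q mod N)) = ord q" if "q < N" for q
        proof -
          have "ord (Suc q mod N) < N" using ord N_pos by simp
          then show ?thesis using h P1(2)[OF that] by (simp add: same_levels_def eq)
        qed
        ultimately show "network_done ord (Suc t) (set_reg ''t'' (Suc t) s3)"
          using h by (simp add: network_done_def perm_level_def stage_correct_def)
      qed simp
    qed simp
  qed simp_all
  then show ?thesis by (simp add: add.commute)
qed

text \<open>The legal arcs for arbitrary settings \<open>D\<close>, without the assumption that they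
  route anything; it agrees with the relation of \<open>routed_network\<close> once the row is
  routed.\<close>

definition legal_arcs_of :: "(nat \<Rightarrow> nat) \<Rightarrow> (nat \<times> nat) set" where
  "legal_arcs_of D = {(v, w) \<in> arcs. legal D w}"

definition dominated :: "nat \<Rightarrow> bool" where
  "dominated i \<longleftrightarrow> (\<forall>k<m. \<forall>j<m. B $$ (k, j) \<longrightarrow> le i k (m + j))"

lemma network_correct:
  assumes srt: "sorted_level i L s" and nd: "network_done (order_at s L) L s'"
  defines "D \<equiv> cells s' ''D''"
  shows "dominated i \<Longrightarrow> wf ((legal_arcs_of D)\<inverse>)" "\<not> dominated i \<Longrightarrow> \<exists>v. (v, v) \<in> (legal_arcs_of D)\<^sup>+"
proof -
  interpret r: routed_network L m "\<lambda>k j. B $$ (k, j)" D "order_at s L" "T_at s'" "le i"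
  proof
    show "order_at s L ` {..<N} = {..<N}" using sorted_levelD(1)[OF srt] .
    show "x < y \<Longrightarrow> y < N \<Longrightarrow> le i (order_at s L x) (order_at s L y)" for x y using sorted_levelD(4)[OF srt] .
    show "le i x y \<Longrightarrow> 2 * m \<le> y \<Longrightarrow> 2 * m \<le> x" for x y by (auto simp: le_def)
    show "\<not> (le i k (m + j) \<and> le i (m + j) k)" if "k < m" "j < m" for k j
      using that by (auto simp: le_def none_def val_def)
    show "T_at s' 0 (order_at s L (Suc q mod N)) = order_at s L q" if "q < N" for q
      using nd that by (simp add: network_done_def)
    \<comment> \<open>Level \<open>L\<close> respects all \<open>L\<close> binary digits, that is,
      the whole number below \<open>N\<close>.\<close>
    show "T_at s' L x = x" if x: "x < N" for x
    proof -
      have "T_at s' L x < N" "T_at s' L x mod 2 ^ L = x mod 2 ^ L"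
        using nd x unfolding network_done_def perm_level_def by blast+
      then show ?thesis using x unfolding N_def[symmetric] by simp
    qed
    show "set_digit (2 ^ t) (D ((2 * L - 1 - t) * N + T_at s' (Suc t) (set_digit (2 ^ t) (D (t * N + x) mod 2) x)) mod 2)
      (T_at s' (Suc t) (set_digit (2 ^ t) (D (t * N + x) mod 2) x)) = T_at s' t x" if "t < L" "x < N" for t x
      using nd that by (simp add: network_done_def stage_correct_def Let_def D_at_def D_def)
  qed
  have eq: "r.legal_arcs = legal_arcs_of D" by (simp add: r.legal_arcs_def legal_arcs_of_def)
  show "dominated i \<Longrightarrow> wf ((legal_arcs_of D)\<inverse>)"
    using r.acyclic_if_dominated unfolding dominated_def eq by blast
  show "\<not> dominated i \<Longrightarrow> \<exists>v. (v, v) \<in> (legal_arcs_of D)\<^sup>+"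
    using r.cycle_if_not_dominated unfolding dominated_def eq by blast
qed

section \<open>Targets and the outcome of one row\<close>

abbreviation V where "V \<equiv> 4 * L * N"

definition row_targets :: "nat \<Rightarrow> (nat \<Rightarrow> nat) \<Rightarrow> state \<Rightarrow> nat \<Rightarrow> bool" where
  "row_targets i D s v \<longleftrightarrow> cells s ''F0'' (i * V + v) = of_bool (\<not> legal D v) \<and> cells s ''F1'' (i * V + v) = of_bool (legal D v) \<and>
     cells s ''F0'' (n * V + (i * V + v)) = 1 \<and> cells s ''F1'' (n * V + (i * V + v)) = 0"

lemma config_addr:
  assumes "i < n" "v < V" "i' < n" "v' < V"
  shows "i * V + v < n * V" "i * V + v = i' * V + v' \<longleftrightarrow> i = i' \<and> v = v'"
proof -
  have "i * V + v < Suc i * V" using assms by simp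
  also have "\<dots> \<le> n * V" using assms by (intro mult_right_mono) auto
  finally show "i * V + v < n * V" .
  have "(i * K + v) div K = i" "(i * K + v) mod K = v" if "v < K" for i v K :: nat
    using that by simp_all
  then have "(i * V + v) div V = i" "(i * V + v) mod V = v" "(i' * V + v') div V = i'" "(i' * V + v') mod V = v'"
    using assms(2,4) by blast+
  then show "i * V + v = i' * V + v' \<longleftrightarrow> i = i' \<and> v = v'" by metis
qed

text \<open>The clause on other rows is quantified over all \<open>D\<close>, because the settings
  belonging to them are not in memory at this time.\<close>

lemma runs_targets:
  assumes s: "base s" "regs s ''i'' = i" "i < n"
  shows "runs M E targets_prog s (V * 6 + 2) (\<lambda>s'. (\<forall>v<V. row_targets i (cells s ''D'') s' v) \<and>
     (\<forall>i'<n. i' \<noteq> i \<longrightarrow> (\<forall>D. \<forall>v<V. row_targets i' D s v \<longrightarrow> row_targets i' D s' v)))"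
proof -
  let ?D = "cells s ''D''"
  let ?Inv = "\<lambda>q s'. (\<forall>v<q. row_targets i ?D s' v) \<and> (\<forall>i'<n. i' \<noteq> i \<longrightarrow> (\<forall>D. \<forall>v<V. row_targets i' D s v \<longrightarrow> row_targets i' D s' v))"
  have "runs M E targets_prog s (V * (4 + 2) + 2) (?Inv V)"
    unfolding targets_prog_def Let_def
  proof (rule runs_For_reg[where Inv = ?Inv], goal_cases)
    case 1 show ?case using s(1) by (simp add: baseD)
  next
    case 2 show ?case using M_bounds by simp
  next
    case 4 show ?case by (simp add: row_targets_def)
  next
    case (5 s1 q)
    have b1: "base s1" "regs s1 ''i'' = i" using base_preserved[OF 5(1) s(1,2)] by simp_all
    have D1: "cells s1 ''D'' = ?D" using 5(1) by (simp add: agree_off_def)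
    have q: "q < V" by fact
    define a where "a = i * V + q"
    have a: "a < n * V" using config_addr(1)[OF s(3) q s(3) q] by (simp add: a_def)
    then have aM: "a < M" "n * V + a < M" using M_bounds(6) by simp_all
    define l where "l = ?D (q div 2) + q"
    define s2 where "s2 = set_cell ''F1'' (n * V + a) 0 (set_cell ''F0'' (n * V + a) 1
      (set_cell ''F1'' a (Suc l mod 2) (set_cell ''F0'' a (l mod 2) s1)))"
    have upd: "row_targets i' D (set_reg ''q'' (Suc q) s2) v = (if i' = i \<and> v = q then
        (\<not> legal D v \<longleftrightarrow> l mod 2 = 1) else row_targets i' D s1 v)" if iv: "i' < n" "v < V" for i' D v
    proof -
      note ca = config_addr[OF iv s(3) q]
      have ll: "l mod 2 = 0 \<or> l mod 2 = 1" by auto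
      show ?thesis
      proof (cases "i' = i \<and> v = q")
        case True
        then have e: "i' * V + v = a" by (simp add: a_def)
        show ?thesis unfolding row_targets_def e using True ll a n L_pos N_pos by (auto simp: s2_def mod_Suc split: if_splits)
      next
        case False
        then have ne: "i' * V + v \<noteq> a" using ca(2) by (simp add: a_def)
        show ?thesis unfolding row_targets_def using False ne a ca(1) by (auto simp: s2_def)
      qed
    qed
    have lq: "\<not> legal ?D q \<longleftrightarrow> l mod 2 = 1" unfolding legal_def l_def by (simp add: mod2_eq_if)
    have inv: "?Inv (Suc q) (set_reg ''q'' (Suc q) s2)"
    proof (intro conjI allI impI)
      fix v assume v: "v < Suc q"
      then show "row_targets i ?D (set_reg ''q'' (Suc q) s2) v"
        using upd[OF s(3), of v] q lq 5(4) by (cases "v = q") auto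
    next
      fix i' D v assume h: "i' < n" "i' \<noteq> i" "v < V" "row_targets i' D s v"
      then show "row_targets i' D (set_reg ''q'' (Suc q) s2) v" using upd[OF h(1,3)] 5(4) by auto
    qed
    let ?out = "Add (Mul (Reg ''i'') (Reg ''V1'')) (Reg ''q'')"
    let ?st = "Store ''F0'' ?out (Rem (Add (Cell ''D'' (Quot (Reg ''q'') (Lit 2))) (Reg ''q'')) (Lit 2)) ;;
      Store ''F1'' ?out (Rem (Succ (Add (Cell ''D'' (Quot (Reg ''q'') (Lit 2))) (Reg ''q''))) (Lit 2)) ;;
      Store ''F0'' (Add (Mul (Reg ''V0'') (Reg ''V1'')) ?out) (Lit 1) ;;
      Store ''F1'' (Add (Mul (Reg ''V0'') (Reg ''V1'')) ?out) (Lit 0)"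
    have out: "regs s1 ''i'' * regs s1 ''V1'' + regs s1 ''q'' = a" "regs s1 ''V0'' * regs s1 ''V1'' = n * V" "regs s1 ''q'' = q"
      using b1 5(2) by (simp_all add: baseD a_def)
    have res: "result E ?st s1 = s2" using out a by (simp add: s2_def D1 l_def[symmetric])
    have m2: "x mod 2 < M" for x :: nat
    proof -
      have "x mod 2 < 2" by simp
      then show ?thesis using M_bounds(9) by linarith
    qed
    show ?case
    proof (rule runs_loop_free)
      show "loop_free ?st" "max_steps ?st \<le> 4" by simp_all
      show "?Inv (Suc q) (set_reg ''q'' (Suc q) (result E ?st s1))" unfolding res by (rule inv)
      show "in_bounds M E ?st s1" using aM M_bounds(9) m2 out(1)[unfolded out(3)] by (simp add: out D1 l_def[symmetric])
    qed
  qed simp_all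
  then show ?thesis by (rule runs_weaken) simp_all
qed

text \<open>The rows share the array \<open>D\<close>, which the next row overwrites. The settings
  are therefore hidden behind an existential quantifier; the bits in the target arrays are their
  lasting trace.\<close>

definition row_done :: "nat \<Rightarrow> state \<Rightarrow> bool" where
  "row_done i s \<longleftrightarrow> (\<exists>D. (\<forall>v<V. row_targets i D s v) \<and> (dominated i \<longrightarrow> wf ((legal_arcs_of D)\<inverse>)) \<and>
     (\<not> dominated i \<longrightarrow> (\<exists>v. (v, v) \<in> (legal_arcs_of D)\<^sup>+)))"

lemma runs_row:
  assumes s: "base s" "regs s ''i'' = i" "i < n"
  shows "runs M E row_prog s (100 * (L * N)) (\<lambda>s'. row_done i s' \<and>
    regs s' ''g'' = (if \<forall>j<m. attained i j then regs s ''g'' else 0) \<and>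
    (\<forall>i'<n. i' \<noteq> i \<longrightarrow> row_done i' s \<longrightarrow> row_done i' s'))"
proof -
  have time: "N * 3 + 2 + (L * (N * 8 + 4) + 2) + ((N * 6 + 3) + ((N * 6 + 2) + ((L * (N * 24 + 9) + 2) + (V * 6 + 2)))) \<le> 100 * (L * N)"
  proof -
    have "1 \<le> L * N" "N \<le> L * N" "L \<le> L * N" using L_pos N_pos by simp_all
    moreover have "N * 3 + 2 + (L * (N * 8 + 4) + 2) + ((N * 6 + 3) + ((N * 6 + 2) + ((L * (N * 24 + 9) + 2) + (V * 6 + 2))))
      = 15 * N + 13 * L + 13 + 56 * (L * N)" by (simp add: algebra_simps)
    ultimately show ?thesis by linarith
  qed
  show ?thesis unfolding row_prog_def
  proof (rule runs_Seq_le[OF runs_sort[OF s] _ time], goal_cases)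
    case (1 s1)
    have b1: "base s1" "regs s1 ''i'' = i" using base_preserved[OF 1(1) s(1,2)] by simp_all
    have g1: "regs s1 ''g'' = regs s ''g''" using 1(1) by (simp add: agree_off_def)
    have F1: "cells s1 ''F0'' = cells s ''F0''" "cells s1 ''F1'' = cells s ''F1''"
      using 1(1) by (simp_all add: agree_off_def)
    have srt: "sorted_level i L s1" by fact
    show ?case
    proof (rule runs_Seq[OF runs_attained[OF b1 s(3) srt]], goal_cases)
      case (1 s2)
      have b2: "base s2" "regs s2 ''i'' = i" using base_preserved[OF 1(1) b1] by simp_all
      have "order_at s2 = order_at s1" using 1(1) by (simp add: agree_off_def order_at_def fun_eq_iff)
      then have srt2: "sorted_level i L s2" "order_at s2 = order_at s1" using srt by (simp_all add: sorted_level_def)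
      have F2: "cells s2 ''F0'' = cells s ''F0''" "cells s2 ''F1'' = cells s ''F1''"
        using 1(1) F1 by (simp_all add: agree_off_def)
      have g2: "regs s2 ''g'' = (if \<forall>j<m. attained i j then regs s ''g'' else 0)" using 1(2) unfolding g1 .
      show ?case
      proof (rule runs_Seq[OF runs_permutation[OF b2 s(3) srt2(1)]], goal_cases)
        case (1 s3)
        have b3: "base s3" "regs s3 ''i'' = i" using base_preserved[OF 1(1) b2] by simp_all
        have g3: "regs s3 ''g'' = regs s2 ''g''" using 1(1) by (simp add: agree_off_def)
        have F3: "cells s3 ''F0'' = cells s ''F0''" "cells s3 ''F1'' = cells s ''F1''"
          using 1(1) F2 by (simp_all add: agree_off_def)
        have net: "runs M E (For ''t'' (Reg ''L'') (colour_prog ;; switch_prog)) s3 (L * (N * 24 + 9) + 2) (network_done (order_at s2 L) L)"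
          using 1(2) sorted_levelD(3)[OF srt2(1)] by (intro runs_network[OF b3]) auto
        show ?case
        proof (rule runs_Seq[OF net], goal_cases)
          case (1 s4)
          have b4: "base s4" "regs s4 ''i'' = i" using base_preserved[OF 1(1) b3] by simp_all
          have g4: "regs s4 ''g'' = regs s2 ''g''" using 1(1) g3 by (simp add: agree_off_def)
          have F4: "cells s4 ''F0'' = cells s ''F0''" "cells s4 ''F1'' = cells s ''F1''"
            using 1(1) F3 by (simp_all add: agree_off_def)
          note nc = network_correct[OF srt2(1) 1(2)]
          show ?case
          proof (rule runs_weaken[OF runs_targets[OF b4 s(3)]], goal_cases)
            case (2 s5)
            have "regs s5 ''g'' = regs s2 ''g''" using 2(1) g4 by (simp add: agree_off_def)
            moreover have "row_done i s5" unfolding row_done_def using 2(2) nc by blast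
            moreover have "row_done i' s5" if "i' < n" "i' \<noteq> i" "row_done i' s" for i'
            proof -
              have "row_targets i' D s4 v" if "row_targets i' D s v" for D v
                using that by (simp add: row_targets_def F4)
              then have "row_targets i' D s5 v" if "row_targets i' D s v" "v < V" for D v
                using that 2(2) \<open>i' < n\<close> \<open>i' \<noteq> i\<close> by blast
              then show ?thesis using that(3) unfolding row_done_def by blast
            qed
            ultimately show ?case using g2 by simp
          qed simp
        qed
      qed
    qed
  qed
qed

end

lemma runs_setup:
  fixes A :: "'a::linorder mat" and C :: "'a option mat"
  assumes n: "n \<ge> 1" and m: "m \<ge> 1" and inst: "distinct_msb_instance n m m A B C"
    and M: "256 * n * m * m + 8 * m * m < M"
  shows "runs M (msb_entries n m m A C) setup_prog (msb_input n m m B C) (30 * m)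
    (\<lambda>s. \<exists>L. msb_run n m L M A B C \<and> msb_run.base n m L B C s \<and> regs s ''g'' = 1)"
proof -
  let ?E = "msb_entries n m m A C"
  let ?s0 = "msb_input n m m B C"
  have "m * m \<le> n * (m * m)" "m \<le> m * m" "n \<le> n * (m * m)" using n m by simp_all
  moreover have "256 * (n * (m * m)) + 8 * (m * m) < M" using M by (simp add: mult.assoc)
  ultimately have M': "16 * m < M" "n < M" "16 < M" using m by linarith+
  define s1 where "s1 = set_reg ''L'' 0 (set_reg ''N'' 1 ?s0)"
  have r1: "regs s1 ''n1'' = n" "regs s1 ''n2'' = m" by (simp_all add: s1_def msb_input_def)
  let ?test = "Less (Reg ''N'') (Succ (Twice (Reg ''n2'')))"
  let ?body = "Store ''p'' (Reg ''L'') (Reg ''N'') ;; ''N'' ::= Twice (Reg ''N'') ;; ''L'' ::= Succ (Reg ''L'')"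
  let ?Inv = "\<lambda>s'. regs s' ''N'' = 2 ^ regs s' ''L'' \<and> regs s' ''N'' \<le> 4 * m \<and> (\<forall>t<regs s' ''L''. cells s' ''p'' t = 2 ^ t)"
  \<comment> \<open>The variant counts in units although \<open>N\<close> doubles; the resulting
    bound is linear in \<open>m\<close>, which the overall time allows.\<close>
  have loop: "runs M ?E (While ?test ?body) s1 ((2 * m + 1 - regs s1 ''N'') * (3 + 1) + 1) (\<lambda>s'. ?Inv s' \<and> \<not> bval ?E s' ?test)"
  proof (rule runs_While[where Inv = ?Inv and \<Phi> = "\<lambda>s'. 2 * m + 1 - regs s' ''N''"], goal_cases)
    case 1 show ?case using m by (simp add: s1_def)
  next
    case (2 s')
    have "regs s' ''n2'' = m" using 2(1) r1 by (simp add: agree_off_def)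
    then have lt: "regs s' ''N'' < 2 * m + 1" using 2(3) by simp
    have N': "1 \<le> (2::nat) ^ regs s' ''L''" "regs s' ''L'' < 2 ^ regs s' ''L''" "2 ^ regs s' ''L'' \<le> 2 * m"
      using lt 2(2) by simp_all
    then have "regs s' ''L'' < M" "Suc (regs s' ''L'') < M" "2 ^ regs s' ''L'' < M" "2 * 2 ^ regs s' ''L'' < M"
      "2 * m + 1 - 2 * 2 ^ regs s' ''L'' < 2 * m + 1 - 2 ^ regs s' ''L''" "2 * 2 ^ regs s' ''L'' \<le> 4 * m"
      using M' by linarith+
    then show ?case using 2(2)
      by (intro runs_loop_free) (auto simp: All_less_Suc)
  qed
  show ?thesis unfolding setup_prog_def
  proof (rule runs_Seq_le[where R = "\<lambda>s. s = set_reg ''N'' 1 ?s0" and T = 1 and T' = "1 + ((8 * m + 1) + ((12 * m + 2) + 3))"], goal_cases)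
    case 1 show ?case using M' by (intro runs_loop_free) simp_all
  next
    case (2 s)
    show ?case unfolding 2(2)
    proof (rule runs_Seq[where R = "\<lambda>s. s = s1"], goal_cases)
      case 1 show ?case using M' by (intro runs_loop_free) (simp_all add: s1_def)
    next
      case (2 s)
      have loop': "runs M ?E (While ?test ?body) s1 (8 * m + 1) (\<lambda>s'. ?Inv s' \<and> \<not> bval ?E s' ?test)"
        using loop by (rule runs_weaken) (simp_all add: s1_def)
      show ?case unfolding 2(2)
      proof (rule runs_Seq[OF loop'], goal_cases)
        case (1 s2)
        define L where "L = regs s2 ''L''"
        have r2: "regs s2 ''n1'' = n" "regs s2 ''n2'' = m"
          using 1(1) r1 by (simp_all add: agree_off_def)
        have L: "regs s2 ''N'' = 2 ^ L" "2 ^ L \<le> 4 * m" "\<And>t. t < L \<Longrightarrow> cells s2 ''p'' t = 2 ^ t" "2 * m < 2 ^ L"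
          using 1(2) r2 by (simp_all add: L_def)
        have L4: "L < 4 * m" using L(2) less_exp[of L] by linarith
        \<comment> \<open>Since \<open>L < 2 ^ L \<le> 4 * m\<close>, the product
          \<open>L * 2 ^ L\<close> is at most \<open>16 * m * m\<close>; this is where the 256 comes
          from.\<close>
        have LN: "16 * n * L * 2 ^ L + 8 * m * m < M"
        proof -
          have "L * 2 ^ L \<le> (4 * m) * (4 * m)" using L4 L(2) by (intro mult_mono) auto
          then have "16 * n * (L * 2 ^ L) \<le> 16 * n * ((4 * m) * (4 * m))" by (rule mult_left_mono) simp
          also have "\<dots> = 256 * n * m * m" by simp
          finally show ?thesis using M unfolding mult.assoc by linarith
        qed
        interpret msb_run n m L M A B C using n m L LN inst by unfold_locales auto
        let ?J = "\<lambda>t s'. (\<forall>u<L. cells s' ''p'' u = 2 ^ u) \<and> (\<forall>u<t. cells s' ''p'' (2 * L - 1 - u) = 2 ^ u)"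
        let ?st = "Store ''p'' (Sub (Sub (Twice (Reg ''L'')) (Lit 1)) (Reg ''t'')) Weight"
        have copy: "runs M ?E (For ''t'' (Reg ''L'') ?st) s2 (L * (1 + 2) + 2) (?J L)"
        proof (rule runs_For_reg[where Inv = ?J], goal_cases)
          case 1 show ?case by (simp add: L_def)
        next
          case 2 show ?case using M_bounds by simp
        next
          case 4 show ?case using L(3) by simp
        next
          case (5 s' t)
          have "regs s' ''L'' = L" using 5(1) by (simp add: agree_off_def L_def)
          moreover have "2 ^ t < (2::nat) ^ L" using 5(3) by simp
          then have "2 ^ t < M" using M_bounds(1) unfolding N_def by (rule less_trans)
          moreover have "2 * L - Suc t < M" using M_bounds(3) by simp
          ultimately show ?case using 5(2,3,4)
            by (intro runs_loop_free) (auto simp: less_Suc_eq)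
        qed simp_all
        then have copy': "runs M ?E (For ''t'' (Reg ''L'') ?st) s2 (12 * m + 2) (?J L)"
          by (rule runs_weaken) (use L4 in simp_all)
        show ?case
        proof (rule runs_Seq[OF copy'], goal_cases)
          case (1 s3)
          have r3: "regs s3 ''n1'' = n" "regs s3 ''n2'' = m" "regs s3 ''L'' = L" "regs s3 ''N'' = N"
            using 1(1) r2 L by (simp_all add: agree_off_def L_def[symmetric] N_def)
          have c3: "cells s3 ''B'' = cells ?s0 ''B''" "cells s3 ''C'' = cells ?s0 ''C''"
            using agree_off_cells[OF 1(1), of "''B''"] agree_off_cells[OF 1(1), of "''C''"]
              agree_off_cells[OF \<open>agree_off _ _ s1 s2\<close>, of "''B''"] agree_off_cells[OF \<open>agree_off _ _ s1 s2\<close>, of "''C''"]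
            by (simp_all add: s1_def)
          have p3: "cells s3 ''p'' u = weight u" if u: "u < 2 * L" for u
          proof (cases "u < L")
            case True then show ?thesis using 1(2) by (simp add: weight_def)
          next
            case False
            define u' where "u' = 2 * L - 1 - u"
            have "u' < L" "u = 2 * L - 1 - u'" using False u by (auto simp: u'_def)
            then have "cells s3 ''p'' u = 2 ^ u'" using 1(2) by metis
            then show ?thesis using False by (simp add: weight_def u'_def)
          qed
          have "base (set_reg ''g'' 1 (set_reg ''V1'' (4 * L * N) (set_reg ''V0'' n s3)))"
            using r3 p3 by (simp add: base_def c3 msb_input_def)
          then show ?case using M_bounds(4,7,9) msb_run_axioms
            by (intro runs_loop_free) (auto simp: r3)
        qed
      qed
    qed
  qed (use m in simp)
qed

section \<open>Writing the two graphs\<close>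

definition arcs_of :: "state \<Rightarrow> (nat \<times> nat) set" where
  "arcs_of s = (\<lambda>e. (cells s ''src1'' e, cells s ''dst1'' e)) ` {..<regs s ''E1''}"

lemma written_add_arcs [simp]:
  "written_regs (add_arcs bd b x y) = {''q'', ''E1''}" "written_arrays (add_arcs bd b x y) = {''src1'', ''dst1''}"
  by (auto simp: add_arcs_def)

text \<open>The hypothesis on \<open>b\<close>, \<open>x\<close> and \<open>y\<close> ranges over
  all states that agree with \<open>s\<close> off the registers and arrays written here, because
  \<open>y\<close> is evaluated after the tail has been stored.\<close>

lemma runs_add_arcs:
  assumes bd: "\<And>s'. agree_off {''q'', ''E1''} {''src1'', ''dst1''} s s' \<Longrightarrow> aval s' bd = K"
    and M: "K < M" "regs s ''E1'' + K < M"
    and ev: "\<And>s' a. agree_off {''q'', ''E1''} {''src1'', ''dst1''} s s' \<Longrightarrow> regs s' ''q'' = a \<Longrightarrow> a < K \<Longrightarrow>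
      (bval E s' b \<longleftrightarrow> P a) \<and> (P a \<longrightarrow> (aval s' x, aval s' y) = f a)"
    and f: "\<And>a. a < K \<Longrightarrow> P a \<Longrightarrow> fst (f a) < M \<and> snd (f a) < M"
  shows "runs M E (add_arcs bd b x y) s (K * 6 + 2)
    (\<lambda>s'. arcs_of s' = arcs_of s \<union> f ` {a. a < K \<and> P a} \<and> regs s' ''E1'' \<le> regs s ''E1'' + K)"
proof -
  let ?Inv = "\<lambda>q s'. arcs_of s' = arcs_of s \<union> f ` {a. a < q \<and> P a} \<and> regs s' ''E1'' \<le> regs s ''E1'' + q"
  have "runs M E (add_arcs bd b x y) s (K * (4 + 2) + 2) (?Inv K)" unfolding add_arcs_def
  proof (rule runs_For[where Inv = ?Inv], goal_cases)
    case (1 s')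
    have "agree_off {''q'', ''E1''} {''src1'', ''dst1''} s s'" by (rule agree_off_mono[OF 1]) auto
    then show ?case by (rule bd)
  next
    case 2 show ?case by fact
  next
    case 4 show ?case by (simp add: arcs_of_def)
  next
    case (5 s1 q)
    have ag: "agree_off {''q'', ''E1''} {''src1'', ''dst1''} s s1" by (rule agree_off_mono[OF 5(1)]) auto
    define e where "e = regs s1 ''E1''"
    have E: "e < M" "Suc e < M" using 5(3,4) M(2) by (simp_all add: e_def)
    have I: "arcs_of s1 = arcs_of s \<union> f ` {a. a < q \<and> P a}" "e \<le> regs s ''E1'' + q" using 5(4) by (simp_all add: e_def)
    have test: "bval E s1 b \<longleftrightarrow> P q" using ev[OF ag 5(2,3)] by simp
    show ?case
    proof (cases "P q")
      case False
      then have "{a. a < Suc q \<and> P a} = {a. a < q \<and> P a}" by (auto simp: less_Suc_eq)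
      then show ?thesis using I test False
        by (intro runs_loop_free) (auto simp: arcs_of_def e_def)
    next
      case True
      define s2 where "s2 = set_cell ''src1'' e (aval s1 x) s1"
      have ag2: "agree_off {''q'', ''E1''} {''src1'', ''dst1''} s s2"
        using ag by (auto simp: agree_off_def s2_def set_cell_def)
      have q2: "regs s2 ''q'' = q" using 5(2) by (simp add: s2_def)
      have xy: "aval s1 x = fst (f q)" "aval s2 y = snd (f q)"
        using ev[OF ag 5(2,3)] ev[OF ag2 q2 5(3)] True by (metis fst_conv, metis snd_conv)
      have lt: "aval s1 x < M" "aval s2 y < M" using f[OF 5(3) True] xy by simp_all
      define s3 where "s3 = set_reg ''E1'' (Suc e) (set_cell ''dst1'' e (aval s2 y) s2)"
      have c3: "cells s3 ''src1'' = (cells s1 ''src1'')(e := fst (f q))"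
        "cells s3 ''dst1'' = (cells s1 ''dst1'')(e := snd (f q))" "regs s3 ''E1'' = Suc e"
        by (simp_all add: fun_eq_iff s3_def xy) (simp_all add: s2_def xy)
      have "arcs_of s3 = insert (f q) (arcs_of s1)"
        unfolding arcs_of_def c3 lessThan_Suc image_insert e_def[symmetric]
        by (intro arg_cong2[where f = insert] image_cong) auto
      moreover have "{a. a < Suc q \<and> P a} = insert q {a. a < q \<and> P a}" using True by (auto simp: less_Suc_eq)
      ultimately have inv: "?Inv (Suc q) (set_reg ''q'' (Suc q) s3)"
        using I by (auto simp: arcs_of_def s3_def)
      have res: "result E (Add_Arc x y) s1 = s3"
        by (simp add: s3_def s2_def e_def)
      have bd: "in_bounds M E (Add_Arc x y) s1"
        using lt E by (simp add: s2_def e_def)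
      show ?thesis
      proof (rule runs_loop_free, goal_cases)
        case 2 show ?case using bd True test by (simp only: in_bounds.simps if_True)
      next
        case 4 show ?case unfolding result.simps(4) test if_P[OF True] res by (rule inv)
      qed simp_all
    qed
  qed simp_all
  then show ?thesis by (rule runs_weaken) simp_all
qed

lemma written_graphs_prog [simp]:
  "written_regs graphs_prog = {''q'', ''E0'', ''E1''}" "written_arrays graphs_prog = {''src0'', ''dst0'', ''src1'', ''dst1''}"
  by (auto simp: graphs_prog_def Let_def)

context msb_run
begin

definition graphs_done :: "state \<Rightarrow> bool" where
  "graphs_done s \<longleftrightarrow> regs s ''E0'' = n \<and> (\<forall>e<n. cells s ''src0'' e = e \<and> cells s ''dst0'' e = e) \<and> arcs_of s = arcs"

lemma graphs_done_agree_off: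
  assumes "agree_off X Y s s'" "graphs_done s"
    "X \<inter> {''E0'', ''E1''} = {}" "Y \<inter> {''src0'', ''dst0'', ''src1'', ''dst1''} = {}"
  shows "graphs_done s'"
proof -
  have "regs s' x = regs s x" if "x \<in> {''E0'', ''E1''}" for x
    using assms that by (intro agree_off_reg[OF assms(1)]) blast
  moreover have "cells s' x = cells s x" if "x \<in> {''src0'', ''dst0'', ''src1'', ''dst1''}" for x
    using assms that by (intro agree_off_cells[OF assms(1)]) blast
  ultimately show ?thesis using assms(2) by (simp add: graphs_done_def arcs_of_def)
qed

lemma runs_graphs:
  assumes s: "base s" "regs s ''E1'' = 0"
  shows "runs M E graphs_prog s (4 * n + 48 * (L * N) + 24 * (m * m) + 7) graphs_done"
proof -
  let ?Alice = "\<lambda>s'. \<forall>e<n. cells s' ''src0'' e = e \<and> cells s' ''dst0'' e = e"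
  have alice: "runs M E (For ''q'' (Reg ''n1'') (Store ''src0'' (Reg ''q'') (Reg ''q'') ;; Store ''dst0'' (Reg ''q'') (Reg ''q''))) s
     (n * (2 + 2) + 2) ?Alice"
  proof (rule runs_For_reg[where Inv = "\<lambda>q s'. \<forall>e<q. cells s' ''src0'' e = e \<and> cells s' ''dst0'' e = e"], goal_cases)
    case 1 show ?case using s(1) by (simp add: baseD)
  next
    case 2 show ?case using M_bounds by simp
  next
    case (5 s1 q)
    show ?case using 5 M_bounds(7) by (intro runs_loop_free) (auto simp: less_Suc_eq)
  qed simp_all
  have arc_lt: "fst e < M \<and> snd e < M" if "e \<in> arcs" for e
  proof -
    have "e \<in> {..<4 * L * N} \<times> {..<4 * L * N}" using that arcs_less by blast
    then have "fst e < 4 * L * N" "snd e < 4 * L * N" by auto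
    then show ?thesis using M_bounds(4) by linarith
  qed
  have tm: "n * (2 + 2) + 2 + (1 + ((8 * L * N * 6 + 2) + (4 * m * m * 6 + 2))) \<le> 4 * n + 48 * (L * N) + 24 * (m * m) + 7"
    by simp
  show ?thesis unfolding graphs_prog_def Let_def
  proof (rule runs_Seq_le[OF alice _ tm], goal_cases)
    case (1 s1)
    have b1: "base s1" using base_agree_off[OF 1(1) s(1)] by simp
    have e1: "regs s1 ''E1'' = 0" using 1(1) s(2) by (simp add: agree_off_def)
    define s2 where "s2 = set_reg ''E0'' n s1"
    have b2: "base s2" "regs s2 ''E1'' = 0" "regs s2 ''E0'' = n" "?Alice s2"
      using b1 e1 1(2) by (simp_all add: s2_def base_def)
    have arcs2: "arcs_of s2 = {}" using b2 by (simp add: arcs_of_def)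
    let ?P = "\<lambda>a. \<not> (4 * m \<le> a div 2 \<and> a div 2 < 2 * N)"
    let ?Q = "\<lambda>a. B $$ (a div 4 div m, a div 4 mod m)"
    show ?case
    proof (rule runs_Seq[where R = "\<lambda>s. s = s2"], goal_cases)
      case 1 show ?case using M_bounds(7) b1 by (intro runs_loop_free) (simp_all add: s2_def baseD)
    next
      case (2 s')
      show ?case unfolding 2(2)
      proof (rule runs_Seq[OF runs_add_arcs[where K = "8 * L * N" and f = route_arc and P = ?P]], goal_cases)
        case (1 s')
        have "base s'" using base_agree_off[OF 1 b2(1)] by simp
        then show ?case by (simp add: baseD)
      next
        case 2 show ?case using M_bounds(5) by simp
      next
        case 3 show ?case using M_bounds(5) b2(2) by simp
      next
        case (4 s' a)
        have b: "base s'" using base_agree_off[OF 4(1) b2(1)] by simp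
        have sl: "a div 2 div (2 * N) < 2 * L"
        proof -
          have "a div 2 < 2 * L * (2 * N)" using 4(3) by auto
          then show ?thesis by (rule less_mult_imp_div_less)
        qed
        show ?case using baseD(7)[OF b sl] 4(2)
          by (simp add: baseD(2-4)[OF b] route_arc_def Let_def set_digit_def not_less)
      next
        case (5 a)
        then have "route_arc a \<in> arcs" by (simp add: arcs_def route_arcs_def)
        then show ?case by (rule arc_lt)
      next
        case (6 s3)
        have b3: "base s3" using base_agree_off[OF 6(1) b2(1)] by simp
        have r3: "arcs_of s3 = route_arcs" "regs s3 ''E1'' \<le> 8 * L * N" using 6(2) arcs2 b2(2) by (simp_all add: route_arcs_def)
        have a3: "regs s3 ''E0'' = n" "?Alice s3"
          using 6(1) b2 by (simp_all add: agree_off_def)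
        show ?case
        proof (rule runs_weaken[OF runs_add_arcs[where K = "4 * m * m" and f = matrix_arc and P = ?Q]], goal_cases)
          case (1 s')
          have "base s'" using base_agree_off[OF 1 b3] by simp
          then show ?case by (simp add: baseD)
        next
          case 2 show ?case using M_bounds(5) by simp
        next
          case 3 show ?case using M_bounds(5) r3(2) by simp
        next
          case (4 s' a)
          have b: "base s'" using base_agree_off[OF 4(1) b3] by simp
          have "a div 4 < m * m" using 4(3) by auto
          then show ?case using 4(2)
            by (simp add: baseD(2)[OF b] baseD(8)[OF b] matrix_arc_def)
        next
          case (5 a)
          then have "matrix_arc a \<in> arcs" by (simp add: arcs_def matrix_arcs_def)
          then show ?case by (rule arc_lt)
        next
          case (7 s4)
          have a4: "regs s4 ''E0'' = n" "?Alice s4"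
            using 7(1) a3 by (simp_all add: agree_off_def)
          have "arcs_of s4 = arcs" using 7(2) r3 by (simp add: arcs_def matrix_arcs_def)
          then show ?case using a4 by (simp add: graphs_done_def)
        qed simp
      qed
    qed
  qed
qed

section \<open>All rows and the candidate sets\<close>

lemma runs_rows:
  assumes s: "base s" "regs s ''g'' = 1"
  shows "runs M E (For ''i'' (Reg ''n1'') row_prog) s (n * (100 * (L * N) + 2) + 2)
    (\<lambda>s'. (\<forall>i<n. row_done i s') \<and> regs s' ''g'' = of_bool (\<forall>i<n. \<forall>j<m. attained i j))"
proof (rule runs_For_reg[where Inv = "\<lambda>k s'. (\<forall>i<k. row_done i s') \<and> regs s' ''g'' = of_bool (\<forall>i<k. \<forall>j<m. attained i j)"], goal_cases)
  case 1 show ?case using s(1) by (simp add: baseD)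
next
  case 2 show ?case using M_bounds by simp
next
  case 4 show ?case using s by simp
next
  case (5 s1 i)
  have b1: "base s1" using base_agree_off[OF 5(1) s(1)] by simp
  have rd: "row_done i' (set_reg x k s') = row_done i' s'" for i' x k s'
    by (simp add: row_done_def row_targets_def)
  from runs_row[OF b1 5(2,3)] show ?case
  proof (rule runs_weaken)
    fix s' :: state assume h: "row_done i s' \<and> regs s' ''g'' = (if \<forall>j<m. attained i j then regs s1 ''g'' else 0) \<and>
      (\<forall>i'<n. i' \<noteq> i \<longrightarrow> row_done i' s1 \<longrightarrow> row_done i' s')"
    have "row_done i' s'" if "i' < Suc i" for i' using h 5(3,4) that by (cases "i' = i") auto
    moreover have "(\<forall>i'<Suc i. Q i') \<longleftrightarrow> (\<forall>i'<i. Q i') \<and> Q i" for Q by (auto simp: less_Suc_eq)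
    then have "regs s' ''g'' = of_bool (\<forall>i'<Suc i. \<forall>j<m. attained i' j)" using h 5(4) by auto
    ultimately show "(\<forall>i'<Suc i. row_done i' (set_reg ''i'' (Suc i) s')) \<and>
      regs (set_reg ''i'' (Suc i) s') ''g'' = of_bool (\<forall>i'<Suc i. \<forall>j<m. attained i' j)"
      by (simp add: rd)
  qed simp
qed simp_all

lemma runs_candidates:
  assumes s: "base s" and g: "regs s ''g'' < M"
  shows "runs M E candidates_prog s (2 * (n * V) * 4 + 2)
    (\<lambda>s'. \<forall>a<2 * (n * V). cells s' ''W0'' a = regs s ''g'' \<and> cells s' ''S0'' a = regs s ''g'')"
proof -
  have K: "2 * (n * V) < M" using M_bounds(6) by (simp add: mult.assoc mult.left_commute)
  have "runs M E candidates_prog s (2 * (n * V) * (2 + 2) + 2)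
    (\<lambda>s'. \<forall>a<2 * (n * V). cells s' ''W0'' a = regs s ''g'' \<and> cells s' ''S0'' a = regs s ''g'')"
    unfolding candidates_prog_def
  proof (rule runs_For[where Inv = "\<lambda>k s'. \<forall>a<k. cells s' ''W0'' a = regs s ''g'' \<and> cells s' ''S0'' a = regs s ''g''"], goal_cases)
    case (1 s')
    have "base s'" using base_agree_off[OF 1 s] by simp
    then show ?case by (simp add: baseD)
  next
    case 2 show ?case using K .
  next
    case (5 s1 q)
    have "regs s1 ''g'' = regs s ''g''" using 5(1) by (simp add: agree_off_def)
    then show ?case using 5(2-4) K g by (intro runs_loop_free) (auto simp: less_Suc_eq)
  qed simp_all
  then show ?thesis by simp
qed

subsection \<open>Correctness of the reduction\<close>

text \<open>A finite maximum is characterised as an upper bound that is attained. For an entry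
  \<open>None\<close> attainment is vacuous, and no row lies below such a column, so dominance says
  that the set is empty.\<close>

lemma product_iff: "C = A \<star>\<^sub>m\<^sub>a\<^sub>x B \<longleftrightarrow> (\<forall>i<n. dominated i) \<and> (\<forall>i<n. \<forall>j<m. attained i j)"
proof -
  have carr: "A \<in> carrier_mat n m" "B \<in> carrier_mat m m" "C \<in> carrier_mat n m"
    using inst by (auto simp: distinct_msb_instance_def)
  define S where "S i j = {A $$ (i, k) |k. k < m \<and> B $$ (k, j)}" for i j
  have "C = A \<star>\<^sub>m\<^sub>a\<^sub>x B \<longleftrightarrow> (\<forall>i<n. \<forall>j<m. C $$ (i, j) = max_option (S i j))"
    using carr by (auto simp: mat_eq_iff max_semi_boolean_mult_def S_def)
  also have "\<dots> \<longleftrightarrow> (\<forall>i<n. \<forall>j<m. (\<forall>k<m. B $$ (k, j) \<longrightarrow> le i k (m + j)) \<and> attained i j)"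
  proof -
    have "C $$ (i, j) = max_option (S i j) \<longleftrightarrow> (\<forall>k<m. B $$ (k, j) \<longrightarrow> le i k (m + j)) \<and> attained i j"
      if ij: "i < n" "j < m" for i j
    proof -
      have le: "le i k (m + j) \<longleftrightarrow> C $$ (i, j) \<noteq> None \<and> A $$ (i, k) \<le> the (C $$ (i, j))" if "k < m" for k
        using that ij by (auto simp: le_def none_def val_def)
      have fin: "finite (S i j)"
      proof -
        have "S i j \<subseteq> (\<lambda>k. A $$ (i, k)) ` {..<m}" by (auto simp: S_def)
        then show ?thesis using finite_subset by blast
      qed
      show ?thesis
      proof (cases "C $$ (i, j)")
        case None
        then show ?thesis using le by (auto simp: max_option_def attained_def S_def)
      next
        case (Some c)
        have "Some c = max_option (S i j) \<longleftrightarrow> c \<in> S i j \<and> (\<forall>x\<in>S i j. x \<le> c)"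
          using fin Max_eq_iff[OF fin, of c] by (auto simp: max_option_def)
        also have "\<dots> \<longleftrightarrow> (\<forall>k<m. B $$ (k, j) \<longrightarrow> A $$ (i, k) \<le> c) \<and> (\<exists>k<m. B $$ (k, j) \<and> A $$ (i, k) = c)"
          by (auto simp: S_def)
        finally show ?thesis using le Some by (auto simp: attained_def)
      qed
    qed
    then show ?thesis by blast
  qed
  also have "\<dots> \<longleftrightarrow> (\<forall>i<n. dominated i) \<and> (\<forall>i<n. \<forall>j<m. attained i j)"
    by (auto simp: dominated_def)
  finally show ?thesis .
qed

text \<open>If some row is not dominated, Bob survives somewhere although his candidate set is
  empty. If attainment fails, Alice's candidate set is empty although she wins at once at an illegal
  vertex. Otherwise she wins everywhere, as the candidates claim.\<close>

lemma output_correct: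
  assumes s: "base s" and gd: "graphs_done s" and rows: "\<And>i. i < n \<Longrightarrow> row_done i s"
    and cand: "\<And>a. a < 2 * (n * V) \<Longrightarrow> cells s ''W0'' a = g \<and> cells s ''S0'' a = g"
    and g: "g = of_bool (\<forall>i<n. \<forall>j<m. attained i j)"
    and zero: "cells s ''W1'' = (\<lambda>_. 0)" "cells s ''S1'' = (\<lambda>_. 0)"
  shows "trg_instance (trg_output s)" "card (pverts (graphs (trg_output s) Alice)) = n"
    "card (pverts (graphs (trg_output s) Bob)) = V"
    "C = A \<star>\<^sub>m\<^sub>a\<^sub>x B \<longleftrightarrow> trg_correct (trg_output s)"
proof -
  have HA: "out_graph s Alice = \<lparr>pverts = {..<n}, parcs = Id_on {..<n}\<rparr>"
    using gd by (auto simp: out_graph_def baseD[OF s] graphs_done_def)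
  have HB: "out_graph s Bob = \<lparr>pverts = {..<V}, parcs = arcs\<rparr>"
    using gd by (simp add: out_graph_def baseD[OF s] graphs_done_def arcs_of_def)
  have "\<forall>i. \<exists>D. i < n \<longrightarrow> (\<forall>v<V. row_targets i D s v) \<and> (dominated i \<longrightarrow> wf ((legal_arcs_of D)\<inverse>)) \<and>
     (\<not> dominated i \<longrightarrow> (\<exists>v. (v, v) \<in> (legal_arcs_of D)\<^sup>+))"
    using rows unfolding row_done_def by blast
  then obtain D where D: "\<And>i v. i < n \<Longrightarrow> v < V \<Longrightarrow> row_targets i (D i) s v"
    "\<And>i. i < n \<Longrightarrow> dominated i \<Longrightarrow> wf ((legal_arcs_of (D i))\<inverse>)"
    "\<And>i. i < n \<Longrightarrow> \<not> dominated i \<Longrightarrow> \<exists>v. (v, v) \<in> (legal_arcs_of (D i))\<^sup>+"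
    by metis
  have configs: "configs (token_game (out_graph s)) = {(Alice, i, v) |i v. i < n \<and> v < V} \<union> {(Bob, v, i) |i v. i < n \<and> v < V}"
    by (auto simp: token_game_def token_configs_def HA HB)
  have addr: "config_address s (Alice, i, v) = i * V + v" "config_address s (Bob, v, i) = n * V + (i * V + v)" for i v
    by (simp_all add: baseD[OF s])
  have F0: "out_configs s ''F0'' = {(Alice, i, v) |i v. i < n \<and> v < V \<and> \<not> legal (D i) v} \<union> {(Bob, v, i) |i v. i < n \<and> v < V}"
    unfolding out_configs_def configs using D(1) by (auto simp: addr row_targets_def simp del: config_address.simps)
  have F1: "out_configs s ''F1'' = {(Alice, i, v) |i v. i < n \<and> v < V \<and> legal (D i) v}"
    unfolding out_configs_def configs using D(1) by (auto simp: addr row_targets_def simp del: config_address.simps)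
  interpret game: self_loop_game n V arcs "\<lambda>i. legal (D i)" "out_graph s" "\<lambda>P. out_configs s (tag P ''F'')"
    using arcs_less by unfold_locales (simp_all add: HA HB F0 F1)
  have la: "game.legal_arcs i = legal_arcs_of (D i)" for i
    by (simp add: game.legal_arcs_def legal_arcs_of_def)
  have addr_lt: "config_address s \<sigma> < 2 * (n * V)" if \<sigma>: "\<sigma> \<in> configs (token_game (out_graph s))" for \<sigma>
  proof -
    obtain i v where iv: "i < n" "v < V" and "\<sigma> = (Alice, i, v) \<or> \<sigma> = (Bob, v, i)"
      using \<sigma> unfolding configs by auto
    then have "config_address s \<sigma> = i * V + v \<or> config_address s \<sigma> = n * V + (i * V + v)"
      using addr by metis
    then show ?thesis using config_addr(1)[OF iv iv] by linarith
  qed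
  have W0: "out_configs s ''W0'' = (if g = 0 then {} else configs (token_game (out_graph s)))"
    and S0: "out_configs s ''S0'' = (if g = 0 then {} else configs (token_game (out_graph s)))"
    using cand addr_lt by (auto simp: out_configs_def)
  have WS1: "out_configs s ''W1'' = {}" "out_configs s ''S1'' = {}"
    using zero by (simp_all add: out_configs_def)
  show "trg_instance (trg_output s)"
    using game.digraphs game.targets_partition by (simp add: trg_instance_def trg_output_def)
  show "card (pverts (graphs (trg_output s) Alice)) = n" "card (pverts (graphs (trg_output s) Bob)) = V"
    by (simp_all add: trg_output_def HA HB)
  let ?G = "token_game (out_graph s)" and ?F = "\<lambda>P. out_configs s (tag P ''F'')"
  have all_P: "(\<forall>P. Q P) \<longleftrightarrow> Q Alice \<and> Q Bob" for Q by (metis player.exhaust)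
  have correct_iff: "trg_correct (trg_output s) \<longleftrightarrow>
      out_configs s ''W0'' = winning_set ?G ?F Alice \<and> out_configs s ''S0'' = surviving_set ?G ?F Alice \<and>
      out_configs s ''W1'' = winning_set ?G ?F Bob \<and> out_configs s ''S1'' = surviving_set ?G ?F Bob"
    by (simp add: trg_correct_def trg_output_def all_P)
  have "trg_correct (trg_output s) \<longleftrightarrow> (\<forall>i<n. dominated i) \<and> g \<noteq> 0"
  proof (intro iffI conjI allI impI)
    fix i assume c: "trg_correct (trg_output s)" and i: "i < n"
    show "dominated i"
    proof (rule ccontr)
      assume "\<not> dominated i"
      then obtain v where "(v, v) \<in> (legal_arcs_of (D i))\<^sup>+" using D(3) i by blast
      then have "(Bob, v, i) \<in> surviving_set ?G ?F Bob"
        using game.Bob_survives_on_cycle[OF i] by (simp add: la)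
      then show False using c WS1 unfolding correct_iff by simp
    qed
  next
    assume c: "trg_correct (trg_output s)"
    have "1 \<le> L * N" using L_pos N_pos by simp
    then have V: "0 < V" "1 < V" unfolding mult.assoc by linarith+
    \<comment> \<open>Vertices 0 and 1 are the two announcements on the same wire before stage 0,
      and one of them contradicts the setting.\<close>
    have "\<not> legal (D 0) 0 \<or> \<not> legal (D 0) 1"
      by (cases "even (D 0 0)") (auto simp: legal_def odd_iff_mod_2_eq_one)
    then obtain v where v: "v < V" "\<not> legal (D 0) v" using V by blast
    have mem: "(Alice, 0, v) \<in> out_configs s ''F0''" using v n by (simp add: F0)
    have "(Alice, 0, v) \<in> winning_set ?G ?F Alice"
    proof (rule wins_if_stops_in_target)
      show "(Alice, 0, v) \<in> controlled ?G Alice" unfolding game.controlled_Alice using v n by simp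
      then show "(Alice, 0, v) \<in> configs ?G" by (simp add: game.configs_eq)
      show "(Alice, 0, v) \<in> out_configs s (tag Alice ''F'')" using mem by simp
    qed
    moreover have "out_configs s ''W0'' = winning_set ?G ?F Alice" using c unfolding correct_iff by simp
    ultimately have "(Alice, 0, v) \<in> out_configs s ''W0''" by (simp only:)
    then show "g \<noteq> 0" unfolding W0 by (simp split: if_splits)
  next
    assume h: "(\<forall>i<n. dominated i) \<and> g \<noteq> 0"
    have "wf ((game.legal_arcs i)\<inverse>)" if "i < n" for i using D(2) h that by (simp add: la)
    from game.Alice_wins_everywhere[OF this] show "trg_correct (trg_output s)"
      unfolding correct_iff using h W0 S0 WS1 by simp
  qed
  then show "C = A \<star>\<^sub>m\<^sub>a\<^sub>x B \<longleftrightarrow> trg_correct (trg_output s)"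
    unfolding product_iff by (simp add: g)
qed

section \<open>Sizes in terms of the logarithm\<close>

lemma log_bound: "real L \<le> 2 + log 2 (real m)"
proof -
  have "real L = log 2 (2 ^ L)" by simp
  also have "\<dots> \<le> log 2 (4 * real m)"
  proof -
    have "(2::real) ^ L = real (2 ^ L)" by simp
    also have "\<dots> \<le> real (4 * m)" using upper by (rule of_nat_mono)
    finally show ?thesis using m by (subst log_le_cancel_iff) auto
  qed
  also have "\<dots> = log 2 4 + log 2 (real m)" using m by (simp add: log_mult)
  also have "log 2 (4::real) = 2" using log_nat_power[of 2 2 2] by simp
  finally show ?thesis .
qed

lemma size_bound: "real (L * N) \<le> 8 * (real m * (1 + log 2 (real m)))"
proof -
  have "0 \<le> log 2 (real m)" using m by simp
  moreover have "x \<le> 2 * (1 + l)" if "0 \<le> l" "x \<le> 2 + l" for x l :: real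
    using that by simp
  ultimately have "real L \<le> 2 * (1 + log 2 (real m))" using log_bound by blast
  moreover have "real N \<le> 4 * real m" using upper of_nat_mono[OF upper] by (simp add: N_def)
  ultimately have "real L * real N \<le> (2 * (1 + log 2 (real m))) * (4 * real m)" by (intro mult_mono) auto
  then show ?thesis by (simp add: algebra_simps)
qed

end

lemma written_reduction [simp]:
  "written_regs setup_prog = {''N'', ''L'', ''t'', ''V0'', ''V1'', ''g''}" "written_arrays setup_prog = {''p''}"
  "written_regs candidates_prog = {''q''}" "written_arrays candidates_prog = {''W0'', ''S0''}"
  by (auto simp: setup_prog_def candidates_prog_def)

text \<open>One constant serves as exponent of the word bound and as factor for time and sizes. The
  choice 2000 covers the time, at most \<open>54 * m * m + 1600 * n * m\<close> up to the
  logarithmic factor. For the words exponent 12 would do, as \<open>n + m\<close> is at least 2 and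
  its ninth power absorbs the factor 512; for Bob's vertices the factor 32 would do.\<close>

theorem theorem20:
  "\<exists>(p :: com) (c :: nat). \<forall>(n :: nat) (m :: nat)
      (A :: 'a::linorder mat) (B :: bool mat) (C :: 'a option mat).
     n \<ge> 1 \<and> m \<ge> 1 \<and> distinct_msb_instance n m m A B C \<longrightarrow>
     (\<exists>t s. exec ((n + m) ^ c) (msb_entries n m m A C) p (msb_input n m m B C) t s \<and>
        real t \<le> real c * real (n * m + m * m) * (1 + log 2 (real m)) \<and>
        trg_instance (trg_output s) \<and>
        card (pverts (graphs (trg_output s) Alice)) \<le> c * n \<and>
        real (card (pverts (graphs (trg_output s) Bob))) \<le> real c * real m * (1 + log 2 (real m)) \<and>
        (C = A \<star>\<^sub>m\<^sub>a\<^sub>x B \<longleftrightarrow> trg_correct (trg_output s)))"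
proof (rule exI[of _ reduction_prog], rule exI[of _ 2000], intro allI impI)
  fix n m :: nat and A :: "'a mat" and B :: "bool mat" and C :: "'a option mat"
  assume "n \<ge> 1 \<and> m \<ge> 1 \<and> distinct_msb_instance n m m A B C"
  then have n: "n \<ge> 1" and m: "m \<ge> 1" and inst: "distinct_msb_instance n m m A B C" by auto
  define M where "M = (n + m) ^ 2000"
  let ?E = "msb_entries n m m A C"
  let ?s0 = "msb_input n m m B C"
  let ?lg = "1 + log 2 (real m)"
  let ?bound = "real 2000 * real (n * m + m * m) * ?lg"
  have lg: "?lg \<ge> 1" using m by simp
  have M: "256 * n * m * m + 8 * m * m < M"
  proof -
    let ?k = "n + m"
    have k: "2 \<le> ?k" using n m by simp
    have "m * m \<le> n * (m * m)" using n by simp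
    then have "256 * (n * (m * m)) + 8 * (m * m) < 512 * (n * (m * m))" using n m by simp
    also have "n * (m * m) \<le> ?k * (?k * ?k)" by (intro mult_mono) auto
    then have "512 * (n * (m * m)) \<le> 512 * ?k ^ 3" by (simp add: power3_eq_cube mult.assoc)
    also have "(512::nat) = 2 ^ 9" by simp
    also have "2 ^ 9 * ?k ^ 3 \<le> ?k ^ 9 * ?k ^ 3" using k by (intro mult_right_mono power_mono) auto
    also have "\<dots> = ?k ^ 12" by (simp flip: power_add)
    also have "\<dots> \<le> ?k ^ 2000" using k by (intro power_increasing) auto
    finally show ?thesis by (simp add: M_def mult.assoc)
  qed
  let ?Q = "\<lambda>t s. real t \<le> ?bound \<and> trg_instance (trg_output s) \<and>
        card (pverts (graphs (trg_output s) Alice)) \<le> 2000 * n \<and>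
        real (card (pverts (graphs (trg_output s) Bob))) \<le> real 2000 * real m * ?lg \<and>
        (C = A \<star>\<^sub>m\<^sub>a\<^sub>x B \<longleftrightarrow> trg_correct (trg_output s))"
  obtain t1 s1 L where s1: "exec M ?E setup_prog ?s0 t1 s1" "t1 \<le> 30 * m"
    "msb_run n m L M A B C" "msb_run.base n m L B C s1" "regs s1 ''g'' = 1"
    using runs_setup[OF n m inst M] by (auto simp: runs_def)
  interpret msb_run n m L M A B C by fact
  have ag1: "agree_off (written_regs setup_prog) (written_arrays setup_prog) ?s0 s1" using exec_agree_off[OF s1(1)] .
  have e1: "regs s1 ''E1'' = 0" using ag1 by (simp add: agree_off_def msb_input_def)
  have z1: "cells s1 ''W1'' = (\<lambda>_. 0)" "cells s1 ''S1'' = (\<lambda>_. 0)"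
    using ag1 by (simp_all add: agree_off_def msb_input_def)
  obtain t2 s2 where s2: "exec M ?E graphs_prog s1 t2 s2" "t2 \<le> 4 * n + 48 * (L * N) + 24 * (m * m) + 7" "graphs_done s2"
    using runs_graphs[OF s1(4) e1] by (auto simp: runs_def)
  note ag2 = exec_agree_off[OF s2(1)]
  have b2: "base s2" using base_agree_off[OF ag2 s1(4)] by simp
  have g2: "regs s2 ''g'' = 1" using ag2 s1(5) by (simp add: agree_off_def)
  let ?g = "of_bool (\<forall>i<n. \<forall>j<m. attained i j) :: nat"
  let ?rows = "For ''i'' (Reg ''n1'') row_prog"
  obtain t3 s3 where s3: "exec M ?E ?rows s2 t3 s3" "t3 \<le> n * (100 * (L * N) + 2) + 2"
    "\<And>i. i < n \<Longrightarrow> row_done i s3" "regs s3 ''g'' = ?g"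
    using runs_rows[OF b2 g2] by (auto simp: runs_def)
  note ag3 = exec_agree_off[OF s3(1)]
  have b3: "base s3" using base_agree_off[OF ag3 b2] by simp
  have gd3: "graphs_done s3" using graphs_done_agree_off[OF ag3 s2(3)] by simp
  have gM: "regs s3 ''g'' < M" using M_bounds(9) by (simp add: s3(4))
  obtain t4 s4 where s4: "exec M ?E candidates_prog s3 t4 s4" "t4 \<le> 2 * (n * V) * 4 + 2"
    "\<And>a. a < 2 * (n * V) \<Longrightarrow> cells s4 ''W0'' a = ?g \<and> cells s4 ''S0'' a = ?g"
    using runs_candidates[OF b3 gM] by (auto simp: runs_def s3(4))
  note ag4 = exec_agree_off[OF s4(1)]
  have b4: "base s4" using base_agree_off[OF ag4 b3] by simp
  have gd4: "graphs_done s4" using graphs_done_agree_off[OF ag4 gd3] by simp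
  have rows4: "row_done i s4" if "i < n" for i
    using ag4 s3(3)[OF that] by (simp add: agree_off_def row_done_def row_targets_def)
  have z4: "cells s4 ''W1'' = (\<lambda>_. 0)" "cells s4 ''S1'' = (\<lambda>_. 0)"
    using ag4 ag3 ag2 z1 by (simp_all add: agree_off_def)
  note out = output_correct[OF b4 gd4 rows4 s4(3) refl z4]
  have ex: "exec M ?E reduction_prog ?s0 (t1 + (t2 + (t3 + t4))) s4"
    unfolding reduction_prog_def using s1(1) s2(1) s3(1) s4(1) by (intro exec.Seq)
  have "real (t1 + (t2 + (t3 + t4))) \<le> ?bound"
  proof -
    define X where "X = n * (L * N)"
    have "L * N \<le> X" "n \<le> X" "1 \<le> X" "m \<le> m * m" using n m L_pos N_pos by (simp_all add: X_def)
    moreover have "n * (100 * (L * N) + 2) + 2 = 100 * X + 2 * n + 2" "2 * (n * V) * 4 + 2 = 32 * X + 2"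
      by (simp_all add: X_def algebra_simps)
    ultimately have "t1 + (t2 + (t3 + t4)) \<le> 54 * (m * m) + 200 * X"
      using s1(2) s2(2) s3(2) s4(2) by linarith
    then have "real (t1 + (t2 + (t3 + t4))) \<le> real (54 * (m * m) + 200 * X)" by (rule of_nat_mono)
    also have "\<dots> = 54 * real (m * m) + 200 * (real n * real (L * N))" by (simp add: X_def)
    also have "\<dots> \<le> 54 * (real (m * m) * ?lg) + 200 * (real n * (8 * (real m * ?lg)))"
    proof (rule add_mono)
      show "54 * real (m * m) \<le> 54 * (real (m * m) * ?lg)"
        using mult_left_mono[OF lg, of "real (m * m)"] by simp
      show "200 * (real n * real (L * N)) \<le> 200 * (real n * (8 * (real m * ?lg)))"
        using size_bound by (intro mult_left_mono) auto
    qed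
    also have "\<dots> = (54 * real (m * m) + 1600 * real (n * m)) * ?lg" by (simp add: algebra_simps)
    also have "\<dots> \<le> (2000 * real (n * m + m * m)) * ?lg" using lg by (intro mult_right_mono) auto
    finally show ?thesis by simp
  qed
  moreover have "real V \<le> real 2000 * real m * ?lg"
  proof -
    have "real V = 4 * real (L * N)" by simp
    also have "\<dots> \<le> 32 * (real m * ?lg)" using size_bound by simp
    also have "\<dots> \<le> 2000 * (real m * ?lg)" using lg by (intro mult_right_mono) auto
    finally show ?thesis by simp
  qed
  ultimately have "?Q (t1 + (t2 + (t3 + t4))) s4"
    using out by simp
  then show "\<exists>t s. exec ((n + m) ^ 2000) ?E reduction_prog ?s0 t s \<and> ?Q t s"
    using ex unfolding M_def by blast
qed

end
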